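(* Let $G$ be a locally compact, second countable group with a fixed left Haar measure $\ell$ and modular function $\mu_G$. Let $\lambda$ be a $\sigma$-finite Borel measure on $\mathrm{Sub}_G$ such that $\lambda$-a.e. $H\in\mathrm{Sub}_G$ is discrete or compact. Then $\lambda$ is conjugation invariant if and only if $\mu_G|_H=1$ for $\lambda$-a.e. $H\in\mathrm{Sub}_G$, and for every nonnegative Borel function $f:\mathrm{Cos}_G\to\mathbb{R}$, $$\int_{\mathrm{Sub}_G}\int_{H\backslash G}f(Hg)\,\mu_G(Hg)\,d\nu_H(Hg)\,d\lambda(H)=\int_{\mathrm{Sub}_G}\int_{H\backslash G}f(g^{-1}H)\,d\nu_H(Hg)\,d\lambda(H).$$
   Context: Topological groups are Hausdorff. $\mathrm{Sub}_G$ is the space of closed subgroups of $G$ with the Chabauty topology, on which $G$ acts by conjugation $H\mapsto kHk^{-1}$. $\mathrm{Cos}_G=\{Hg: H\in\mathrm{Sub}_G,\ g\in G\}$ is the space of cosets of closed subgroups of $G$ (since $gH=(gHg^{-1})g$, left cosets and right cosets give the same set), with the Fell topology of closed subsets of $G$, i.e. the topology with subbasis $\{C:C\cap K=\emptyset\}$ ($K\subset G$ compact) and $\{C:C\cap U\ne\emptyset\}$ ($U\subset G$ open); its restriction to subgroups is the Chabauty topology. The modular function $\mu_G$ is defined by $\ell(S)=\mu_G(g)\,\ell(Sg)$ for every Borel $S\subset G$. When $\mu_G|_H=1$, $\mu_G$ is constant on each coset $Hg$, and $\mu_G(Hg)$ denotes the common value. The measures $\nu_H$ on $H\backslash G\subset\mathrm{Cos}_G$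 are defined as follows. If $H$ is compact, $\nu_H$ is the push forward of $\ell$ under $G\to H\backslash G$. If $H$ is discrete, $\nu_H$ is the local push forward of $\ell$ under the covering map $G\to H\backslash G$: if $U\subset H\backslash G$ is an evenly covered open set with preimage $V_1\sqcup V_2\sqcup\cdots$, then $\nu_H|_U$ is the push forward of $\ell|_{V_i}$ for every $i$. In both cases $\nu_H$ is characterized by $\ell=\int_{H\backslash G}\eta_{Hg}\,d\nu_H(Hg)$, where $\eta_{Hg}$ is the counting measure on $Hg$ if $H$ is discrete, and the unique left $H$-invariant probability measure on $Hg$ if $H$ is compact. For finite $H$ the two definitions differ by the factor $|H|$; one of the two conventions is fixed and used for all finite $H$. *)

theory Defs
  imports "HOL-Analysis.Analysis"
begin

text \<open>
  Groups are written additively, following the class \<^class>\<open>topological_group_add\<close>, whose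
  underlying class \<^class>\<open>group_add\<close> is not commutative. So \<open>H + g\<close> stands for the right
  coset \<open>Hg\<close>, \<open>- g + H\<close> for \<open>g\<^sup>-\<^sup>1H\<close> and \<open>k + H - k\<close> for \<open>kHk\<^sup>-\<^sup>1\<close>.
\<close>

section \<open>Closed subgroups, cosets and the Fell topology\<close>

definition closed_subgroups :: "'g::topological_group_add set set" where
  "closed_subgroups =
    {H. closed H \<and> 0 \<in> H \<and> (\<forall>x\<in>H. \<forall>y\<in>H. x + y \<in> H) \<and> (\<forall>x\<in>H. - x \<in> H)}"

definition rcoset :: "'g::group_add set \<Rightarrow> 'g \<Rightarrow> 'g set" where
  "rcoset H g = (\<lambda>h. h + g) ` H"

definition lcoset :: "'g::group_add \<Rightarrow> 'g set \<Rightarrow> 'g set" where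
  "lcoset g H = (\<lambda>h. g + h) ` H"

definition conjugate :: "'g::group_add \<Rightarrow> 'g set \<Rightarrow> 'g set" where
  "conjugate k H = (\<lambda>h. k + h - k) ` H"

definition coset_inverse :: "'g::group_add set \<Rightarrow> 'g set" where
  "coset_inverse C = uminus ` C"

text \<open>The map \<open>Hg \<mapsto> g\<^sup>-\<^sup>1H\<close> is well defined, being inversion of subsets:\<close>

lemma coset_inverse_rcoset:
  assumes "H \<in> closed_subgroups"
  shows "coset_inverse (rcoset H g) = lcoset (- g) H"
proof -
  have neg: "- h \<in> H" if "h \<in> H" for h
    using assms that by (simp add: closed_subgroups_def)
  have "uminus ` H = H"
    using neg by (force intro: image_eqI[where x = "- x" for x])
  then have "(\<lambda>h. - g + h) ` H = (\<lambda>h. - g + h) ` (uminus ` H)" by simp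
  then show ?thesis
    by (simp add: coset_inverse_def rcoset_def lcoset_def image_image minus_add)
qed

definition fell_topology :: "'g::topological_space set topology" where
  "fell_topology = topology_generated_by
     ({{C. closed C \<and> C \<inter> K = {}} | K. compact K} \<union>
      {{C. closed C \<and> C \<inter> U \<noteq> {}} | U. open U})"

definition chabauty_topology :: "'g::topological_group_add set topology" where
  "chabauty_topology = subtopology fell_topology closed_subgroups"

definition coset_topology :: "'g::topological_group_add set topology" where
  "coset_topology = subtopology fell_topology {rcoset H g | H g. H \<in> closed_subgroups}"

definition quotient_topology :: "'g::topological_group_add set \<Rightarrow> 'g set topology" where
  "quotient_topology H = subtopology coset_topology (range (rcoset H))"

definition borel_of :: "'a topology \<Rightarrow> 'a measure" where
  "borel_of X = sigma (topspace X) {U. openin X U}"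

definition conjugation_invariant :: "'g::topological_group_add set measure \<Rightarrow> bool" where
  "conjugation_invariant \<Lambda> \<longleftrightarrow>
     (\<forall>k. \<forall>A\<in>sets \<Lambda>. emeasure \<Lambda> (conjugate k ` A) = emeasure \<Lambda> A)"


section \<open>Haar measure and modular function\<close>

definition left_haar_measure :: "'g::topological_group_add measure \<Rightarrow> bool" where
  "left_haar_measure haar \<longleftrightarrow>
     sets haar = sets borel \<and>
     (\<forall>g. \<forall>S\<in>sets borel. emeasure haar ((\<lambda>x. g + x) ` S) = emeasure haar S) \<and>
     (\<forall>K. compact K \<longrightarrow> emeasure haar K < \<infinity>) \<and>
     (\<forall>U. open U \<longrightarrow> U \<noteq> {} \<longrightarrow> 0 < emeasure haar U)"

text \<open>The equation determines \<open>\<mu>\<close>, since some \<open>S\<close> has finite positive Haar measure.\<close>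

definition modular_function :: "'g::topological_group_add measure \<Rightarrow> ('g \<Rightarrow> real) \<Rightarrow> bool" where
  "modular_function haar \<mu> \<longleftrightarrow>
     (\<forall>g. 0 < \<mu> g \<and>
          (\<forall>S\<in>sets borel. emeasure haar S = ennreal (\<mu> g) * emeasure haar ((\<lambda>x. x + g) ` S)))"

text \<open>The common value of \<open>\<mu>\<close> on \<open>C\<close>, unspecified if \<open>\<mu>\<close> is not constant on \<open>C\<close>.\<close>

definition modular_on_coset :: "('g \<Rightarrow> real) \<Rightarrow> 'g set \<Rightarrow> real" where
  "modular_on_coset \<mu> C = (THE c. \<forall>x\<in>C. \<mu> x = c)"


section \<open>The measures on the coset spaces\<close>

text \<open>\<open>\<V>\<close> is the family of sheets over the evenly covered open set \<open>U\<close>.\<close>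

definition evenly_covered ::
    "'g::topological_group_add set \<Rightarrow> 'g set set \<Rightarrow> 'g set set \<Rightarrow> bool" where
  "evenly_covered H U \<V> \<longleftrightarrow>
     openin (quotient_topology H) U \<and>
     rcoset H -` U = \<Union>\<V> \<and> pairwise disjnt \<V> \<and>
     (\<forall>V\<in>\<V>. open V \<and>
        homeomorphic_map (top_of_set V) (subtopology (quotient_topology H) U) (rcoset H))"

definition local_push_forward ::
    "'g::topological_group_add measure \<Rightarrow> 'g set \<Rightarrow> 'g set measure \<Rightarrow> bool" where
  "local_push_forward haar H N \<longleftrightarrow>
     sets N = sets (borel_of (quotient_topology H)) \<and>
     (\<forall>U \<V>. evenly_covered H U \<V> \<longrightarrow>
        (\<forall>V\<in>\<V>. \<forall>A\<in>sets N. A \<subseteq> U \<longrightarrow> emeasure N A = emeasure haar (V \<inter> rcoset H -` A)))"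

text \<open>
  A finite \<open>H\<close> is both compact and discrete; the flag \<open>fin_discrete\<close> selects the convention
  used for all such \<open>H\<close>. The value is only meaningful if \<open>H\<close> is compact or discrete.
\<close>

definition coset_measure ::
    "bool \<Rightarrow> 'g::topological_group_add measure \<Rightarrow> 'g set \<Rightarrow> 'g set measure" where
  "coset_measure fin_discrete haar H =
     (if compact H \<and> \<not> (finite H \<and> fin_discrete)
      then distr haar (borel_of (quotient_topology H)) (rcoset H)
      else (THE N. local_push_forward haar H N))"

end

theory Submission
  imports Defs
begin

text \<open>
  The idea, in multiplicative notation. A function on \<open>H\<close>-cosets is integrated against \<open>\<nu>\<^sub>H\<close> by
  integrating a function on the group \<open>G\<close> against \<open>haar\<close>: if \<open>w\<close> is a function on \<open>G\<close> with sum \<open>1\<close> on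
  every coset of a discrete \<open>H\<close>, then \<open>\<integral> q(Hg) d\<nu>\<^sub>H = \<integral> w(g) q(Hg) dg\<close>, and for a compact \<open>H\<close> one takes
  \<open>w = 1\<close>; for a finite \<open>H\<close> the convention decides between the two (\<open>coset_measure_eq\<close>). The
  integral does not depend on the choice of \<open>w\<close>, by a mass transport argument on the cosets (\<open>mass_transport\<close>), and there is a choice that is jointly
  measurable in \<open>H\<close> and \<open>g\<close> (\<open>weight\<close>), because the number of points of a closed set in an
  open set is a Borel function of the closed set (\<open>num_points_eq_SUP\<close>).

  If \<open>\<Lambda>\<close> is conjugation invariant, then inverting \<open>g\<close>, which turns \<open>haar\<close> into \<open>\<mu> haar\<close>, and conjugating
  \<open>H\<close> by \<open>g\<close> under the integral over \<open>\<Lambda>\<close> shows that \<open>\<Phi>(H, g) \<mu>(g)\<close> and \<open>\<Phi>(g\<^sup>-\<^sup>1Hg, g\<^sup>-\<^sup>1)\<close> have the same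
  integral over all pairs \<open>(H, g)\<close> (\<open>nn_integral_invert_conjugate\<close>). As \<open>(Hg)\<^sup>-\<^sup>1 = (g\<^sup>-\<^sup>1Hg)g\<^sup>-\<^sup>1\<close>, this is
  the identity on cosets if \<open>\<Phi>(H, g)\<close> is \<open>f(Hg)\<close> times the weight of \<open>g\<close> in \<open>Hg\<close>. It also forces
  \<open>\<mu> = 1\<close> on almost every \<open>H\<close>: if \<open>\<mu>\<close> took values at most \<open>a\<close> and at least \<open>b > a\<close> on the same coset,
  for a set of cosets of positive finite mass, then concentrating the weights on the points of the
  first or of the second kind would give totals that differ on the left but agree on the right
  (\<open>AE_coset_not_meeting_both\<close>).

  Conversely, compare the identity for \<open>f\<close> and for its right translate \<open>C \<mapsto> f(Ck)\<close>. The left sides agree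
  because \<open>\<mu> haar\<close> is right invariant. The right side for the translate is that for \<open>f\<close> with \<open>H\<close>
  replaced by \<open>k\<^sup>-\<^sup>1Hk\<close>. Since \<open>H = C\<^sup>-\<^sup>1C\<close> for \<open>C = g\<^sup>-\<^sup>1H\<close>, the function \<open>f\<close> can be chosen such that its
  inner integral on the right is the indicator function of any given Borel set of subgroups
  (\<open>invariant_if_coset_identity\<close>); hence \<open>\<Lambda>\<close> is invariant under conjugation by \<open>k\<close>.
\<close>

section \<open>Borel sets of the Fell topology\<close>

lemma topspace_fell: "topspace fell_topology = {C. closed C}"
proof -
  have "{C. closed C} = {C. closed C \<and> C \<inter> {} = ({} :: 'a set)}" by auto
  then have "{C::'a set. closed C} \<in> {{C. closed C \<and> C \<inter> K = {}} | K. compact K}"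
    using compact_empty by blast
  then show ?thesis
    unfolding fell_topology_def topology_generated_by_topspace by auto
qed

lemma openin_fell_hit: "open U \<Longrightarrow> openin fell_topology {C. closed C \<and> C \<inter> U \<noteq> {}}"
  unfolding fell_topology_def by (rule topology_generated_by_Basis) auto

text \<open>Missing a compact set is the same as missing one of the finite unions of basic open sets
  that cover it. Hence Fell open sets are countable unions of sets that are defined by finitely
  many conditions of hitting or missing a basic open set, although the latter need not be open.\<close>

lemma fell_open_countable_union:
  fixes W :: "'a::second_countable_topology set set"
  assumes "openin fell_topology W"
  obtains \<D> where "countable \<D>"
    and "\<And>P N. (P, N) \<in> \<D> \<Longrightarrow> finite P \<and> finite N \<and> (\<forall>B\<in>P \<union> N. open B)"
    and "W = {C. closed C \<and> (\<exists>(P, N)\<in>\<D>. (\<forall>B\<in>P. C \<inter> B \<noteq> {}) \<and> (\<forall>B\<in>N. C \<inter> B = {}))}"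
proof -
  obtain \<B> :: "'a set set" where \<B>: "countable \<B>" "topological_basis \<B>"
    using ex_countable_basis by auto
  define fits where "fits P N C \<longleftrightarrow> (\<forall>B\<in>P. C \<inter> B \<noteq> {}) \<and> (\<forall>B\<in>N. C \<inter> B = {})"
    for P N :: "'a set set" and C
  define \<F> where "\<F> = {A. finite A \<and> A \<subseteq> \<B>}"
  define ins where "ins P N W \<longleftrightarrow> (\<forall>D. closed D \<longrightarrow> fits P N D \<longrightarrow> D \<in> W)" for P N W
  define loc where "loc W \<longleftrightarrow> (\<forall>C\<in>W. \<exists>P\<in>\<F>. \<exists>N\<in>\<F>. fits P N C \<and> ins P N W)" for W
  have "loc W"
    using assms unfolding fell_topology_def openin_topology_generated_by_iff
  proof induction
    case Empty
    then show ?case by (simp add: loc_def)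
  next
    case (Int a b)
    show ?case unfolding loc_def
    proof
      fix C assume C: "C \<in> a \<inter> b"
      from C Int(3) obtain P N where PN: "P \<in> \<F>" "N \<in> \<F>" "fits P N C" "ins P N a"
        unfolding loc_def by blast
      from C Int(4) obtain P' N' where PN': "P' \<in> \<F>" "N' \<in> \<F>" "fits P' N' C" "ins P' N' b"
        unfolding loc_def by blast
      have "P \<union> P' \<in> \<F>" "N \<union> N' \<in> \<F>" using PN PN' by (auto simp: \<F>_def)
      moreover have "fits (P \<union> P') (N \<union> N') C" using PN(3) PN'(3) unfolding fits_def by blast
      moreover have "ins (P \<union> P') (N \<union> N') (a \<inter> b)"
        using PN(4) PN'(4) unfolding ins_def fits_def by (simp add: ball_Un)
      ultimately show "\<exists>P\<in>\<F>. \<exists>N\<in>\<F>. fits P N C \<and> ins P N (a \<inter> b)" by blast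
    qed
  next
    case (UN K)
    show ?case unfolding loc_def
    proof
      fix C assume "C \<in> \<Union>K"
      then obtain k where k: "k \<in> K" "C \<in> k" by auto
      with UN(2)[of k] obtain P N where PN: "P \<in> \<F>" "N \<in> \<F>" "fits P N C" "ins P N k"
        unfolding loc_def by blast
      moreover have "ins P N (\<Union>K)" using PN(4) k(1) unfolding ins_def by blast
      ultimately show "\<exists>P\<in>\<F>. \<exists>N\<in>\<F>. fits P N C \<and> ins P N (\<Union>K)" by blast
    qed
  next
    case (Basis s)
    then consider K where "compact K" "s = {C. closed C \<and> C \<inter> K = {}}"
      | U where "open U" "s = {C. closed C \<and> C \<inter> U \<noteq> {}}" by blast
    then show ?case
    proof cases
      case 1
      show ?thesis unfolding loc_def
      proof
        fix C assume "C \<in> s"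
        then have C: "open (- C)" "K \<subseteq> - C" using 1 by auto
        have "x \<in> \<Union>{B\<in>\<B>. B \<subseteq> - C}" if "x \<in> K" for x
        proof -
          have "x \<in> - C" using C(2) that by blast
          then show ?thesis by (rule topological_basisE[OF \<B>(2) C(1)]) blast
        qed
        then have cover: "K \<subseteq> \<Union>{B\<in>\<B>. B \<subseteq> - C}" by blast
        have op: "open B" if "B \<in> {B\<in>\<B>. B \<subseteq> - C}" for B
          using topological_basis_open[OF \<B>(2)] that by simp
        obtain N where N: "N \<subseteq> {B\<in>\<B>. B \<subseteq> - C}" "finite N" "K \<subseteq> \<Union>N"
          by (rule compactE[OF 1(1) cover op]) (assumption, rule that)
        have "{} \<in> \<F>" "N \<in> \<F>" "fits {} N C" using N by (auto simp: \<F>_def fits_def)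
        moreover have "ins {} N s"
          using N(3) 1(2) unfolding ins_def fits_def by blast
        ultimately show "\<exists>P\<in>\<F>. \<exists>N\<in>\<F>. fits P N C \<and> ins P N s"
          by blast
      qed
    next
      case 2
      show ?thesis unfolding loc_def
      proof
        fix C assume "C \<in> s"
        then obtain x where x: "x \<in> C" "x \<in> U" using 2 by auto
        then obtain B where B: "B \<in> \<B>" "x \<in> B" "B \<subseteq> U"
          using topological_basisE[OF \<B>(2) 2(1) x(2)] by metis
        have "{B} \<in> \<F>" "{} \<in> \<F>" "fits {B} {} C" using B x by (auto simp: \<F>_def fits_def)
        moreover have "ins {B} {} s"
          using B(3) 2(2) unfolding ins_def fits_def by blast
        ultimately show "\<exists>P\<in>\<F>. \<exists>N\<in>\<F>. fits P N C \<and> ins P N s"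
          by blast
      qed
    qed
  qed
  have W: "W \<subseteq> {C. closed C}" using openin_subset[OF assms] by (simp add: topspace_fell)
  define \<D> where "\<D> = {(P, N) \<in> \<F> \<times> \<F>. ins P N W}"
  show thesis
  proof
    have "countable \<F>" unfolding \<F>_def by (rule countable_Collect_finite_subset[OF \<B>(1)])
    then have "countable (\<F> \<times> \<F>)" by auto
    then show "countable \<D>" unfolding \<D>_def by (rule countable_subset[rotated]) auto
    show "finite P \<and> finite N \<and> (\<forall>B\<in>P \<union> N. open B)" if "(P, N) \<in> \<D>" for P N
      using that topological_basis_open[OF \<B>(2)] by (auto simp: \<D>_def \<F>_def)
    have "W = {C. closed C \<and> (\<exists>(P, N)\<in>\<D>. fits P N C)}"
    proof (intro set_eqI iffI)
      fix C assume "C \<in> W"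
      then show "C \<in> {C. closed C \<and> (\<exists>(P, N)\<in>\<D>. fits P N C)}"
        using \<open>loc W\<close> W unfolding loc_def \<D>_def by fastforce
    qed (auto simp: \<D>_def ins_def)
    then show "W = {C. closed C \<and> (\<exists>(P, N)\<in>\<D>. (\<forall>B\<in>P. C \<inter> B \<noteq> {}) \<and> (\<forall>B\<in>N. C \<inter> B = {}))}"
      by (simp add: fits_def)
  qed
qed

lemma space_borel_of [simp]: "space (borel_of X) = topspace X"
  unfolding borel_of_def by (rule space_measure_of) (auto dest: openin_subset)

lemma sets_borel_of: "sets (borel_of X) = sigma_sets (topspace X) {U. openin X U}"
  unfolding borel_of_def by (rule sets_measure_of) (auto dest: openin_subset)

lemma openin_sets_borel_of: "openin X U \<Longrightarrow> U \<in> sets (borel_of X)"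
  unfolding sets_borel_of by (rule sigma_sets.Basic) simp

text \<open>So the hitting sets of open sets generate the Borel \<open>\<sigma>\<close>-algebra of any subspace of the Fell
  topology, and all measurability proofs below only have to consider hitting sets.\<close>

lemma measurable_into_fell_subspace:
  fixes f :: "'b \<Rightarrow> 'a::second_countable_topology set"
  assumes f: "\<And>x. x \<in> space M \<Longrightarrow> f x \<in> X" "\<And>x. x \<in> space M \<Longrightarrow> closed (f x)"
    and hit: "\<And>U. open U \<Longrightarrow> {x\<in>space M. f x \<inter> U \<noteq> {}} \<in> sets M"
  shows "f \<in> measurable M (borel_of (subtopology fell_topology X))"
  unfolding borel_of_def
proof (rule measurable_measure_of)
  show "{U. openin (subtopology fell_topology X) U} \<subseteq> Pow (topspace (subtopology fell_topology X))"
    using openin_subset by blast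
  show "f \<in> space M \<rightarrow> topspace (subtopology fell_topology X)"
    using f by (auto simp: topspace_fell)
  fix Y assume "Y \<in> {U. openin (subtopology fell_topology X) U}"
  then obtain W where W: "openin fell_topology W" "Y = W \<inter> X"
    by (auto simp: openin_subtopology)
  obtain \<D> where \<D>: "countable \<D>"
    and fin: "\<And>P N. (P, N) \<in> \<D> \<Longrightarrow> finite P \<and> finite N \<and> (\<forall>B\<in>P \<union> N. open B)"
    and eq: "W = {C. closed C \<and> (\<exists>(P, N)\<in>\<D>. (\<forall>B\<in>P. C \<inter> B \<noteq> {}) \<and> (\<forall>B\<in>N. C \<inter> B = {}))}"
    by (rule fell_open_countable_union[OF W(1)]) (rule that)
  have miss: "{x\<in>space M. f x \<inter> U = {}} \<in> sets M" if "open U" for U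
  proof -
    have "{x\<in>space M. f x \<inter> U = {}} = space M - {x\<in>space M. f x \<inter> U \<noteq> {}}" by auto
    then show ?thesis using hit[OF that] by auto
  qed
  have "f -` Y \<inter> space M = {x\<in>space M. \<exists>PN\<in>\<D>. (\<forall>B\<in>fst PN. f x \<inter> B \<noteq> {}) \<and> (\<forall>B\<in>snd PN. f x \<inter> B = {})}"
    using f W(2) eq by (auto simp: case_prod_beta)
  also have "\<dots> \<in> sets M"
  proof (rule sets.sets_Collect_countable_Ex'[OF _ \<D>])
    fix PN assume "PN \<in> \<D>"
    then have *: "finite (fst PN)" "finite (snd PN)" "\<And>B. B \<in> fst PN \<union> snd PN \<Longrightarrow> open B"
      using fin[of "fst PN" "snd PN"] by auto
    show "{x\<in>space M. (\<forall>B\<in>fst PN. f x \<inter> B \<noteq> {}) \<and> (\<forall>B\<in>snd PN. f x \<inter> B = {})} \<in> sets M"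
      by (rule sets.sets_Collect_conj; rule sets.sets_Collect_countable_All')
        (use * in \<open>auto intro: hit miss countable_finite\<close>)
  qed
  finally show "f -` Y \<inter> space M \<in> sets M" .
qed

lemma measurable_into_fell:
  fixes f :: "'b \<Rightarrow> 'a::second_countable_topology set"
  assumes "\<And>x. x \<in> space M \<Longrightarrow> closed (f x)"
    and "\<And>U. open U \<Longrightarrow> {x\<in>space M. f x \<inter> U \<noteq> {}} \<in> sets M"
  shows "f \<in> measurable M (borel_of fell_topology)"
  using measurable_into_fell_subspace[of M f UNIV, OF UNIV_I assms] unfolding subtopology_UNIV .

lemma sets_fell_hit: "open U \<Longrightarrow> {C. closed C \<and> C \<inter> U \<noteq> {}} \<in> sets (borel_of fell_topology)"
  by (rule openin_sets_borel_of[OF openin_fell_hit])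

lemma measurable_from_fell_subspace:
  fixes X :: "'a::second_countable_topology set set"
  shows "(\<lambda>C. C) \<in> measurable (borel_of (subtopology fell_topology X)) (borel_of fell_topology)"
proof (rule measurable_into_fell)
  fix U :: "'a set" assume "open U"
  then have "openin (subtopology fell_topology X) (X \<inter> {C. closed C \<and> C \<inter> U \<noteq> {}})"
    by (intro openin_subtopology_Int2 openin_fell_hit)
  moreover have "{C \<in> space (borel_of (subtopology fell_topology X)). C \<inter> U \<noteq> {}}
      = X \<inter> {C. closed C \<and> C \<inter> U \<noteq> {}}"
    by (auto simp: topspace_fell)
  ultimately show "{C \<in> space (borel_of (subtopology fell_topology X)). C \<inter> U \<noteq> {}}
      \<in> sets (borel_of (subtopology fell_topology X))"
    using openin_sets_borel_of by metis
qed (simp add: topspace_fell)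

section \<open>Counting the points of a closed set in an open set\<close>

definition num_points :: "'a set \<Rightarrow> 'a set \<Rightarrow> ennreal" where
  "num_points U C = emeasure (count_space UNIV) (C \<inter> U)"

lemma num_points_eq: "num_points U C = (if finite (C \<inter> U) then of_nat (card (C \<inter> U)) else \<infinity>)"
  unfolding num_points_def by (rule emeasure_count_space) simp

lemma num_points_pos_iff: "0 < num_points U C \<longleftrightarrow> C \<inter> U \<noteq> {}"
  by (auto simp: num_points_eq)

lemma num_points_finite_iff: "num_points U C < \<infinity> \<longleftrightarrow> finite (C \<inter> U)"
  by (auto simp: num_points_eq less_top[symmetric])

lemma finite_set_separated:
  fixes F :: "'a::t2_space set"
  assumes "finite F" "F \<subseteq> U" "open U" "topological_basis \<B>"
  obtains b where "\<And>x. x \<in> F \<Longrightarrow> x \<in> b x \<and> b x \<subseteq> U \<and> b x \<in> \<B>"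
    "\<And>x y. x \<in> F \<Longrightarrow> y \<in> F \<Longrightarrow> x \<noteq> y \<Longrightarrow> b x \<inter> b y = {}"
proof -
  have "\<forall>x y. \<exists>V. x \<noteq> y \<longrightarrow> open (fst V) \<and> open (snd V) \<and> x \<in> fst V \<and> y \<in> snd V \<and> fst V \<inter> snd V = ({}::'a set)"
    using hausdorff by (metis fst_conv snd_conv)
  then obtain V where V: "\<And>x y::'a. x \<noteq> y \<Longrightarrow> open (fst (V x y)) \<and> open (snd (V x y)) \<and>
      x \<in> fst (V x y) \<and> y \<in> snd (V x y) \<and> fst (V x y) \<inter> snd (V x y) = {}"
    by metis
  define O' where "O' x = U \<inter> (\<Inter>y\<in>F - {x}. fst (V x y) \<inter> snd (V y x))" for x
  have O': "open (O' x)" "x \<in> O' x" if "x \<in> F" for x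
  proof -
    have "open (\<Inter>y\<in>F - {x}. fst (V x y) \<inter> snd (V y x))"
      using assms(1) V by (intro open_INT open_Int) auto
    then show "open (O' x)" using assms(3) by (auto simp: O'_def)
    show "x \<in> O' x" unfolding O'_def
    proof (intro IntI INT_I)
      show "x \<in> U" using that assms(2) by blast
      fix y assume "y \<in> F - {x}"
      then show "x \<in> fst (V x y)" "x \<in> snd (V y x)" using V[of x y] V[of y x] by auto
    qed
  qed
  have "\<exists>B. B \<in> \<B> \<and> x \<in> B \<and> B \<subseteq> O' x" if "x \<in> F" for x
    by (rule topological_basisE[OF assms(4) O'(1)[OF that] O'(2)[OF that]]) blast
  then obtain b where b: "\<And>x. x \<in> F \<Longrightarrow> b x \<in> \<B> \<and> x \<in> b x \<and> b x \<subseteq> O' x"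
    by metis
  show thesis
  proof
    show "x \<in> b x \<and> b x \<subseteq> U \<and> b x \<in> \<B>" if "x \<in> F" for x
      using b[OF that] by (auto simp: O'_def)
    show "b x \<inter> b y = {}" if "x \<in> F" "y \<in> F" "x \<noteq> y" for x y
    proof -
      have "b x \<subseteq> fst (V x y)" "b y \<subseteq> snd (V x y)"
        using b[OF that(1)] b[OF that(2)] that unfolding O'_def by blast+
      then show ?thesis using V[OF that(3)] by blast
    qed
  qed
qed

text \<open>By the Hausdorff property, \<open>C\<close> has at least \<open>n\<close> points in \<open>U\<close> iff it meets \<open>n\<close> disjoint
  basic open subsets of \<open>U\<close>. So counting points is a countable supremum of Borel functions.\<close>

lemma num_points_eq_SUP:
  fixes U :: "'a::t2_space set"
  assumes "open U" "topological_basis \<B>"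
  shows "num_points U C = (SUP F \<in> {F. finite F \<and> F \<subseteq> \<B> \<and> disjoint F \<and> \<Union>F \<subseteq> U}.
    \<Sum>B\<in>F. indicator {C. C \<inter> B \<noteq> {}} C)" (is "_ = (SUP F \<in> ?\<F>. ?n F)")
proof (rule antisym)
  have *: "of_nat (card F) \<le> (SUP F \<in> ?\<F>. ?n F)" if F: "finite F" "F \<subseteq> C \<inter> U" for F
  proof -
    obtain b where b: "\<And>x. x \<in> F \<Longrightarrow> x \<in> b x \<and> b x \<subseteq> U \<and> b x \<in> \<B>"
      "\<And>x y. x \<in> F \<Longrightarrow> y \<in> F \<Longrightarrow> x \<noteq> y \<Longrightarrow> b x \<inter> b y = {}"
      using finite_set_separated[of F U \<B>] F assms by auto
    have inj: "inj_on b F" by (rule inj_onI) (use b in blast)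
    have "disjoint (b ` F)"
    proof (rule disjointI)
      fix A B assume "A \<in> b ` F" "B \<in> b ` F" "A \<noteq> B"
      then show "A \<inter> B = {}" using b(2) by auto
    qed
    moreover have "finite (b ` F)" "b ` F \<subseteq> \<B>" "\<Union>(b ` F) \<subseteq> U"
      using b(1) F(1) by auto
    ultimately have "b ` F \<in> ?\<F>" by blast
    moreover have "?n (b ` F) = (\<Sum>B\<in>b ` F. 1)"
    proof (rule sum.cong)
      fix B assume "B \<in> b ` F"
      then obtain x where "x \<in> F" "B = b x" by blast
      then have "C \<inter> B \<noteq> {}" using b(1) F(2) by blast
      then show "indicator {C. C \<inter> B \<noteq> {}} C = (1::ennreal)" by simp
    qed simp
    then have "?n (b ` F) = of_nat (card F)" using card_image[OF inj] by simp
    ultimately show ?thesis by (metis (no_types, lifting) SUP_upper)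
  qed
  show "num_points U C \<le> (SUP F \<in> ?\<F>. ?n F)"
  proof (cases "finite (C \<inter> U)")
    case True
    then show ?thesis using *[OF True] by (simp add: num_points_eq)
  next
    case False
    have "of_nat n \<le> (SUP F \<in> ?\<F>. ?n F)" for n
    proof -
      obtain F where "finite F" "card F = n" "F \<subseteq> C \<inter> U"
        using infinite_arbitrarily_large[OF False] by blast
      then show ?thesis using * by blast
    qed
    then have "\<not> (SUP F \<in> ?\<F>. ?n F) < top"
      using ennreal_Ex_less_of_nat[of "SUP F \<in> ?\<F>. ?n F"] leD by blast
    then have *: "(SUP F \<in> ?\<F>. ?n F) = top"
      using less_top[of "SUP F \<in> ?\<F>. ?n F"] by blast
    show ?thesis unfolding * by (rule top_greatest)
  qed
  show "(SUP F \<in> ?\<F>. ?n F) \<le> num_points U C"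
  proof (rule SUP_least)
    fix F assume F: "F \<in> ?\<F>"
    show "?n F \<le> num_points U C"
    proof (cases "finite (C \<inter> U)")
      case True
      define F' where "F' = {B\<in>F. C \<inter> B \<noteq> {}}"
      have "?n F = of_nat (card F')"
        unfolding F'_def using F sum_of_bool_eq[of F "\<lambda>B. C \<inter> B \<noteq> {}"]
        by (simp add: indicator_def Int_def del: sum_of_bool_eq)
      moreover have "card F' \<le> card (C \<inter> U)"
      proof (rule surj_card_le[OF True, of F' "\<lambda>x. SOME B. B \<in> F \<and> x \<in> B"])
        show "F' \<subseteq> (\<lambda>x. SOME B. B \<in> F \<and> x \<in> B) ` (C \<inter> U)"
        proof
          fix B assume "B \<in> F'"
          then obtain x where x: "x \<in> C" "x \<in> B" "B \<in> F" by (auto simp: F'_def)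
          have "(SOME B. B \<in> F \<and> x \<in> B) = B"
            by (rule some_equality) (use x F in \<open>auto simp: disjoint_def\<close>)
          moreover have "x \<in> C \<inter> U" using x F by auto
          ultimately show "B \<in> (\<lambda>x. SOME B. B \<in> F \<and> x \<in> B) ` (C \<inter> U)" by force
        qed
      qed
      ultimately show ?thesis using True by (simp add: num_points_eq)
    qed (simp add: num_points_eq)
  qed
qed

lemma measurable_num_points:
  fixes U :: "'a::{t2_space, second_countable_topology} set"
  assumes "open U"
  shows "num_points U \<in> borel_measurable (borel_of fell_topology)"
proof -
  obtain \<B> :: "'a set set" where \<B>: "countable \<B>" "topological_basis \<B>"
    using ex_countable_basis by auto
  let ?\<F> = "{F. finite F \<and> F \<subseteq> \<B> \<and> disjoint F \<and> \<Union>F \<subseteq> U}"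
  have "(\<lambda>C. SUP F \<in> ?\<F>. \<Sum>B\<in>F. indicator {C. C \<inter> B \<noteq> {}} C :: ennreal)
      \<in> borel_measurable (borel_of fell_topology)"
  proof (rule borel_measurable_SUP)
    show "countable ?\<F>"
      by (rule countable_subset[OF _ countable_Collect_finite_subset[OF \<B>(1)]]) auto
    fix F assume F: "F \<in> ?\<F>"
    show "(\<lambda>C. \<Sum>B\<in>F. indicator {C. C \<inter> B \<noteq> {}} C :: ennreal) \<in> borel_measurable (borel_of fell_topology)"
    proof (rule borel_measurable_sum)
      fix B assume "B \<in> F"
      then have "open B" using F topological_basis_open[OF \<B>(2)] by auto
      then show "(\<lambda>C. indicator {C. C \<inter> B \<noteq> {}} C :: ennreal) \<in> borel_measurable (borel_of fell_topology)"
        using sets_fell_hit[of B] by (intro borel_measurable_indicator') (auto simp: topspace_fell)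
    qed
  qed
  then show ?thesis
    using num_points_eq_SUP[OF assms \<B>(2)] by (simp cong: measurable_cong)
qed

section \<open>Cosets and conjugates of closed subgroups\<close>

lemmas group_arith = add.assoc minus_add diff_conv_add_uminus

lemma closed_subgroupD:
  assumes "H \<in> closed_subgroups"
  shows "closed H" "0 \<in> H" "x \<in> H \<Longrightarrow> y \<in> H \<Longrightarrow> x + y \<in> H" "x \<in> H \<Longrightarrow> - x \<in> H"
    "x \<in> H \<Longrightarrow> y \<in> H \<Longrightarrow> x - y \<in> H"
  using assms unfolding closed_subgroups_def diff_conv_add_uminus by blast+

lemma minus_mem_iff: "H \<in> closed_subgroups \<Longrightarrow> - x \<in> H \<longleftrightarrow> x \<in> H"
  using closed_subgroupD(4)[of H x] closed_subgroupD(4)[of H "- x"] by auto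

lemma mem_rcoset: "x \<in> rcoset H g \<longleftrightarrow> x - g \<in> H"
  unfolding rcoset_def by (force simp: image_iff)

lemma mem_translate_left: "x \<in> (\<lambda>y. a + y) ` S \<longleftrightarrow> - a + x \<in> S" for a :: "'a::group_add"
  by (force simp: image_iff simp flip: add.assoc)

lemma mem_translate_right: "x \<in> (\<lambda>y. y + a) ` S \<longleftrightarrow> x - a \<in> S" for a :: "'a::group_add"
  by (force simp: image_iff)

lemma mem_conjugate: "x \<in> conjugate k H \<longleftrightarrow> - k + x + k \<in> H"
proof
  assume "x \<in> conjugate k H"
  then obtain h where "h \<in> H" "x = k + h - k" by (auto simp: conjugate_def)
  then show "- k + x + k \<in> H" by (simp add: group_arith del: add_uminus_conv_diff)
next
  assume "- k + x + k \<in> H"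
  moreover have "x = k + (- k + x + k) - k" by (simp add: group_arith del: add_uminus_conv_diff)
  ultimately show "x \<in> conjugate k H" unfolding conjugate_def by blast
qed

lemma mem_coset_inverse: "x \<in> coset_inverse C \<longleftrightarrow> - x \<in> C"
  unfolding coset_inverse_def by (metis image_iff minus_minus)

lemma conjugate_conjugate: "conjugate a (conjugate b H) = conjugate (a + b) H"
  by (auto simp: mem_conjugate group_arith simp del: add_uminus_conv_diff)

lemma conjugate_zero [simp]: "conjugate 0 H = H"
  by (auto simp: mem_conjugate)

lemma rcoset_add: "H \<in> closed_subgroups \<Longrightarrow> h \<in> H \<Longrightarrow> rcoset H (h + g) = rcoset H g"
proof (intro set_eqI)
  fix x assume H: "H \<in> closed_subgroups" "h \<in> H"
  have eq: "x - (h + g) = (x - g) - h" "x - g = (x - (h + g)) + h"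
    by (simp_all add: group_arith del: add_uminus_conv_diff)
  show "x \<in> rcoset H (h + g) \<longleftrightarrow> x \<in> rcoset H g"
    unfolding mem_rcoset using closed_subgroupD(3,5)[OF H(1)] H(2) eq by metis
qed

lemma rcoset_eqI: "H \<in> closed_subgroups \<Longrightarrow> x \<in> rcoset H g \<Longrightarrow> rcoset H x = rcoset H g"
  using rcoset_add[of H "x - g" g] by (simp add: mem_rcoset)

lemma self_mem_rcoset: "H \<in> closed_subgroups \<Longrightarrow> g \<in> rcoset H g"
  by (simp add: mem_rcoset closed_subgroupD)

lemma rcoset_zero [simp]: "rcoset H 0 = H"
  by (auto simp: mem_rcoset)

lemma coset_inverse_eq_rcoset:
  assumes "H \<in> closed_subgroups"
  shows "coset_inverse (rcoset H g) = rcoset (conjugate (- g) H) (- g)"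
proof (intro set_eqI)
  fix x
  have "g + x - - g + - g = - (- x - g)"
    by (simp add: group_arith del: add_uminus_conv_diff)
  then have "g + (x - - g) + - g = - (- x - g)" by (simp add: group_arith del: add_uminus_conv_diff)
  then show "x \<in> coset_inverse (rcoset H g) \<longleftrightarrow> x \<in> rcoset (conjugate (- g) H) (- g)"
    unfolding mem_coset_inverse mem_rcoset mem_conjugate minus_minus
    using minus_mem_iff[OF assms, of "- x - g"] by simp
qed

lemma rcoset_rcoset: "(\<lambda>x. x + k) ` rcoset H g = rcoset H (g + k)"
  by (intro set_eqI) (simp add: mem_rcoset mem_translate_right group_arith del: add_uminus_conv_diff)

lemma open_translate_left: "open U \<Longrightarrow> open ((\<lambda>x. a + x) ` U)" for a :: "'a::topological_group_add"
proof -
  assume "open U"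
  then have "open ((\<lambda>x. - a + x) -` U)" by (intro open_vimage continuous_intros)
  moreover have "(\<lambda>x. a + x) ` U = (\<lambda>x. - a + x) -` U" by (intro set_eqI) (simp add: mem_translate_left)
  ultimately show ?thesis by simp
qed

lemma open_translate_right: "open U \<Longrightarrow> open ((\<lambda>x. x + a) ` U)" for a :: "'a::topological_group_add"
proof -
  assume "open U"
  then have "open ((\<lambda>x. x + - a) -` U)" by (intro open_vimage continuous_intros)
  moreover have "(\<lambda>x. x + a) ` U = (\<lambda>x. x + - a) -` U"
    by (intro set_eqI) (simp only: mem_translate_right vimage_eq diff_conv_add_uminus)
  ultimately show ?thesis by simp
qed

lemma continuous_diff_group: "continuous_on S f \<Longrightarrow> continuous_on S g \<Longrightarrow> continuous_on S (\<lambda>x. f x - g x)"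
  for f g :: "'b::topological_space \<Rightarrow> 'a::topological_group_add"
  unfolding diff_conv_add_uminus by (intro continuous_intros)

lemma closed_rcoset: "closed H \<Longrightarrow> closed (rcoset H g)"
  for g :: "'a::topological_group_add"
proof -
  assume "closed H"
  then have "closed ((\<lambda>x. x - g) -` H)" by (intro closed_vimage continuous_diff_group continuous_intros)
  moreover have "rcoset H g = (\<lambda>x. x - g) -` H" by (auto simp: mem_rcoset)
  ultimately show ?thesis by simp
qed

lemma conjugate_closed_subgroup:
  assumes H: "H \<in> closed_subgroups"
  shows "conjugate k H \<in> closed_subgroups"
proof -
  have "closed ((\<lambda>x. - k + x + k) -` H)"
    using closed_subgroupD(1)[OF H] by (intro closed_vimage continuous_intros)
  moreover have "conjugate k H = (\<lambda>x. - k + x + k) -` H" by (auto simp: mem_conjugate)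
  moreover have "- k + (x + y) + k = (- k + x + k) + (- k + y + k)" "- k + - x + k = - (- k + x + k)" for x y
    by (simp_all add: group_arith del: add_uminus_conv_diff)
  ultimately show ?thesis
    using closed_subgroupD(2-4)[OF H] unfolding closed_subgroups_def
    by (auto simp: mem_conjugate)
qed

lemma compact_conjugate_iff: "compact (conjugate k H) \<longleftrightarrow> compact H" for k :: "'a::topological_group_add"
proof -
  have *: "compact H \<Longrightarrow> compact (conjugate k H)" for k :: 'a and H
    unfolding conjugate_def
    by (intro compact_continuous_image continuous_diff_group continuous_intros)
  from *[of H k] *[of "conjugate k H" "- k"] show ?thesis
    by (auto simp: conjugate_conjugate)
qed

lemma compact_rcoset_iff: "compact (rcoset H g) \<longleftrightarrow> compact H" for g :: "'a::topological_group_add"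
proof -
  have *: "compact H \<Longrightarrow> compact ((\<lambda>x. x + g) ` H)" for g :: 'a and H
    by (intro compact_continuous_image continuous_intros)
  from *[of H g] *[of "rcoset H g" "- g"] show ?thesis
    by (auto simp: rcoset_def image_image group_arith simp del: add_uminus_conv_diff)
qed

lemma finite_rcoset_iff: "finite (rcoset H g) \<longleftrightarrow> finite H"
  unfolding rcoset_def by (rule finite_image_iff) (simp add: inj_on_def)

lemma finite_conjugate_iff: "finite (conjugate k H) \<longleftrightarrow> finite H"
proof -
  have *: "finite H \<Longrightarrow> finite (conjugate k H)" for k :: 'a and H unfolding conjugate_def by simp
  from *[of H k] *[of "conjugate k H" "- k"] show ?thesis by (auto simp: conjugate_conjugate)
qed

lemma discrete_translate:
  fixes g :: "'a::topological_group_add"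
  assumes "discrete H" shows "discrete (rcoset H g)"
proof (rule discreteI)
  fix x assume x: "x \<in> rcoset H g"
  then have "(x - g) isolated_in H" using assms by (auto simp: mem_rcoset discrete_def)
  then obtain T where T: "open T" "T \<inter> H = {x - g}" by (auto simp: isolated_in_def)
  have "(\<lambda>y. y + g) ` T \<inter> rcoset H g = (\<lambda>y. y + g) ` (T \<inter> H)"
    by (auto simp: rcoset_def)
  then have "(\<lambda>y. y + g) ` T \<inter> rcoset H g = {x}" unfolding T(2) by simp
  then show "x isolated_in rcoset H g"
    using isolated_inI[OF x open_translate_right[OF T(1)]] by blast
qed

lemma discrete_conjugate:
  fixes k :: "'a::topological_group_add"
  assumes "discrete H" shows "discrete (conjugate k H)"
proof (rule discreteI)
  fix x assume x: "x \<in> conjugate k H"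
  then have "(- k + x + k) isolated_in H" using assms by (auto simp: mem_conjugate discrete_def)
  then obtain T where T: "open T" "T \<inter> H = {- k + x + k}" by (auto simp: isolated_in_def)
  have "open ((\<lambda>y. - k + y + k) -` T)" using T(1) by (intro open_vimage continuous_intros)
  moreover have "(\<lambda>y. - k + y + k) -` T \<inter> conjugate k H = (\<lambda>y. - k + y + k) -` (T \<inter> H)"
    by (auto simp: mem_conjugate)
  then have "(\<lambda>y. - k + y + k) -` T \<inter> conjugate k H = {x}" unfolding T(2) by auto
  ultimately show "x isolated_in conjugate k H" using isolated_inI[OF x] by blast
qed

definition tame :: "'a::topological_group_add set \<Rightarrow> bool" where
  "tame H \<longleftrightarrow> H \<in> closed_subgroups \<and> (discrete H \<or> compact H)"

lemma tame_conjugate: "tame H \<Longrightarrow> tame (conjugate k H)"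
  using discrete_conjugate conjugate_closed_subgroup compact_conjugate_iff unfolding tame_def by blast

text \<open>Every \<open>k \<in> K\<close> and the given \<open>g\<close> have neighbourhoods \<open>A\<close>, \<open>B\<close> with \<open>A - B\<close> disjoint from the
  closed set \<open>H\<close>, and finitely many of the \<open>A\<close> cover \<open>K\<close>. Together with the next lemma this is
  continuity of the quotient map for the Fell topology.\<close>

lemma open_rcoset_miss:
  assumes H: "closed H" and K: "compact K"
  shows "open {g :: 'a::topological_group_add. rcoset H g \<inter> K = {}}"
proof (rule topological_space_class.openI)
  fix g assume "g \<in> {g. rcoset H g \<inter> K = {}}"
  then have g: "k - g \<notin> H" if "k \<in> K" for k using that by (auto simp: mem_rcoset)
  have op: "open ((\<lambda>p. fst p - snd p) -` (- H) :: ('a \<times> 'a) set)"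
    using H by (intro open_vimage continuous_diff_group continuous_intros) auto
  have "\<exists>A B. open A \<and> open B \<and> k \<in> A \<and> g \<in> B \<and> (\<forall>x\<in>A. \<forall>y\<in>B. x - y \<notin> H)" if "k \<in> K" for k
  proof -
    have "(k, g) \<in> (\<lambda>p. fst p - snd p) -` (- H)" using g[OF that] by simp
    then obtain A B where AB: "open A" "open B" "(k, g) \<in> A \<times> B" "A \<times> B \<subseteq> (\<lambda>p. fst p - snd p) -` (- H)"
      using open_prod_elim[OF op] by metis
    have "x - y \<notin> H" if "x \<in> A" "y \<in> B" for x y
      using subsetD[OF AB(4), of "(x, y)"] that by simp
    then show ?thesis using AB by blast
  qed
  then obtain A B where AB: "\<And>k. k \<in> K \<Longrightarrow> open (A k) \<and> open (B k) \<and> k \<in> A k \<and> g \<in> B k \<and>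
      (\<forall>x\<in>A k. \<forall>y\<in>B k. x - y \<notin> H)" by metis
  have "K \<subseteq> (\<Union>k\<in>K. A k)" using AB by blast
  then obtain F where F: "F \<subseteq> K" "finite F" "K \<subseteq> (\<Union>k\<in>F. A k)"
    using compactE_image[OF K, of K A] AB by metis
  show "\<exists>T. open T \<and> g \<in> T \<and> T \<subseteq> {g. rcoset H g \<inter> K = {}}"
  proof (intro exI conjI subsetI)
    show "open (\<Inter>k\<in>F. B k)" using F AB by (intro open_INT) blast+
    show "g \<in> (\<Inter>k\<in>F. B k)" using F AB by blast
    fix y assume y: "y \<in> (\<Inter>k\<in>F. B k)"
    have "x - y \<notin> H" if x: "x \<in> K" for x
    proof -
      obtain k where "k \<in> F" "x \<in> A k" using F(3) x by blast
      then show ?thesis using AB[of k] y F(1) by blast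
    qed
    then show "y \<in> {g. rcoset H g \<inter> K = {}}" by (auto simp: mem_rcoset)
  qed
qed

lemma open_rcoset_hit:
  assumes "open U"
  shows "open {g :: 'a::topological_group_add. rcoset H g \<inter> U \<noteq> {}}"
proof -
  have "{g. rcoset H g \<inter> U \<noteq> {}} = (\<Union>h\<in>H. (\<lambda>x. - h + x) ` U)"
    by (auto simp: rcoset_def mem_translate_left)
  then show ?thesis using open_translate_left[OF assms] by auto
qed

lemma topspace_chabauty: "topspace chabauty_topology = closed_subgroups"
  unfolding chabauty_topology_def by (auto simp: topspace_fell closed_subgroups_def)

lemma topspace_coset: "topspace coset_topology = {rcoset H g | H g. H \<in> closed_subgroups}"
  unfolding coset_topology_def using closed_rcoset closed_subgroupD(1) by (fastforce simp: topspace_fell)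

lemma quotient_topology_eq:
  assumes "H \<in> closed_subgroups"
  shows "quotient_topology H = subtopology fell_topology (range (rcoset H))"
proof -
  have "{rcoset H g | H g. H \<in> closed_subgroups} \<inter> range (rcoset H) = range (rcoset H)"
    using assms by blast
  then show ?thesis
    unfolding quotient_topology_def coset_topology_def subtopology_subtopology by simp
qed

lemma topspace_quotient:
  "H \<in> closed_subgroups \<Longrightarrow> topspace (quotient_topology H) = range (rcoset H)"
  using closed_rcoset closed_subgroupD(1) by (fastforce simp: quotient_topology_eq topspace_fell)

lemma openin_quotient_hit:
  assumes H: "H \<in> closed_subgroups" and "open U"
  shows "openin (quotient_topology H) {C \<in> range (rcoset H). C \<inter> U \<noteq> {}}"
proof -
  have "openin (quotient_topology H) (range (rcoset H) \<inter> {C. closed C \<and> C \<inter> U \<noteq> {}})"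
    unfolding quotient_topology_eq[OF H] by (intro openin_subtopology_Int2 openin_fell_hit assms)
  moreover have "range (rcoset H) \<inter> {C. closed C \<and> C \<inter> U \<noteq> {}} = {C \<in> range (rcoset H). C \<inter> U \<noteq> {}}"
    using closed_rcoset closed_subgroupD(1)[OF H] by auto
  ultimately show ?thesis by simp
qed

lemma rcoset_image_eq:
  assumes H: "H \<in> closed_subgroups"
  shows "rcoset H ` V = {C \<in> range (rcoset H). C \<inter> V \<noteq> {}}"
proof (intro set_eqI iffI)
  fix C assume "C \<in> rcoset H ` V"
  then show "C \<in> {C \<in> range (rcoset H). C \<inter> V \<noteq> {}}" using self_mem_rcoset[OF H] by blast
next
  fix C assume "C \<in> {C \<in> range (rcoset H). C \<inter> V \<noteq> {}}"
  then obtain g x where "C = rcoset H g" "x \<in> C" "x \<in> V" by blast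
  then have "C = rcoset H x" using rcoset_eqI[OF H] by blast
  then show "C \<in> rcoset H ` V" using \<open>x \<in> V\<close> by blast
qed

text \<open>Hitting an open set is a Fell open condition, so the quotient map is open as well as
  continuous, and it is a homeomorphism wherever it is injective.\<close>

lemma homeomorphic_map_sheet:
  fixes V :: "'a::topological_group_add set"
  assumes H: "H \<in> closed_subgroups" and V: "open V"
    and inj: "\<And>x y. x \<in> V \<Longrightarrow> y \<in> V \<Longrightarrow> x - y \<in> H \<Longrightarrow> x = y"
  shows "homeomorphic_map (top_of_set V) (subtopology (quotient_topology H) (rcoset H ` V)) (rcoset H)"
proof (rule bijective_open_imp_homeomorphic_map)
  have cont: "continuous_map euclidean fell_topology (rcoset H)"
    unfolding fell_topology_def continuous_on_generated_topo_iff
  proof (intro conjI allI impI)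
    fix Y :: "'a set set"
    assume Y: "Y \<in> {{C. closed C \<and> C \<inter> K = {}} |K. compact K} \<union> {{C. closed C \<and> C \<inter> U \<noteq> {}} |U. open U}"
    note cl = closed_subgroupD(1)[OF H]
    from Y have "open (rcoset H -` Y)"
    proof (elim UnE CollectE exE conjE)
      fix K :: "'a set" assume K: "Y = {C. closed C \<and> C \<inter> K = {}}" "compact K"
      have "rcoset H -` Y = {g. rcoset H g \<inter> K = {}}" unfolding K using closed_rcoset[OF cl] by auto
      then show ?thesis using open_rcoset_miss[OF cl K(2)] by simp
    next
      fix U :: "'a set" assume U: "Y = {C. closed C \<and> C \<inter> U \<noteq> {}}" "open U"
      have "rcoset H -` Y = {g. rcoset H g \<inter> U \<noteq> {}}" unfolding U using closed_rcoset[OF cl] by auto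
      then show ?thesis using open_rcoset_hit[OF U(2)] by simp
    qed
    then show "openin euclidean (rcoset H -` Y \<inter> topspace euclidean)" by simp
  next
    show "rcoset H ` topspace euclidean \<subseteq>
      \<Union>({{C. closed C \<and> C \<inter> K = {}} |K. compact K} \<union> {{C. closed C \<and> C \<inter> U \<noteq> {}} |U. open U})"
      using closed_rcoset[OF closed_subgroupD(1)[OF H]]
      unfolding topspace_fell[unfolded fell_topology_def topology_generated_by_topspace] by blast
  qed
  have sub: "rcoset H ` V \<subseteq> range (rcoset H)" by blast
  have top: "subtopology (quotient_topology H) (rcoset H ` V) = subtopology fell_topology (rcoset H ` V)"
    unfolding quotient_topology_eq[OF H] subtopology_subtopology using sub by (simp add: Int_absorb1)
  have top_eq: "topspace (subtopology (quotient_topology H) (rcoset H ` V)) = rcoset H ` V"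
    using sub topspace_quotient[OF H] by auto
  show "continuous_map (top_of_set V) (subtopology (quotient_topology H) (rcoset H ` V)) (rcoset H)"
    unfolding top continuous_map_in_subtopology
    using continuous_map_from_subtopology[OF cont, of V] by auto
  show "rcoset H ` topspace (top_of_set V) = topspace (subtopology (quotient_topology H) (rcoset H ` V))"
    unfolding top_eq by simp
  show "inj_on (rcoset H) (topspace (top_of_set V))"
  proof (rule inj_onI)
    fix x y assume "x \<in> topspace (top_of_set V)" "y \<in> topspace (top_of_set V)" "rcoset H x = rcoset H y"
    then show "x = y" using inj[of x y] self_mem_rcoset[OF H, of x] by (simp add: mem_rcoset)
  qed
  show "open_map (top_of_set V) (subtopology (quotient_topology H) (rcoset H ` V)) (rcoset H)"
    unfolding open_map_def
  proof (intro allI impI)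
    fix O' assume "openin (top_of_set V) O'"
    then have O': "open O'" "O' \<subseteq> V" using openin_open_eq[OF V] by auto
    have "openin (quotient_topology H) (rcoset H ` O')"
      by (subst rcoset_image_eq[OF H]) (rule openin_quotient_hit[OF H O'(1)])
    moreover have "rcoset H ` O' = rcoset H ` O' \<inter> rcoset H ` V" using O'(2) by blast
    ultimately show "openin (subtopology (quotient_topology H) (rcoset H ` V)) (rcoset H ` O')"
      unfolding openin_subtopology by blast
  qed
qed

lemma discrete_subgroup_sheet:
  fixes g :: "'a::topological_group_add"
  assumes H: "H \<in> closed_subgroups" and disc: "discrete H"
  obtains V where "open V" "g \<in> V" "\<And>x y. x \<in> V \<Longrightarrow> y \<in> V \<Longrightarrow> x - y \<in> H \<Longrightarrow> x = y"
proof -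
  have "0 isolated_in H" using disc closed_subgroupD(2)[OF H] by (simp add: discrete_def)
  then obtain T where T: "open T" "T \<inter> H = {0}" by (auto simp: isolated_in_def)
  have op: "open ((\<lambda>p. fst p - snd p) -` T :: ('a \<times> 'a) set)"
    using T by (intro open_vimage continuous_diff_group continuous_intros) auto
  have "(g, g) \<in> (\<lambda>p. fst p - snd p) -` T" using T(2) by auto
  then obtain A B where AB: "open A" "open B" "(g, g) \<in> A \<times> B" "A \<times> B \<subseteq> (\<lambda>p. fst p - snd p) -` T"
    using open_prod_elim[OF op] by metis
  show thesis
  proof
    show "open (A \<inter> B)" "g \<in> A \<inter> B" using AB by auto
    fix x y assume "x \<in> A \<inter> B" "y \<in> A \<inter> B" "x - y \<in> H"
    then have "x - y \<in> T \<inter> H" using subsetD[OF AB(4), of "(x, y)"] by auto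
    then show "x = y" using T(2) by simp
  qed
qed

text \<open>The translates of a sheet by the elements of \<open>H\<close> are the sheets over its image.\<close>

lemma discrete_subgroup_evenly_covered:
  fixes g :: "'a::topological_group_add"
  assumes H: "H \<in> closed_subgroups" and disc: "discrete H"
  obtains U \<V> V where "evenly_covered H U \<V>" "V \<in> \<V>" "open V" "g \<in> V" "U = rcoset H ` V"
proof -
  obtain V where V: "open V" "g \<in> V" and inj: "\<And>x y. x \<in> V \<Longrightarrow> y \<in> V \<Longrightarrow> x - y \<in> H \<Longrightarrow> x = y"
    using discrete_subgroup_sheet[OF assms, of g] by metis
  define sheet where "sheet h = (\<lambda>x. h + x) ` V" for h
  have op: "open (sheet h)" for h unfolding sheet_def by (rule open_translate_left[OF V(1)])
  have sheet_inj: "x = y" if "h \<in> H" "x \<in> sheet h" "y \<in> sheet h" "x - y \<in> H" for h x y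
  proof -
    have "(- h + x) - (- h + y) = - h + (x - y) + h" by (simp add: group_arith del: add_uminus_conv_diff)
    then have "(- h + x) - (- h + y) \<in> H" using that(1,4) closed_subgroupD(3,4)[OF H] by metis
    then have "- h + x = - h + y"
      using that(2,3) unfolding sheet_def mem_translate_left by (intro inj)
    then show ?thesis by simp
  qed
  have im: "rcoset H ` sheet h = rcoset H ` V" if "h \<in> H" for h
    unfolding sheet_def image_image using rcoset_add[OF H that] by simp
  have "evenly_covered H (rcoset H ` V) (sheet ` H)"
    unfolding evenly_covered_def
  proof (intro conjI ballI)
    show "openin (quotient_topology H) (rcoset H ` V)"
      by (subst rcoset_image_eq[OF H]) (rule openin_quotient_hit[OF H V(1)])
    show "rcoset H -` rcoset H ` V = \<Union>(sheet ` H)"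
    proof (intro set_eqI iffI)
      fix x assume "x \<in> rcoset H -` rcoset H ` V"
      then obtain v where "v \<in> V" "rcoset H x = rcoset H v" by blast
      then have "x - v \<in> H" using self_mem_rcoset[OF H, of x] by (simp add: mem_rcoset)
      moreover have "x \<in> sheet (x - v)" using \<open>v \<in> V\<close> by (force simp: sheet_def)
      ultimately show "x \<in> \<Union>(sheet ` H)" by blast
    next
      fix x assume "x \<in> \<Union>(sheet ` H)"
      then obtain h where h: "h \<in> H" "x \<in> sheet h" by blast
      then have "rcoset H x \<in> rcoset H ` V" using im[OF h(1)] by blast
      then show "x \<in> rcoset H -` rcoset H ` V" by simp
    qed
    show "pairwise disjnt (sheet ` H)"
    proof (rule pairwiseI)
      fix A B assume "A \<in> sheet ` H" "B \<in> sheet ` H" "A \<noteq> B"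
      then obtain h k where hk: "h \<in> H" "k \<in> H" "A = sheet h" "B = sheet k" "h \<noteq> k" by blast
      show "disjnt A B"
      proof (rule ccontr)
        assume "\<not> disjnt A B"
        then obtain x where "x \<in> sheet h" "x \<in> sheet k" unfolding hk disjnt_def by blast
        then have x: "- h + x \<in> V" "- k + x \<in> V" by (simp_all add: sheet_def mem_translate_left)
        have "(- h + x) - (- k + x) = - h + k" by (simp add: group_arith del: add_uminus_conv_diff)
        then have "(- h + x) - (- k + x) \<in> H" using hk closed_subgroupD(3,4)[OF H] by simp
        then have "- h + x = - k + x" using inj x by blast
        then show False using hk(5) by simp
      qed
    qed
    fix W assume "W \<in> sheet ` H"
    then obtain h where h: "h \<in> H" "W = sheet h" by blast
    show "open W" using op h by simp
    show "homeomorphic_map (top_of_set W) (subtopology (quotient_topology H) (rcoset H ` V)) (rcoset H)"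
      unfolding h(2) im[OF h(1), symmetric]
      by (rule homeomorphic_map_sheet[OF H op]) (rule sheet_inj[OF h(1)])
  qed
  moreover have "V = sheet 0" by (simp add: sheet_def)
  then have "V \<in> sheet ` H" using closed_subgroupD(2)[OF H] by blast
  ultimately show thesis using that V by blast
qed

section \<open>Measurable maps between subgroups, elements and cosets\<close>

lemma basic_box:
  assumes A: "topological_basis \<A>" and B: "topological_basis \<B>" and W: "open W" "(x, y) \<in> W"
  obtains A' B' where "A' \<in> \<A>" "B' \<in> \<B>" "x \<in> A'" "y \<in> B'" "A' \<times> B' \<subseteq> W"
proof -
  from W obtain A' B' where AB: "open A'" "open B'" "(x, y) \<in> A' \<times> B'" "A' \<times> B' \<subseteq> W"
    by (rule open_prod_elim) (rule that)
  have xy: "x \<in> A'" "y \<in> B'" using AB(3) by auto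
  obtain A'' where A'': "A'' \<in> \<A>" "x \<in> A''" "A'' \<subseteq> A'"
    by (rule topological_basisE[OF A AB(1) xy(1)]) (rule that)
  obtain B'' where B'': "B'' \<in> \<B>" "y \<in> B''" "B'' \<subseteq> B'"
    by (rule topological_basisE[OF B AB(2) xy(2)]) (rule that)
  have "A'' \<times> B'' \<subseteq> W" using A''(3) B''(3) AB(4) by blast
  then show thesis using that[OF A''(1) B''(1) A''(2) B''(2)] by blast
qed

text \<open>Since \<open>\<phi>\<close> is continuous, \<open>\<phi> h g \<in> U\<close> for some \<open>h \<in> H\<close> iff \<open>H\<close> meets \<open>A\<close> and \<open>g \<in> B\<close> for one
  of the countably many basic boxes \<open>A \<times> B\<close> that \<open>\<phi>\<close> maps into \<open>U\<close>.\<close>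

lemma sets_image_hit:
  fixes \<phi> :: "'a::second_countable_topology \<Rightarrow> 'b::second_countable_topology \<Rightarrow> 'c::topological_space"
  assumes cont: "continuous_on UNIV (\<lambda>p. \<phi> (fst p) (snd p))" and U: "open U"
  shows "{p \<in> space (borel_of fell_topology \<Otimes>\<^sub>M borel). \<exists>h\<in>fst p. \<phi> h (snd p) \<in> U}
    \<in> sets (borel_of fell_topology \<Otimes>\<^sub>M borel)"
proof -
  obtain \<A> :: "'a set set" where \<A>: "countable \<A>" "topological_basis \<A>" using ex_countable_basis by auto
  obtain \<B> :: "'b set set" where \<B>: "countable \<B>" "topological_basis \<B>" using ex_countable_basis by auto
  define I where "I = {AB \<in> \<A> \<times> \<B>. \<forall>x\<in>fst AB. \<forall>y\<in>snd AB. \<phi> x y \<in> U}"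
  have cI: "countable I" unfolding I_def using \<A> \<B> by (intro countable_Collect countable_SIGMA) auto
  have op: "open ((\<lambda>p. \<phi> (fst p) (snd p)) -` U)" by (rule open_vimage[OF U cont])
  have box: "\<exists>AB\<in>I. h \<in> fst AB \<and> g \<in> snd AB" if "\<phi> h g \<in> U" for h g
  proof -
    have mem: "(h, g) \<in> (\<lambda>p. \<phi> (fst p) (snd p)) -` U" using that by simp
    obtain A' B' where "A' \<in> \<A>" "B' \<in> \<B>" "h \<in> A'" "g \<in> B'" "A' \<times> B' \<subseteq> (\<lambda>p. \<phi> (fst p) (snd p)) -` U"
      by (rule basic_box[OF \<A>(2) \<B>(2) op mem]) (rule that)
    then have "(A', B') \<in> I" "h \<in> fst (A', B') \<and> g \<in> snd (A', B')" unfolding I_def by auto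
    then show ?thesis by blast
  qed
  have "{p \<in> space (borel_of fell_topology \<Otimes>\<^sub>M borel). \<exists>h\<in>fst p. \<phi> h (snd p) \<in> U}
    = (\<Union>AB\<in>I. {C. closed C \<and> C \<inter> fst AB \<noteq> {}} \<times> snd AB)" (is "?L = ?R")
  proof (intro set_eqI iffI)
    fix p assume "p \<in> ?L"
    then obtain C g h where p: "p = (C, g)" "closed C" "h \<in> C" "\<phi> h g \<in> U"
      by (cases p) (auto simp: space_pair_measure topspace_fell)
    then show "p \<in> ?R" using box[of h g] by fastforce
  next
    fix p assume "p \<in> ?R"
    then show "p \<in> ?L" unfolding I_def by (fastforce simp: space_pair_measure topspace_fell)
  qed
  also have "\<dots> \<in> sets (borel_of fell_topology \<Otimes>\<^sub>M borel)"
  proof (intro sets.countable_UN''[OF cI])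
    fix AB assume "AB \<in> I"
    then have "open (fst AB)" "open (snd AB)"
      using topological_basis_open[OF \<A>(2)] topological_basis_open[OF \<B>(2)] by (auto simp: I_def)
    then show "{C. closed C \<and> C \<inter> fst AB \<noteq> {}} \<times> snd AB \<in> sets (borel_of fell_topology \<Otimes>\<^sub>M borel)"
      by (intro pair_measureI sets_fell_hit) auto
  qed
  finally show ?thesis .
qed

abbreviation Sub :: "'a::topological_group_add set measure" where "Sub \<equiv> borel_of chabauty_topology"
abbreviation Cos :: "'a::topological_group_add set measure" where "Cos \<equiv> borel_of coset_topology"

lemma measurable_Sub_fell [measurable]: "(\<lambda>H. H) \<in> Sub \<rightarrow>\<^sub>M borel_of (fell_topology :: 'a::{topological_group_add, second_countable_topology} set topology)"
  unfolding chabauty_topology_def by (rule measurable_from_fell_subspace)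

lemma measurable_Cos_fell [measurable]: "(\<lambda>C. C) \<in> Cos \<rightarrow>\<^sub>M borel_of (fell_topology :: 'a::{topological_group_add, second_countable_topology} set topology)"
  unfolding coset_topology_def by (rule measurable_from_fell_subspace)

text \<open>A coset or a subgroup that depends on a subgroup \<open>H\<close> and an element \<open>g\<close> as the image of \<open>H\<close>
  under a continuous map is a Borel function of \<open>(H, g)\<close>.\<close>

lemma sets_Sub_hit:
  fixes \<phi> :: "'a::{topological_group_add, second_countable_topology} \<Rightarrow> 'a \<Rightarrow> 'a"
  assumes cont: "continuous_on UNIV (\<lambda>p. \<phi> (fst p) (snd p))" and U: "open U"
  shows "{p \<in> space (Sub \<Otimes>\<^sub>M borel). (\<lambda>h. \<phi> h (snd p)) ` fst p \<inter> U \<noteq> {}} \<in> sets (Sub \<Otimes>\<^sub>M borel)"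
proof -
  let ?F = "borel_of (fell_topology :: 'a set topology) \<Otimes>\<^sub>M (borel :: 'a measure)"
  have "(\<lambda>p. (fst p, snd p)) \<in> Sub \<Otimes>\<^sub>M borel \<rightarrow>\<^sub>M ?F"
    by (intro measurable_Pair measurable_compose[OF measurable_fst measurable_Sub_fell] measurable_snd)
  from measurable_sets[OF this sets_image_hit[OF cont U]]
  have "(\<lambda>p. (fst p, snd p)) -` {p \<in> space ?F. \<exists>h\<in>fst p. \<phi> h (snd p) \<in> U} \<inter> space (Sub \<Otimes>\<^sub>M borel)
    \<in> sets (Sub \<Otimes>\<^sub>M borel)" .
  moreover have "(\<lambda>p. (fst p, snd p)) -` {p \<in> space ?F. \<exists>h\<in>fst p. \<phi> h (snd p) \<in> U} \<inter> space (Sub \<Otimes>\<^sub>M borel)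
    = {p \<in> space (Sub \<Otimes>\<^sub>M borel). (\<lambda>h. \<phi> h (snd p)) ` fst p \<inter> U \<noteq> {}}"
    by (auto simp: space_pair_measure topspace_fell topspace_chabauty closed_subgroups_def)
  ultimately show ?thesis by simp
qed

lemma measurable_rcoset [measurable]:
  "(\<lambda>p. rcoset (fst p) (snd p)) \<in> Sub \<Otimes>\<^sub>M borel \<rightarrow>\<^sub>M (Cos :: 'a::{topological_group_add, second_countable_topology} set measure)"
  unfolding coset_topology_def
proof (rule measurable_into_fell_subspace)
  fix p :: "'a set \<times> 'a" assume "p \<in> space (Sub \<Otimes>\<^sub>M borel)"
  then have "fst p \<in> closed_subgroups" by (auto simp: space_pair_measure topspace_chabauty)
  then show "rcoset (fst p) (snd p) \<in> {rcoset H g | H g. H \<in> closed_subgroups}" "closed (rcoset (fst p) (snd p))"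
    using closed_rcoset closed_subgroupD(1) by blast+
next
  fix U :: "'a set" assume "open U"
  then show "{p \<in> space (Sub \<Otimes>\<^sub>M borel). rcoset (fst p) (snd p) \<inter> U \<noteq> {}} \<in> sets (Sub \<Otimes>\<^sub>M borel)"
    unfolding rcoset_def by (rule sets_Sub_hit[rotated]) (intro continuous_intros)
qed

lemma measurable_conjugate [measurable]:
  "(\<lambda>p. conjugate (snd p) (fst p)) \<in> Sub \<Otimes>\<^sub>M borel \<rightarrow>\<^sub>M (Sub :: 'a::{topological_group_add, second_countable_topology} set measure)"
proof (subst (2) chabauty_topology_def, rule measurable_into_fell_subspace)
  fix p :: "'a set \<times> 'a" assume "p \<in> space (Sub \<Otimes>\<^sub>M borel)"
  then have "fst p \<in> closed_subgroups" by (auto simp: space_pair_measure topspace_chabauty)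
  then show "conjugate (snd p) (fst p) \<in> closed_subgroups" "closed (conjugate (snd p) (fst p))"
    using conjugate_closed_subgroup closed_subgroupD(1) by blast+
next
  fix U :: "'a set" assume "open U"
  then show "{p \<in> space (Sub \<Otimes>\<^sub>M borel). conjugate (snd p) (fst p) \<inter> U \<noteq> {}} \<in> sets (Sub \<Otimes>\<^sub>M borel)"
    unfolding conjugate_def by (rule sets_Sub_hit[rotated]) (intro continuous_intros continuous_diff_group)
qed

lemma Cos_sets_hit:
  fixes U :: "'a::{topological_group_add, second_countable_topology} set"
  assumes "open U" shows "{C \<in> space Cos. C \<inter> U \<noteq> {}} \<in> sets Cos"
proof -
  have "{C \<in> space Cos. C \<inter> U \<noteq> {}} = (\<lambda>C. C) -` {C. closed C \<and> C \<inter> U \<noteq> {}} \<inter> space Cos"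
    using closed_rcoset closed_subgroupD(1) by (auto simp: topspace_coset)
  then show ?thesis using measurable_sets[OF measurable_Cos_fell sets_fell_hit[OF assms]] by simp
qed

lemma measurable_coset_inverse [measurable]:
  "coset_inverse \<in> Cos \<rightarrow>\<^sub>M (Cos :: 'a::{topological_group_add, second_countable_topology} set measure)"
proof (subst (2) coset_topology_def, rule measurable_into_fell_subspace)
  fix C :: "'a set" assume "C \<in> space Cos"
  then obtain H g where C: "C = rcoset H g" "H \<in> closed_subgroups" by (auto simp: topspace_coset)
  have H': "conjugate (- g) H \<in> closed_subgroups" by (rule conjugate_closed_subgroup[OF C(2)])
  show "coset_inverse C \<in> {rcoset H g | H g. H \<in> closed_subgroups}"
    unfolding C(1) coset_inverse_eq_rcoset[OF C(2)] using H' by blast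
  show "closed (coset_inverse C)"
    unfolding C(1) coset_inverse_eq_rcoset[OF C(2)] by (rule closed_rcoset[OF closed_subgroupD(1)[OF H']])
next
  fix U :: "'a set" assume "open U"
  then have "open (uminus -` U)" by (intro open_vimage continuous_intros)
  moreover have "coset_inverse C \<inter> U \<noteq> {} \<longleftrightarrow> C \<inter> uminus -` U \<noteq> {}" for C
    by (auto simp: coset_inverse_def)
  ultimately show "{C \<in> space Cos. coset_inverse C \<inter> U \<noteq> {}} \<in> sets Cos"
    using Cos_sets_hit by simp
qed

lemma measurable_coset_translate:
  fixes k :: "'a::{topological_group_add, second_countable_topology}"
  shows "(\<lambda>C. (\<lambda>x. x + k) ` C) \<in> Cos \<rightarrow>\<^sub>M Cos"
proof (subst (2) coset_topology_def, rule measurable_into_fell_subspace)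
  fix C :: "'a set" assume "C \<in> space Cos"
  then obtain H g where C: "C = rcoset H g" "H \<in> closed_subgroups" by (auto simp: topspace_coset)
  show "(\<lambda>x. x + k) ` C \<in> {rcoset H g | H g. H \<in> closed_subgroups}" "closed ((\<lambda>x. x + k) ` C)"
    unfolding C(1) rcoset_rcoset using C(2) closed_rcoset[OF closed_subgroupD(1)] by blast+
next
  fix U :: "'a set" assume "open U"
  then have "open ((\<lambda>x. x + k) -` U)" by (intro open_vimage continuous_intros)
  moreover have "(\<lambda>x. x + k) ` C \<inter> U \<noteq> {} \<longleftrightarrow> C \<inter> (\<lambda>x. x + k) -` U \<noteq> {}" for C by auto
  ultimately show "{C \<in> space Cos. (\<lambda>x. x + k) ` C \<inter> U \<noteq> {}} \<in> sets Cos"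
    using Cos_sets_hit by simp
qed

text \<open>The subgroup \<open>C\<^sup>-\<^sup>1C\<close> of which \<open>C\<close> is a left coset.\<close>

definition right_stabilizer :: "'a::group_add set \<Rightarrow> 'a set" where
  "right_stabilizer C = {- x + y | x y. x \<in> C \<and> y \<in> C}"

lemma right_stabilizer_rcoset:
  assumes H: "H \<in> closed_subgroups"
  shows "right_stabilizer (rcoset H g) = conjugate (- g) H"
proof (intro set_eqI iffI)
  fix z assume "z \<in> right_stabilizer (rcoset H g)"
  then obtain x y where xy: "x - g \<in> H" "y - g \<in> H" "z = - x + y"
    by (auto simp: right_stabilizer_def mem_rcoset)
  have "g + z + - g = - (x - g) + (y - g)" by (simp add: xy(3) group_arith del: add_uminus_conv_diff)
  then show "z \<in> conjugate (- g) H"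
    unfolding mem_conjugate minus_minus using closed_subgroupD(3,4)[OF H] xy by metis
next
  fix z assume "z \<in> conjugate (- g) H"
  then have "(g + z) - g \<in> H" "g - g \<in> H"
    using closed_subgroupD(2)[OF H] by (simp_all add: mem_conjugate)
  moreover have "z = - g + (g + z)" by simp
  ultimately show "z \<in> right_stabilizer (rcoset H g)"
    unfolding right_stabilizer_def mem_rcoset by blast
qed

text \<open>\<open>C\<^sup>-\<^sup>1C\<close> meets \<open>U\<close> iff \<open>C\<close> meets both factors of one of countably many basic boxes that
  \<open>(x, y) \<mapsto> x\<^sup>-\<^sup>1y\<close> maps into \<open>U\<close>.\<close>

lemma measurable_right_stabilizer [measurable]:
  "right_stabilizer \<in> Cos \<rightarrow>\<^sub>M (Sub :: 'a::{topological_group_add, second_countable_topology} set measure)"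
  unfolding chabauty_topology_def
proof (rule measurable_into_fell_subspace)
  fix C :: "'a set" assume "C \<in> space Cos"
  then show *: "right_stabilizer C \<in> closed_subgroups"
    using conjugate_closed_subgroup by (auto simp: topspace_coset right_stabilizer_rcoset)
  show "closed (right_stabilizer C)" by (rule closed_subgroupD(1)[OF *])
next
  fix U :: "'a set" assume U: "open U"
  obtain \<B> :: "'a set set" where \<B>: "countable \<B>" "topological_basis \<B>" using ex_countable_basis by auto
  define I where "I = {AB \<in> \<B> \<times> \<B>. \<forall>x\<in>fst AB. \<forall>y\<in>snd AB. - x + y \<in> U}"
  have cI: "countable I" unfolding I_def using \<B> by (intro countable_Collect countable_SIGMA) auto
  have op: "open ((\<lambda>p. - fst p + snd p) -` U :: ('a \<times> 'a) set)"
    using U by (intro open_vimage continuous_intros)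
  have box: "\<exists>AB\<in>I. x \<in> fst AB \<and> y \<in> snd AB" if "- x + y \<in> U" for x y
  proof -
    have mem: "(x, y) \<in> (\<lambda>p. - fst p + snd p) -` U" using that by simp
    obtain A' B' where "A' \<in> \<B>" "B' \<in> \<B>" "x \<in> A'" "y \<in> B'" "A' \<times> B' \<subseteq> (\<lambda>p. - fst p + snd p) -` U"
      by (rule basic_box[OF \<B>(2) \<B>(2) op mem]) (rule that)
    then have "(A', B') \<in> I" "x \<in> fst (A', B') \<and> y \<in> snd (A', B')" unfolding I_def by auto
    then show ?thesis by blast
  qed
  have "{C \<in> space Cos. right_stabilizer C \<inter> U \<noteq> {}}
      = {C \<in> space Cos. \<exists>AB\<in>I. C \<inter> fst AB \<noteq> {} \<and> C \<inter> snd AB \<noteq> {}}" (is "?L = ?R")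
  proof (intro set_eqI iffI)
    fix C assume "C \<in> ?L"
    then obtain x y where "C \<in> space Cos" "x \<in> C" "y \<in> C" "- x + y \<in> U" by (auto simp: right_stabilizer_def)
    then show "C \<in> ?R" using box[of x y] by blast
  next
    fix C assume "C \<in> ?R"
    then obtain AB x y where "C \<in> space Cos" "AB \<in> I" "x \<in> C" "x \<in> fst AB" "y \<in> C" "y \<in> snd AB" by blast
    then have "- x + y \<in> right_stabilizer C \<inter> U" unfolding I_def right_stabilizer_def by blast
    then show "C \<in> ?L" using \<open>C \<in> space Cos\<close> by blast
  qed
  also have "\<dots> \<in> sets Cos"
  proof (intro sets.sets_Collect_countable_Ex'[OF _ cI] sets.sets_Collect_conj Cos_sets_hit)
    fix AB assume "AB \<in> I"
    then show "open (fst AB)" "open (snd AB)" using topological_basis_open[OF \<B>(2)] by (auto simp: I_def)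
  qed
  finally show "{C \<in> space Cos. right_stabilizer C \<inter> U \<noteq> {}} \<in> sets Cos" .
qed

section \<open>Haar measure and the modular function\<close>

locale haar_group =
  fixes haar :: "'g::{topological_group_add, t2_space, second_countable_topology} measure"
  assumes lc: "locally_compact_space (euclidean :: 'g topology)"
    and haar: "left_haar_measure haar"
begin

lemma sets_haar [measurable_cong]: "sets haar = sets borel"
  using haar by (simp add: left_haar_measure_def)

lemma space_haar [simp]: "space haar = UNIV"
  using sets_eq_imp_space_eq[OF sets_haar] by simp

lemma haar_open_pos: "open U \<Longrightarrow> U \<noteq> {} \<Longrightarrow> 0 < emeasure haar U"
  using haar by (simp add: left_haar_measure_def)

lemma haar_compact_finite: "compact K \<Longrightarrow> emeasure haar K < \<infinity>"
  using haar by (simp add: left_haar_measure_def)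

lemma relatively_compact_nbhd:
  fixes x :: 'g
  assumes "open U" "x \<in> U"
  obtains V where "open V" "compact (closure V)" "x \<in> V" "V \<subseteq> U"
proof -
  obtain W K where WK: "open W" "compact K" "x \<in> W" "W \<subseteq> K"
    using lc by (simp add: locally_compact_space_def) metis
  have "closure (W \<inter> U) \<subseteq> K"
    using WK by (intro closure_minimal compact_imp_closed) auto
  then have "compact (closure (W \<inter> U))"
    using WK(2) by (metis closed_closure compact_Int_closed inf.absorb2)
  then show thesis using that[of "W \<inter> U"] WK assms by auto
qed

lemma haar_relatively_compact_finite:
  assumes "compact (closure V)" shows "emeasure haar V < \<infinity>"
proof -
  have "emeasure haar V \<le> emeasure haar (closure V)"
    by (intro emeasure_mono) (auto simp: sets_haar closure_subset)
  then show ?thesis using haar_compact_finite[OF assms] by (rule le_less_trans)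
qed

text \<open>An enumerated basis of relatively compact open sets.\<close>

definition basic :: "nat \<Rightarrow> 'g set" where
  "basic = (SOME B. (\<forall>n. open (B n) \<and> compact (closure (B n))) \<and>
    (\<forall>U x. open U \<longrightarrow> x \<in> U \<longrightarrow> (\<exists>n. x \<in> B n \<and> B n \<subseteq> U)))"

lemma basic: "open (basic n)" "compact (closure (basic n))"
    "open U \<Longrightarrow> x \<in> U \<Longrightarrow> \<exists>n. x \<in> basic n \<and> basic n \<subseteq> U"
proof -
  obtain \<B> :: "'g set set" where \<B>: "countable \<B>" "topological_basis \<B>" using ex_countable_basis by auto
  let ?\<C> = "{B \<in> \<B>. compact (closure B)}"
  have ex: "\<exists>B\<in>?\<C>. x \<in> B \<and> B \<subseteq> U" if U: "open U" "x \<in> U" for x U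
  proof -
    obtain V where V: "open V" "compact (closure V)" "x \<in> V" "V \<subseteq> U"
      using relatively_compact_nbhd[OF U] by metis
    obtain B where B: "B \<in> \<B>" "x \<in> B" "B \<subseteq> V"
      using topological_basisE[OF \<B>(2) V(1,3)] by metis
    have "compact (closure V \<inter> closure B)" using V(2) by blast
    then have "compact (closure B)" using closure_mono[OF B(3)] by (simp add: inf.absorb2)
    then show ?thesis using B V(4) by blast
  qed
  have ne: "?\<C> \<noteq> {}" using ex[of UNIV 0] by auto
  have cnt: "countable ?\<C>" using \<B>(1) by (intro countable_Collect)
  have "(\<forall>n. open (from_nat_into ?\<C> n) \<and> compact (closure (from_nat_into ?\<C> n))) \<and>
    (\<forall>U x. open U \<longrightarrow> x \<in> U \<longrightarrow> (\<exists>n. x \<in> from_nat_into ?\<C> n \<and> from_nat_into ?\<C> n \<subseteq> U))"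
  proof (intro conjI allI impI)
    show "open (from_nat_into ?\<C> n)" "compact (closure (from_nat_into ?\<C> n))" for n
      using from_nat_into[OF ne, of n] topological_basis_open[OF \<B>(2)] by auto
    show "\<exists>n. x \<in> from_nat_into ?\<C> n \<and> from_nat_into ?\<C> n \<subseteq> U" if U: "open U" "x \<in> U" for x U
    proof -
      obtain B where B: "B \<in> ?\<C>" "x \<in> B" "B \<subseteq> U" using ex[OF U] by blast
      have "from_nat_into ?\<C> (to_nat_on ?\<C> B) = B" by (rule from_nat_into_to_nat_on[OF cnt B(1)])
      then show ?thesis using B by (intro exI[of _ "to_nat_on ?\<C> B"]) simp
    qed
  qed
  then have "\<exists>B::nat \<Rightarrow> 'g set. (\<forall>n. open (B n) \<and> compact (closure (B n))) \<and>
    (\<forall>U x. open U \<longrightarrow> x \<in> U \<longrightarrow> (\<exists>n. x \<in> B n \<and> B n \<subseteq> U))"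
    by (rule exI[of _ "from_nat_into ?\<C>"])
  from someI_ex[OF this] have *: "(\<forall>n. open (basic n) \<and> compact (closure (basic n))) \<and>
    (\<forall>U x. open U \<longrightarrow> x \<in> U \<longrightarrow> (\<exists>n. x \<in> basic n \<and> basic n \<subseteq> U))"
    unfolding basic_def .
  show "open (basic n)" "compact (closure (basic n))"
    "open U \<Longrightarrow> x \<in> U \<Longrightarrow> \<exists>n. x \<in> basic n \<and> basic n \<subseteq> U"
    using * by blast+
qed

lemma basic_cover: "(\<Union>n. basic n) = UNIV"
  using basic(3)[OF open_UNIV] by blast

sublocale sigma_finite_measure haar
proof
  show "\<exists>A. countable A \<and> A \<subseteq> sets haar \<and> \<Union>A = space haar \<and> (\<forall>a\<in>A. emeasure haar a \<noteq> \<infinity>)"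
  proof (intro exI conjI ballI)
    show "countable (range basic)" by simp
    show "range basic \<subseteq> sets haar" using basic(1) by (auto simp: sets_haar)
    show "\<Union>(range basic) = space haar" using basic_cover by simp
    show "emeasure haar a \<noteq> \<infinity>" if a: "a \<in> range basic" for a
    proof -
      obtain n where "a = basic n" using a by blast
      then show ?thesis using haar_relatively_compact_finite[OF basic(2)[of n]] by simp
    qed
  qed
qed

lemma compact_subset_basic:
  assumes "compact K" obtains n where "K \<subseteq> (\<Union>i\<le>n. basic i)"
proof -
  have "K \<subseteq> (\<Union>n\<in>UNIV. basic n)" using basic_cover by simp
  then obtain F where F: "finite F" "K \<subseteq> (\<Union>n\<in>F. basic n)"
    using compactE_image[OF assms, of UNIV basic] basic(1) by metis
  then obtain n where "F \<subseteq> {..n}" using finite_nat_iff_bounded_le by blast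
  then show thesis using that[of n] F(2) by blast
qed

lemma measurable_translate [measurable]:
  "(\<lambda>x. a + x :: 'g) \<in> borel \<rightarrow>\<^sub>M borel" "(\<lambda>x. x + a :: 'g) \<in> borel \<rightarrow>\<^sub>M borel"
  by (intro borel_measurable_continuous_onI continuous_intros)+

lemma measurable_uminus_group [measurable]:
  "f \<in> M \<rightarrow>\<^sub>M borel \<Longrightarrow> (\<lambda>x. - f x :: 'g) \<in> M \<rightarrow>\<^sub>M borel"
  by (rule measurable_compose[where g = uminus])
    (auto intro!: borel_measurable_continuous_onI continuous_intros)

lemma nn_integral_left_translate:
  assumes [measurable]: "F \<in> borel_measurable borel"
  shows "(\<integral>\<^sup>+x. F (a + x) \<partial>haar) = (\<integral>\<^sup>+x. F x \<partial>haar)"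
proof -
  have "distr haar borel (\<lambda>x. a + x) = haar"
  proof (rule measure_eqI)
    show "sets (distr haar borel (\<lambda>x. a + x)) = sets haar" by (simp add: sets_haar)
    fix S assume "S \<in> sets (distr haar borel (\<lambda>x. a + x))"
    then have S: "S \<in> sets borel" by simp
    then have "emeasure (distr haar borel (\<lambda>x. a + x)) S = emeasure haar ((\<lambda>x. a + x) -` S)"
      by (subst emeasure_distr) (auto simp: measurable_cong_sets[OF sets_haar refl])
    also have "(\<lambda>x. a + x) -` S = (\<lambda>x. - a + x) ` S" by (intro set_eqI) (simp add: mem_translate_left)
    also have "emeasure haar \<dots> = emeasure haar S" using haar S by (simp add: left_haar_measure_def)
    finally show "emeasure (distr haar borel (\<lambda>x. a + x)) S = emeasure haar S" .
  qed
  then have "(\<integral>\<^sup>+x. F x \<partial>haar) = (\<integral>\<^sup>+x. F x \<partial>distr haar borel (\<lambda>x. a + x))" by simp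
  also have "\<dots> = (\<integral>\<^sup>+x. F (a + x) \<partial>haar)"
    by (rule nn_integral_distr) (auto simp: measurable_cong_sets[OF sets_haar refl])
  finally show ?thesis by simp
qed

lemma borel_measurable_haar_iff: "f \<in> borel_measurable haar \<longleftrightarrow> f \<in> borel_measurable borel"
  using measurable_cong_sets[OF sets_haar refl] by blast

section \<open>Unit weights on the cosets\<close>

text \<open>The two conventions for \<open>\<nu>\<^sub>H\<close> are treated at once: when \<open>\<nu>\<^sub>H\<close> is the push forward of \<open>haar\<close>
  the density is \<open>1\<close>; when it is the local push forward, the density has sum \<open>1\<close> on every coset,
  so that it spreads the mass that \<open>\<nu>\<^sub>H\<close> puts on a coset over the points of that coset.\<close>

definition pushed :: "bool \<Rightarrow> 'g set \<Rightarrow> bool" where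
  "pushed fd C \<longleftrightarrow> compact C \<and> \<not> (finite C \<and> fd)"

definition unit_density :: "bool \<Rightarrow> 'g set \<Rightarrow> ('g \<Rightarrow> ennreal) \<Rightarrow> bool" where
  "unit_density fd H w \<longleftrightarrow> w \<in> borel_measurable borel \<and>
    (\<forall>g. if pushed fd H then w g = 1 else (\<integral>\<^sup>+h. w (h + g) \<partial>count_space H) = 1)"

lemma pushed_rcoset [simp]: "pushed fd (rcoset H g) \<longleftrightarrow> pushed fd H"
  by (simp add: pushed_def compact_rcoset_iff finite_rcoset_iff)

lemma pushed_conjugate [simp]: "pushed fd (conjugate k H) \<longleftrightarrow> pushed fd H"
  by (simp add: pushed_def compact_conjugate_iff finite_conjugate_iff)

lemma discrete_if_not_pushed: "tame H \<Longrightarrow> \<not> pushed fd H \<Longrightarrow> discrete H"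
  using discrete_compact_finite_iff[of H] by (auto simp: tame_def pushed_def)

text \<open>A closed discrete set has no limit points, so it meets a compact set in finitely many points.\<close>

lemma discrete_coset_finite:
  assumes H: "H \<in> closed_subgroups" and disc: "discrete H" and U: "compact (closure U)"
  shows "finite (rcoset H g \<inter> U)"
proof -
  have "finite (closure U \<inter> rcoset H g)"
  proof (rule finite_not_islimpt_in_compact[OF U])
    fix x
    show "\<not> x islimpt rcoset H g"
    proof
      assume x: "x islimpt rcoset H g"
      then have "x \<in> rcoset H g" using closed_rcoset[OF closed_subgroupD(1)[OF H]] closed_limpt by blast
      then have "x isolated_in rcoset H g" using discrete_translate[OF disc] by (auto simp: discrete_def)
      then show False using x by (simp add: isolated_in_islimpt_iff)
    qed
  qed
  then show ?thesis by (rule finite_subset[rotated]) (use closure_subset in blast)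
qed

lemma discrete_subgroup_countable:
  fixes H :: "'g set"
  assumes "H \<in> closed_subgroups" "discrete H" shows "countable H"
proof -
  have "H = (\<Union>n. rcoset H 0 \<inter> basic n)" using basic_cover by auto
  moreover have "countable (\<Union>n. rcoset H 0 \<inter> basic n)"
    by (rule countable_UN) (auto intro: countable_finite discrete_coset_finite[OF assms basic(2), of 0, simplified])
  ultimately show ?thesis by simp
qed

lemma nn_integral_count_rcoset:
  "(\<integral>\<^sup>+h. f (h + g) \<partial>count_space H) = (\<integral>\<^sup>+x. f x \<partial>count_space (rcoset H g))"
  by (rule nn_integral_bij_count_space) (auto simp: bij_betw_def rcoset_def inj_on_def)

text \<open>Two unit weights \<open>w\<^sub>1\<close>, \<open>w\<^sub>2\<close> give the same integrals of an \<open>H\<close>-invariant function \<open>p\<close>: if each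
  point \<open>g\<close> sends the mass \<open>w\<^sub>1(g) w\<^sub>2(hg) p(g)\<close> to \<open>hg\<close>, then it sends out \<open>w\<^sub>1(g) p(g)\<close> and receives
  \<open>w\<^sub>2(g) p(g)\<close>, and left invariance of \<open>haar\<close> makes the totals equal.\<close>

lemma mass_transport:
  fixes w1 w2 p :: "'g \<Rightarrow> ennreal"
  assumes H: "H \<in> closed_subgroups" "countable H"
    and [measurable]: "w1 \<in> borel_measurable borel" "w2 \<in> borel_measurable borel" "p \<in> borel_measurable borel"
    and inv: "\<And>h g. h \<in> H \<Longrightarrow> p (h + g) = p g"
    and s1: "\<And>g. p g \<noteq> 0 \<Longrightarrow> (\<integral>\<^sup>+h. w1 (h + g) \<partial>count_space H) = 1"
    and s2: "\<And>g. p g \<noteq> 0 \<Longrightarrow> (\<integral>\<^sup>+h. w2 (h + g) \<partial>count_space H) = 1"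
  shows "(\<integral>\<^sup>+g. w1 g * p g \<partial>haar) = (\<integral>\<^sup>+g. w2 g * p g \<partial>haar)"
proof -
  have eq1: "w1 g * p g = (\<integral>\<^sup>+h. w1 g * p g * w2 (h + g) \<partial>count_space H)" for g
    using s2[of g] by (cases "p g = 0") (simp_all add: nn_integral_cmult)
  have eq2: "w2 g * p g = (\<integral>\<^sup>+h. w1 (- h + g) * p (- h + g) * w2 g \<partial>count_space H)" for g
  proof -
    have "(\<integral>\<^sup>+h. w1 (- h + g) * p (- h + g) * w2 g \<partial>count_space H)
        = (\<integral>\<^sup>+h. (w2 g * p g) * w1 (- h + g) \<partial>count_space H)"
      using closed_subgroupD(4)[OF H(1)] inv by (intro nn_integral_cong) (simp add: mult_ac)
    also have "\<dots> = (w2 g * p g) * (\<integral>\<^sup>+h. w1 (- h + g) \<partial>count_space H)"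
      by (rule nn_integral_cmult) simp
    also have "bij_betw uminus H H"
      using closed_subgroupD(4)[OF H(1)] by (intro bij_betwI[where g = uminus]) auto
    then have "(\<integral>\<^sup>+h. w1 (- h + g) \<partial>count_space H) = (\<integral>\<^sup>+h. w1 (h + g) \<partial>count_space H)"
      by (rule nn_integral_bij_count_space[where f = "\<lambda>h. w1 (h + g)"])
    finally show ?thesis using s1[of g] by (cases "p g = 0") simp_all
  qed
  have "(\<integral>\<^sup>+g. w1 g * p g \<partial>haar) = (\<integral>\<^sup>+g. \<integral>\<^sup>+h. w1 g * p g * w2 (h + g) \<partial>count_space H \<partial>haar)"
    by (subst eq1) simp
  also have "\<dots> = (\<integral>\<^sup>+h. \<integral>\<^sup>+g. w1 g * p g * w2 (h + g) \<partial>haar \<partial>count_space H)"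
    by (rule nn_integral_count_space_nn_integral[OF H(2)]) measurable
  also have "\<dots> = (\<integral>\<^sup>+h. \<integral>\<^sup>+g. w1 (- h + g) * p (- h + g) * w2 g \<partial>haar \<partial>count_space H)"
  proof (rule nn_integral_cong)
    fix h
    show "(\<integral>\<^sup>+g. w1 g * p g * w2 (h + g) \<partial>haar) = (\<integral>\<^sup>+g. w1 (- h + g) * p (- h + g) * w2 g \<partial>haar)"
      using nn_integral_left_translate[of "\<lambda>g. w1 g * p g * w2 (h + g)" "- h"] by simp
  qed
  also have "\<dots> = (\<integral>\<^sup>+g. \<integral>\<^sup>+h. w1 (- h + g) * p (- h + g) * w2 g \<partial>count_space H \<partial>haar)"
    by (rule nn_integral_count_space_nn_integral[OF H(2), symmetric]) measurable
  also have "\<dots> = (\<integral>\<^sup>+g. w2 g * p g \<partial>haar)"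
    by (subst eq2) simp
  finally show ?thesis .
qed

text \<open>The uniform distribution on the points of \<open>C\<close> in \<open>U\<close>. The quotient is \<open>0\<close> everywhere if these
  points are infinite in number.\<close>

definition share :: "'g set \<Rightarrow> 'g set \<Rightarrow> 'g \<Rightarrow> ennreal" where
  "share U C x = indicator U x / num_points U C"

lemma share_sum:
  assumes "C \<inter> U \<noteq> {}" "finite (C \<inter> U)"
  shows "(\<integral>\<^sup>+x. share U C x \<partial>count_space C) = 1"
proof -
  have "(\<integral>\<^sup>+x. share U C x \<partial>count_space C) = (\<integral>\<^sup>+x. indicator (C \<inter> U) x * inverse (num_points U C) \<partial>count_space C)"
    by (intro nn_integral_cong) (auto simp: share_def divide_ennreal_def indicator_def)
  also have "\<dots> = (\<integral>\<^sup>+x. indicator (C \<inter> U) x \<partial>count_space C) * inverse (num_points U C)"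
    by (rule nn_integral_multc) simp
  also have "(\<integral>\<^sup>+x. indicator (C \<inter> U) x \<partial>count_space C) = num_points U C"
    using assms(2) by (subst nn_integral_indicator) (auto simp: num_points_eq)
  also have "num_points U C * inverse (num_points U C) = num_points U C / num_points U C"
    by (simp add: divide_ennreal_def)
  also have "\<dots> = 1"
    using num_points_pos_iff[of U C] num_points_finite_iff[of U C] assms
    by (intro ennreal_divide_self) auto
  finally show ?thesis .
qed

lemma share_le_indicator:
  assumes "x \<in> C" shows "share U C x \<le> indicator U x"
proof (cases "x \<in> U")
  case True
  show ?thesis
  proof (cases "finite (C \<inter> U)")
    case fin: True
    then have "0 < card (C \<inter> U)" using assms True by (auto simp: card_gt_0_iff)
    then have "of_nat 1 \<le> (of_nat (card (C \<inter> U)) :: ennreal)" by (intro of_nat_mono) simp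
    then have "1 \<le> num_points U C" using fin by (simp add: num_points_eq)
    then have "1 / num_points U C \<le> num_points U C / num_points U C"
      by (rule divide_right_mono_ennreal)
    also have "\<dots> = 1"
      using num_points_pos_iff[of U C] num_points_finite_iff[of U C] fin assms True
      by (intro ennreal_divide_self) auto
    finally show ?thesis using True by (simp add: share_def)
  qed (simp add: share_def num_points_eq)
qed (simp add: share_def)

text \<open>A Borel choice of unit weights: \<open>C\<close> spreads its mass over its points in the first basic set
  that it meets.\<close>

definition first_hit :: "'g set \<Rightarrow> nat" where
  "first_hit C = (LEAST n. C \<inter> basic n \<noteq> {})"

definition weight :: "bool \<Rightarrow> 'g set \<Rightarrow> 'g \<Rightarrow> ennreal" where
  "weight fd C x = (if pushed fd C then 1 else share (basic (first_hit C)) C x)"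

lemma first_hit: "C \<noteq> {} \<Longrightarrow> C \<inter> basic (first_hit C) \<noteq> {}"
  unfolding first_hit_def by (rule LeastI_ex) (use basic_cover in blast)

lemma weight_sum:
  assumes H: "tame H" and "\<not> pushed fd H"
  shows "(\<integral>\<^sup>+x. weight fd (rcoset H g) x \<partial>count_space (rcoset H g)) = 1"
proof -
  have cH: "H \<in> closed_subgroups" using H by (simp add: tame_def)
  have "rcoset H g \<noteq> {}" using self_mem_rcoset[OF cH] by blast
  then have "(\<integral>\<^sup>+x. share (basic (first_hit (rcoset H g))) (rcoset H g) x \<partial>count_space (rcoset H g)) = 1"
    by (intro share_sum first_hit discrete_coset_finite[OF cH discrete_if_not_pushed[OF assms] basic(2)])
  then show ?thesis using assms(2) by (simp add: weight_def)
qed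

lemma sets_fell_compact: "{C. closed C \<and> compact C} \<in> sets (borel_of (fell_topology :: 'g set topology))"
proof -
  have "{C. closed C \<and> compact C} = (\<Union>n. space (borel_of fell_topology) -
      {C. closed C \<and> C \<inter> (- (\<Union>i\<le>n. closure (basic i))) \<noteq> {}})" (is "?L = ?R")
  proof (intro set_eqI iffI)
    fix C assume C: "C \<in> ?L"
    then obtain n where "C \<subseteq> (\<Union>i\<le>n. basic i)" using compact_subset_basic by blast
    then have "C \<subseteq> (\<Union>i\<le>n. closure (basic i))" using closure_subset by blast
    then have "C \<inter> - (\<Union>i\<le>n. closure (basic i)) = {}" by blast
    then have "C \<in> space (borel_of fell_topology) - {C. closed C \<and> C \<inter> (- (\<Union>i\<le>n. closure (basic i))) \<noteq> {}}"
      using C by (simp add: topspace_fell)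
    then show "C \<in> ?R" by blast
  next
    fix C assume "C \<in> ?R"
    then obtain n where C: "closed C" "C \<inter> - (\<Union>i\<le>n. closure (basic i)) = {}"
      unfolding space_borel_of topspace_fell by blast
    then have "closed C" "C \<subseteq> (\<Union>i\<le>n. closure (basic i))" by blast+
    moreover have "compact (\<Union>i\<le>n. closure (basic i))" using basic(2) by (intro compact_UN) auto
    ultimately have "compact ((\<Union>i\<le>n. closure (basic i)) \<inter> C)" by (intro compact_Int_closed)
    then show "C \<in> ?L" using \<open>closed C\<close> \<open>C \<subseteq> (\<Union>i\<le>n. closure (basic i))\<close> by (simp add: inf.absorb2)
  qed
  also have "\<dots> \<in> sets (borel_of fell_topology)"
    by (intro sets.countable_UN sets.compl_sets sets_fell_hit image_subsetI open_Compl closed_UN) auto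
  finally show ?thesis .
qed

text \<open>Compactness is measurable because a closed set is compact iff it misses the open complement of
  one of the sets of a countable exhaustion by compact sets, and finiteness because the number of
  points is.\<close>

lemma measurable_pushed: "Measurable.pred (borel_of fell_topology) (pushed fd)"
proof -
  have 1: "Measurable.pred (borel_of fell_topology) (compact :: 'g set \<Rightarrow> bool)"
    using sets_fell_compact by (simp add: pred_def topspace_fell)
  have "finite = (\<lambda>C :: 'g set. num_points UNIV C < \<infinity>)"
    using num_points_finite_iff[of UNIV] by auto
  moreover have "Measurable.pred (borel_of fell_topology) (\<lambda>C :: 'g set. num_points UNIV C < \<infinity>)"
    using measurable_num_points[of "UNIV :: 'g set"] by measurable
  ultimately have 2: "Measurable.pred (borel_of fell_topology) (finite :: 'g set \<Rightarrow> bool)" by simp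
  show ?thesis unfolding pushed_def[abs_def] using 1 2 by measurable
qed

lemma measurable_share:
  assumes "open U"
  shows "(\<lambda>p. share U (fst p) (snd p)) \<in> borel_measurable (borel_of fell_topology \<Otimes>\<^sub>M borel)"
proof -
  have [measurable]: "num_points U \<in> borel_measurable (borel_of fell_topology)" "U \<in> sets borel"
    using measurable_num_points[OF assms] assms by auto
  show ?thesis unfolding share_def by measurable
qed

lemma measurable_first_hit: "first_hit \<in> borel_of fell_topology \<rightarrow>\<^sub>M count_space UNIV"
  unfolding first_hit_def[abs_def]
proof (rule measurable_Least)
  fix n
  have "{C \<in> space (borel_of fell_topology). C \<inter> basic n \<noteq> {}} = {C. closed C \<and> C \<inter> basic n \<noteq> {}}"
    by (auto simp: topspace_fell)
  then show "Measurable.pred (borel_of fell_topology) (\<lambda>C. C \<inter> basic n \<noteq> {})"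
    unfolding pred_def using sets_fell_hit[OF basic(1), of n] by simp
qed

lemma measurable_weight:
  "(\<lambda>p. weight fd (fst p) (snd p)) \<in> borel_measurable (borel_of fell_topology \<Otimes>\<^sub>M borel)"
  unfolding weight_def
proof (rule measurable_If)
  show "(\<lambda>p. share (basic (first_hit (fst p))) (fst p) (snd p)) \<in> borel_measurable (borel_of fell_topology \<Otimes>\<^sub>M borel)"
    by (rule measurable_compose_countable[OF measurable_share[OF basic(1)]
        measurable_compose[OF measurable_fst measurable_first_hit]])
  show "{p \<in> space (borel_of fell_topology \<Otimes>\<^sub>M borel). pushed fd (fst p)} \<in> sets (borel_of fell_topology \<Otimes>\<^sub>M borel)"
    using measurable_compose[OF measurable_fst measurable_pushed] unfolding pred_def .
qed simp

lemma measurable_weight_rcoset [measurable]: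
  "(\<lambda>p. weight fd (rcoset (fst p) (snd p)) (snd p)) \<in> borel_measurable (Sub \<Otimes>\<^sub>M borel)"
proof -
  have "(\<lambda>p. (rcoset (fst p) (snd p), snd p :: 'g)) \<in> Sub \<Otimes>\<^sub>M borel \<rightarrow>\<^sub>M borel_of fell_topology \<Otimes>\<^sub>M borel"
    by (intro measurable_Pair measurable_snd) (rule measurable_compose[OF measurable_rcoset measurable_Cos_fell])
  from measurable_compose[OF this measurable_weight] show ?thesis by simp
qed

lemma measurable_section:
  "H \<in> closed_subgroups \<Longrightarrow> (\<lambda>g. (H, g)) \<in> borel \<rightarrow>\<^sub>M Sub \<Otimes>\<^sub>M (borel :: 'g measure)"
  by (intro measurable_Pair) (auto simp: topspace_chabauty)

lemma unit_density_weight: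
  assumes "tame H" shows "unit_density fd H (\<lambda>g. weight fd (rcoset H g) g)"
proof -
  have cH: "H \<in> closed_subgroups" using assms by (simp add: tame_def)
  have "(\<integral>\<^sup>+h. weight fd (rcoset H (h + g)) (h + g) \<partial>count_space H) = 1" if "\<not> pushed fd H" for g
  proof -
    have "(\<integral>\<^sup>+h. weight fd (rcoset H (h + g)) (h + g) \<partial>count_space H)
      = (\<integral>\<^sup>+h. weight fd (rcoset H g) (h + g) \<partial>count_space H)"
      by (intro nn_integral_cong) (simp add: rcoset_add[OF cH])
    then show ?thesis using nn_integral_count_rcoset[where f = "weight fd (rcoset H g)"] weight_sum[OF assms that] by simp
  qed
  moreover have "(\<lambda>g. weight fd (rcoset H g) g) \<in> borel_measurable borel"
    using measurable_compose[OF measurable_section[OF cH] measurable_weight_rcoset] by simp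
  ultimately show ?thesis by (auto simp: unit_density_def weight_def)
qed

lemma unit_density_right_translate:
  assumes "unit_density fd H w" shows "unit_density fd H (\<lambda>g. w (g + k))"
proof -
  have [measurable]: "w \<in> borel_measurable borel" using assms by (simp add: unit_density_def)
  have "(\<lambda>g. w (g + k)) \<in> borel_measurable borel" by measurable
  then show ?thesis using assms by (simp add: unit_density_def add.assoc)
qed

lemma unit_density_conjugate:
  assumes H: "H \<in> closed_subgroups" and w: "unit_density fd (conjugate (- k) H) w"
  shows "unit_density fd H (\<lambda>g. w (- k + g))"
proof -
  have [measurable]: "w \<in> borel_measurable borel" using w by (simp add: unit_density_def)
  have "(\<lambda>g. w (- k + g)) \<in> borel_measurable borel" by measurable
  moreover have "(\<integral>\<^sup>+h. w (- k + (h + g)) \<partial>count_space H)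
      = (\<integral>\<^sup>+h. w (h + (- k + g)) \<partial>count_space (conjugate (- k) H))" for g
  proof -
    have "bij_betw (\<lambda>h. - k + h - - k) H (conjugate (- k) H)"
      unfolding bij_betw_def conjugate_def by (auto simp: inj_on_def)
    from nn_integral_bij_count_space[OF this, of "\<lambda>h. w (h + (- k + g))"]
    show ?thesis by (simp add: group_arith del: add_uminus_conv_diff)
  qed
  ultimately show ?thesis using w by (simp add: unit_density_def)
qed

text \<open>Weighting \<open>g\<close> by the weight of \<open>g\<^sup>-\<^sup>1\<close> in the inverse coset is again a unit weight, because
  inversion is a bijection of \<open>Hg\<close> onto \<open>g\<^sup>-\<^sup>1H\<close>.\<close>

lemma unit_density_inverse:
  assumes "tame H" shows "unit_density fd H (\<lambda>g. weight fd (coset_inverse (rcoset H g)) (- g))"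
proof -
  have cH: "H \<in> closed_subgroups" using assms by (simp add: tame_def)
  have "(\<lambda>g. (coset_inverse (rcoset H g), - g)) \<in> borel \<rightarrow>\<^sub>M borel_of fell_topology \<Otimes>\<^sub>M borel"
  proof (intro measurable_Pair measurable_uminus_group measurable_ident_sets[OF refl])
    show "(\<lambda>g. coset_inverse (rcoset H g)) \<in> borel \<rightarrow>\<^sub>M borel_of fell_topology"
      using measurable_compose[OF measurable_compose[OF measurable_compose[OF measurable_section[OF cH]
        measurable_rcoset] measurable_coset_inverse] measurable_Cos_fell] by simp
  qed
  from measurable_compose[OF this measurable_weight]
  have "(\<lambda>g. weight fd (coset_inverse (rcoset H g)) (- g)) \<in> borel_measurable borel" by simp
  moreover have "(\<integral>\<^sup>+h. weight fd (coset_inverse (rcoset H (h + g))) (- (h + g)) \<partial>count_space H) = 1"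
    if "\<not> pushed fd H" for g
  proof -
    let ?C = "coset_inverse (rcoset H g)"
    have "bij_betw uminus (rcoset H g) ?C"
      by (auto simp: bij_betw_def coset_inverse_def)
    then have "(\<integral>\<^sup>+x. weight fd ?C (- x) \<partial>count_space (rcoset H g)) = (\<integral>\<^sup>+x. weight fd ?C x \<partial>count_space ?C)"
      by (rule nn_integral_bij_count_space)
    also have "\<dots> = 1"
      unfolding coset_inverse_eq_rcoset[OF cH]
      by (rule weight_sum[OF tame_conjugate[OF assms]]) (use that in simp)
    finally have "(\<integral>\<^sup>+h. weight fd ?C (- (h + g)) \<partial>count_space H) = 1"
      using nn_integral_count_rcoset[where f = "\<lambda>x. weight fd ?C (- x)"] by simp
    moreover have "(\<integral>\<^sup>+h. weight fd (coset_inverse (rcoset H (h + g))) (- (h + g)) \<partial>count_space H)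
      = (\<integral>\<^sup>+h. weight fd ?C (- (h + g)) \<partial>count_space H)"
      by (intro nn_integral_cong) (simp add: rcoset_add[OF cH])
    ultimately show ?thesis by simp
  qed
  moreover have "weight fd (coset_inverse (rcoset H g)) (- g) = 1" if "pushed fd H" for g
    using that by (simp add: weight_def coset_inverse_eq_rcoset[OF cH])
  ultimately show ?thesis by (auto simp: unit_density_def)
qed

section \<open>The coset measures as weighted push forwards\<close>

lemma measurable_rcoset_quotient:
  assumes H: "H \<in> closed_subgroups"
  shows "rcoset H \<in> borel \<rightarrow>\<^sub>M borel_of (quotient_topology (H :: 'g set))"
  unfolding quotient_topology_eq[OF H]
proof (rule measurable_into_fell_subspace)
  show "{x \<in> space borel. rcoset H x \<inter> U \<noteq> {}} \<in> sets borel" if "open U" for U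
    using open_rcoset_hit[OF that, of H] by simp
qed (use closed_rcoset[OF closed_subgroupD(1)[OF H]] in auto)

text \<open>Countably many of the evenly covered sets cover the coset space by the Lindeloef property, and the
  values on their measurable subsets are prescribed.\<close>

lemma local_push_forward_unique:
  assumes H: "H \<in> closed_subgroups" "discrete H"
    and N: "local_push_forward haar H N" and N': "local_push_forward haar H N'"
  shows "N = N'"
proof -
  define \<F> where "\<F> = {V. open V \<and> (\<exists>\<V>. evenly_covered H (rcoset H ` V) \<V> \<and> V \<in> \<V>)}"
  obtain \<F>' where \<F>': "\<F>' \<subseteq> \<F>" "countable \<F>'" "\<Union>\<F>' = \<Union>\<F>"
    using Lindelof[of \<F>] by (auto simp: \<F>_def)
  have "g \<in> \<Union>\<F>" for g
    using discrete_subgroup_evenly_covered[OF H, of g] unfolding \<F>_def by (metis (mono_tags, lifting) UnionI mem_Collect_eq)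
  then have cover: "\<Union>\<F>' = UNIV" using \<F>'(3) by blast
  then have ne: "\<F>' \<noteq> {}" by auto
  define U where "U n = rcoset H ` from_nat_into \<F>' n" for n
  have sets: "sets N = sets (borel_of (quotient_topology H))" "sets N' = sets (borel_of (quotient_topology H))"
    using N N' by (auto simp: local_push_forward_def)
  have U: "\<exists>\<V> V. evenly_covered H (U n) \<V> \<and> V \<in> \<V>" for n
    using from_nat_into[OF ne, of n] \<F>'(1) unfolding U_def \<F>_def by blast
  have U_sets: "U n \<in> sets N" for n
  proof -
    obtain \<V> where "evenly_covered H (U n) \<V>" using U by blast
    then show ?thesis unfolding sets by (intro openin_sets_borel_of) (simp add: evenly_covered_def)
  qed
  have agree: "emeasure N A = emeasure N' A" if "A \<in> sets N" "A \<subseteq> U n" for A n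
  proof -
    obtain \<V> V where "evenly_covered H (U n) \<V>" "V \<in> \<V>" using U by blast
    then show ?thesis using N N' that sets unfolding local_push_forward_def by metis
  qed
  have U_cover: "(\<Union>n. U n) = range (rcoset H)"
  proof -
    have "(\<Union>n. U n) = rcoset H ` (\<Union>n. from_nat_into \<F>' n)" by (auto simp: U_def)
    also have "(\<Union>n. from_nat_into \<F>' n) = \<Union>\<F>'" using range_from_nat_into[OF ne \<F>'(2)] by simp
    finally show ?thesis using cover by simp
  qed
  show ?thesis
  proof (rule measure_eqI)
    show "sets N = sets N'" using sets by simp
    fix A assume A: "A \<in> sets N"
    define D where "D n = A \<inter> disjointed U n" for n
    have "A \<subseteq> range (rcoset H)"
      using sets.sets_into_space[OF A] sets_eq_imp_space_eq[OF sets(1)] topspace_quotient[OF H(1)] by simp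
    moreover have "(\<Union>n. D n) = A \<inter> (\<Union>n. disjointed U n)" by (auto simp: D_def)
    ultimately have "(\<Union>n. D n) = A" unfolding UN_disjointed_eq U_cover by blast
    moreover have D: "D n \<in> sets N" "D n \<subseteq> U n" for n
    proof -
      have "range (disjointed U) \<subseteq> sets N" using U_sets by (intro sets.range_disjointed_sets) blast
      then show "D n \<in> sets N" unfolding D_def using A by blast
      show "D n \<subseteq> U n" unfolding D_def using disjointed_subset[of U n] by blast
    qed
    moreover have "disjoint_family D"
      using disjoint_family_disjointed[of U] unfolding D_def disjoint_family_on_def by blast
    ultimately have "emeasure N A = (\<Sum>n. emeasure N (D n))" "emeasure N' A = (\<Sum>n. emeasure N' (D n))"
      using suminf_emeasure[of D N] suminf_emeasure[of D N'] sets by (auto simp: image_subset_iff)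
    then show "emeasure N A = emeasure N' A" using agree[OF D] by simp
  qed
qed

text \<open>Over an evenly covered set, the indicator function of a sheet has sum \<open>1\<close> on every coset, so it
  can replace the density \<open>w\<close> by mass transport.\<close>

lemma local_push_forward_exists:
  assumes H: "tame H" and np: "\<not> pushed fd H" and w: "unit_density fd H w"
  shows "local_push_forward haar H (distr (density haar w) (borel_of (quotient_topology H)) (rcoset H))"
    (is "local_push_forward haar H ?N")
proof -
  have cH: "H \<in> closed_subgroups" using H by (simp add: tame_def)
  have disc: "discrete H" by (rule discrete_if_not_pushed[OF H np])
  have [measurable]: "w \<in> borel_measurable borel" using w by (simp add: unit_density_def)
  have rc [measurable]: "rcoset H \<in> borel \<rightarrow>\<^sub>M borel_of (quotient_topology H)"
    by (rule measurable_rcoset_quotient[OF cH])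
  show ?thesis
    unfolding local_push_forward_def
  proof (intro conjI allI impI ballI)
    show "sets ?N = sets (borel_of (quotient_topology H))" by simp
    fix U \<V> V A assume ec: "evenly_covered H U \<V>" and V: "V \<in> \<V>" and "A \<in> sets ?N" and AU: "A \<subseteq> U"
    then have A [measurable]: "A \<in> sets (borel_of (quotient_topology H))" by simp
    have opV: "open V" and hom: "homeomorphic_map (top_of_set V) (subtopology (quotient_topology H) U) (rcoset H)"
      using ec V by (auto simp: evenly_covered_def)
    have [measurable]: "V \<in> sets borel" using opV by simp
    have UU: "topspace (subtopology (quotient_topology H) U) = U"
      using ec openin_subset by (fastforce simp: evenly_covered_def)
    have surj: "rcoset H ` V = U" and inj: "inj_on (rcoset H) V"
      using homeomorphic_imp_surjective_map[OF hom] homeomorphic_imp_injective_map[OF hom] UU by auto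
    define p :: "'g \<Rightarrow> ennreal" where "p g = indicator A (rcoset H g)" for g
    have p [measurable]: "p \<in> borel_measurable borel" unfolding p_def by measurable
    have one: "(\<integral>\<^sup>+h. indicator V (h + g) \<partial>count_space H) = (1::ennreal)" if "p g \<noteq> 0" for g
    proof -
      have "rcoset H g \<in> U" using that AU by (auto simp: p_def indicator_def split: if_splits)
      then obtain v where v: "v \<in> V" "rcoset H v = rcoset H g" using surj by blast
      have "rcoset H g \<inter> V = {v}"
      proof (intro set_eqI iffI)
        fix x assume "x \<in> rcoset H g \<inter> V"
        then have "x \<in> V" "rcoset H x = rcoset H v" using rcoset_eqI[OF cH] v by auto
        then show "x \<in> {v}" using inj_onD[OF inj _ _ v(1)] by blast
      next
        fix x assume "x \<in> {v}"
        then show "x \<in> rcoset H g \<inter> V" using v self_mem_rcoset[OF cH, of v] by simp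
      qed
      moreover have "(\<integral>\<^sup>+x. indicator V x \<partial>count_space (rcoset H g))
        = (\<integral>\<^sup>+x. indicator (rcoset H g \<inter> V) x \<partial>count_space (rcoset H g))"
        by (intro nn_integral_cong) (auto simp: indicator_def)
      moreover have "v \<in> rcoset H g" using v self_mem_rcoset[OF cH, of v] by simp
      ultimately have "(\<integral>\<^sup>+x. indicator V x \<partial>count_space (rcoset H g)) = (1::ennreal)"
        by (simp add: nn_integral_indicator)
      then show ?thesis using nn_integral_count_rcoset[where f = "indicator V"] by simp
    qed
    have "emeasure ?N A = (\<integral>\<^sup>+g. w g * p g \<partial>haar)"
    proof -
      have "rcoset H \<in> density haar w \<rightarrow>\<^sub>M borel_of (quotient_topology H)"
        using rc by (simp add: measurable_cong_sets[OF sets_haar refl])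
      then have "emeasure ?N A = emeasure (density haar w) (rcoset H -` A)"
        by (subst emeasure_distr) auto
      also have "\<dots> = (\<integral>\<^sup>+g. w g * indicator (rcoset H -` A) g \<partial>haar)"
        using measurable_sets[OF rc A] by (intro emeasure_density) (auto simp: sets_haar borel_measurable_haar_iff)
      finally show ?thesis by (simp add: p_def indicator_def)
    qed
    also have "\<dots> = (\<integral>\<^sup>+g. indicator V g * p g \<partial>haar)"
    proof (rule mass_transport[OF cH discrete_subgroup_countable[OF cH disc]])
      show "p (h + g) = p g" if "h \<in> H" for h g by (simp add: p_def rcoset_add[OF cH that])
      show "(\<integral>\<^sup>+h. w (h + g) \<partial>count_space H) = 1" for g using w np by (simp add: unit_density_def)
    qed (use one in auto)
    also have "\<dots> = (\<integral>\<^sup>+g. indicator (V \<inter> rcoset H -` A) g \<partial>haar)"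
      by (intro nn_integral_cong) (auto simp: p_def indicator_def)
    also have "\<dots> = emeasure haar (V \<inter> rcoset H -` A)"
      using measurable_sets[OF rc A] by (intro nn_integral_indicator) (simp add: sets_haar)
    finally show "emeasure ?N A = emeasure haar (V \<inter> rcoset H -` A)" .
  qed
qed

lemma coset_measure_eq:
  assumes H: "tame H" and w: "unit_density fd H w"
  shows "coset_measure fd haar H = distr (density haar w) (borel_of (quotient_topology H)) (rcoset H)"
proof (cases "pushed fd H")
  case True
  then have "w = (\<lambda>_. 1)" using w by (auto simp: unit_density_def)
  then show ?thesis using True by (simp add: coset_measure_def pushed_def density_1)
next
  case False
  have "(THE N. local_push_forward haar H N) = distr (density haar w) (borel_of (quotient_topology H)) (rcoset H)"
  proof (rule the_equality)
    show "local_push_forward haar H (distr (density haar w) (borel_of (quotient_topology H)) (rcoset H))"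
      by (rule local_push_forward_exists[OF H False w])
    then show "N = distr (density haar w) (borel_of (quotient_topology H)) (rcoset H)"
      if "local_push_forward haar H N" for N
      using local_push_forward_unique[OF _ discrete_if_not_pushed[OF H False] that] H by (simp add: tame_def)
  qed
  then show ?thesis using False unfolding coset_measure_def pushed_def[symmetric] by simp
qed

lemma nn_integral_coset_measure:
  assumes H: "tame H" and w: "unit_density fd H w"
    and q: "q \<in> borel_measurable (borel_of (quotient_topology H))"
  shows "(\<integral>\<^sup>+C. q C \<partial>coset_measure fd haar H) = (\<integral>\<^sup>+g. w g * q (rcoset H g) \<partial>haar)"
proof -
  have cH: "H \<in> closed_subgroups" using H by (simp add: tame_def)
  have wm: "w \<in> borel_measurable borel" using w by (simp add: unit_density_def)
  have rc: "rcoset H \<in> borel \<rightarrow>\<^sub>M borel_of (quotient_topology H)" by (rule measurable_rcoset_quotient[OF cH])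
  have "(\<integral>\<^sup>+C. q C \<partial>coset_measure fd haar H) = (\<integral>\<^sup>+g. q (rcoset H g) \<partial>density haar w)"
    unfolding coset_measure_eq[OF H w]
    by (rule nn_integral_distr) (use rc q in \<open>simp_all add: measurable_cong_sets[OF sets_haar refl]\<close>)
  also have "\<dots> = (\<integral>\<^sup>+g. w g * q (rcoset H g) \<partial>haar)"
    using wm measurable_compose[OF rc q] by (intro nn_integral_density) (auto simp: borel_measurable_haar_iff)
  finally show ?thesis .
qed

end

locale haar_modular = haar_group haar
  for haar :: "'g::{topological_group_add, t2_space, second_countable_topology} measure" +
  fixes \<mu> :: "'g \<Rightarrow> real"
  assumes modular: "modular_function haar \<mu>"
begin

lemma \<mu>_pos: "0 < \<mu> g"
  using modular by (simp add: modular_function_def)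

lemma nn_integral_right_translate:
  assumes [measurable]: "F \<in> borel_measurable borel"
  shows "(\<integral>\<^sup>+x. F (x + a) \<partial>haar) = ennreal (\<mu> a) * (\<integral>\<^sup>+x. F x \<partial>haar)"
proof -
  have "distr haar borel (\<lambda>x. x + a) = scale_measure (ennreal (\<mu> a)) haar"
  proof (rule measure_eqI)
    show "sets (distr haar borel (\<lambda>x. x + a)) = sets (scale_measure (ennreal (\<mu> a)) haar)"
      by (simp add: sets_haar)
    fix S assume "S \<in> sets (distr haar borel (\<lambda>x. x + a))"
    then have S [measurable]: "S \<in> sets borel" by simp
    then have "emeasure (distr haar borel (\<lambda>x. x + a)) S = emeasure haar ((\<lambda>x. x + a) -` S)"
      by (subst emeasure_distr) (auto simp: measurable_cong_sets[OF sets_haar refl])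
    also have "\<dots> = ennreal (\<mu> a) * emeasure haar ((\<lambda>x. x + a) ` ((\<lambda>x. x + a) -` S))"
    proof -
      have "(\<lambda>x. x + a) -` S \<in> sets borel"
        using measurable_sets[OF measurable_translate(2) S, of a] by simp
      then show ?thesis using modular unfolding modular_function_def by blast
    qed
    also have "(\<lambda>x. x + a) ` ((\<lambda>x. x + a) -` S) = S"
      by (intro set_eqI) (simp only: mem_translate_right vimage_eq diff_add_cancel)
    finally show "emeasure (distr haar borel (\<lambda>x. x + a)) S = emeasure (scale_measure (ennreal (\<mu> a)) haar) S"
      by simp
  qed
  then have "(\<integral>\<^sup>+x. F x \<partial>distr haar borel (\<lambda>x. x + a)) = ennreal (\<mu> a) * (\<integral>\<^sup>+x. F x \<partial>haar)"
    by (simp add: nn_integral_scale_measure borel_measurable_haar_iff)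
  moreover have "(\<integral>\<^sup>+x. F x \<partial>distr haar borel (\<lambda>x. x + a)) = (\<integral>\<^sup>+x. F (x + a) \<partial>haar)"
    by (rule nn_integral_distr) (auto simp: measurable_cong_sets[OF sets_haar refl])
  ultimately show ?thesis by simp
qed

lemma symmetric_nbhd:
  obtains V :: "'g set" where "open V" "compact (closure V)" "0 \<in> V" "\<And>x. - x \<in> V \<longleftrightarrow> x \<in> V"
proof -
  obtain W :: "'g set" where W: "open W" "compact (closure W)" "0 \<in> W"
    using relatively_compact_nbhd[OF open_UNIV, of 0] by blast
  have "open (W \<inter> uminus -` W)" using W by (intro open_Int open_vimage continuous_intros)
  moreover have "compact (closure W \<inter> closure (W \<inter> uminus -` W))" using W(2) by (intro compact_Int_closed) auto
  then have "compact (closure (W \<inter> uminus -` W))"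
    using closure_mono[of "W \<inter> uminus -` W" W] by (simp add: inf.absorb2)
  ultimately show thesis using that[of "W \<inter> uminus -` W"] W(3) by auto
qed

lemma unit_mass_set:
  obtains V l where "open V" "emeasure haar V = ennreal l" "0 < l"
proof -
  obtain V :: "'g set" where V: "open V" "compact (closure V)" "0 \<in> V" using symmetric_nbhd by metis
  have "0 < emeasure haar V" "emeasure haar V < \<infinity>"
    using haar_open_pos[OF V(1)] haar_relatively_compact_finite[OF V(2)] V(3) by auto
  then show thesis using that[OF V(1), of "enn2real (emeasure haar V)"]
    by (simp add: enn2real_positive_iff)
qed

lemma \<mu>_add: "\<mu> (a + b) = \<mu> a * \<mu> b"
proof -
  obtain V l where V: "open V" "emeasure haar V = ennreal l" "0 < l" by (rule unit_mass_set)
  have [measurable]: "V \<in> sets borel" using V(1) by simp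
  have int: "(\<integral>\<^sup>+x. indicator V x \<partial>haar) = ennreal l"
    using V(2) by (simp add: sets_haar)
  have *: "(\<integral>\<^sup>+x. indicator V (x + c) \<partial>haar) = ennreal (\<mu> c * l)" for c
    using nn_integral_right_translate[of "indicator V" c] V(3) \<mu>_pos[of c] int by (simp add: ennreal_mult)
  have "ennreal (\<mu> (a + b) * l) = (\<integral>\<^sup>+x. indicator V ((x + a) + b) \<partial>haar)"
    using *[of "a + b"] by (simp add: add.assoc)
  also have "\<dots> = ennreal (\<mu> a) * (\<integral>\<^sup>+x. indicator V (x + b) \<partial>haar)"
    by (rule nn_integral_right_translate) measurable
  also have "\<dots> = ennreal (\<mu> a * (\<mu> b * l))"
    unfolding * using \<mu>_pos[of a] \<mu>_pos[of b] V(3) by (simp add: ennreal_mult)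
  finally have "\<mu> (a + b) * l = \<mu> a * (\<mu> b * l)"
    using \<mu>_pos[of a] \<mu>_pos[of b] \<mu>_pos[of "a + b"] V(3) by simp
  then show ?thesis using V(3) by simp
qed

lemma \<mu>_zero [simp]: "\<mu> 0 = 1"
  using \<mu>_add[of 0 0] \<mu>_pos[of 0] by simp

lemma \<mu>_minus: "\<mu> (- g) = 1 / \<mu> g"
  using \<mu>_add[of g "- g"] \<mu>_pos[of g] by (simp add: field_simps)

text \<open>By Fatou's lemma, \<open>g \<mapsto> haar (V - g) = \<mu> g * haar V\<close> is lower semicontinuous for open \<open>V\<close>.
  As \<open>\<mu>\<close> is a homomorphism, it is then upper semicontinuous as well.\<close>

lemma open_\<mu>_greater: "open {g. a < \<mu> g}"
proof (cases "0 \<le> a")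
  case False
  then have "{g. a < \<mu> g} = UNIV" using \<mu>_pos by (auto intro: less_trans less_imp_le simp: not_le)
  then show ?thesis by simp
next
  case True
  obtain V l where V: "open V" "emeasure haar V = ennreal l" "0 < l" by (rule unit_mass_set)
  have [measurable]: "V \<in> sets borel" using V(1) by simp
  have int: "(\<integral>\<^sup>+x. indicator V (x + c) \<partial>haar) = ennreal (\<mu> c * l)" for c
    using nn_integral_right_translate[of "indicator V" c] V \<mu>_pos[of c] by (simp add: sets_haar ennreal_mult)
  have ev: "eventually (\<lambda>g. a < \<mu> g) (nhds g)" if g: "a < \<mu> g" for g
    unfolding eventually_nhds_iff_sequentially
  proof (intro allI impI)
    fix s assume s: "s \<longlonglongrightarrow> g"
    have "(indicator V (x + g) :: ennreal) \<le> liminf (\<lambda>n. indicator V (x + s n))" for x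
    proof (cases "x + g \<in> V")
      case True
      have "(\<lambda>n. x + s n) \<longlonglongrightarrow> x + g" using s by (intro tendsto_intros)
      then have "eventually (\<lambda>n. x + s n \<in> V) sequentially" using V(1) True by (rule topological_tendstoD)
      then have "eventually (\<lambda>n. (1::ennreal) \<le> indicator V (x + s n)) sequentially"
        by eventually_elim simp
      then show ?thesis using True by (simp add: Liminf_bounded)
    qed simp
    then have "(\<integral>\<^sup>+x. indicator V (x + g) \<partial>haar) \<le> (\<integral>\<^sup>+x. liminf (\<lambda>n. indicator V (x + s n)) \<partial>haar)"
      by (rule nn_integral_mono)
    also have "\<dots> \<le> liminf (\<lambda>n. \<integral>\<^sup>+x. indicator V (x + s n) \<partial>haar)"
      by (rule nn_integral_liminf) measurable
    finally have "ennreal (\<mu> g * l) \<le> liminf (\<lambda>n. ennreal (\<mu> (s n) * l))" unfolding int .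
    moreover have "ennreal (a * l) < ennreal (\<mu> g * l)" using g True V(3) by (simp add: ennreal_less_iff)
    ultimately have "eventually (\<lambda>n. ennreal (a * l) < ennreal (\<mu> (s n) * l)) sequentially"
      by (intro less_LiminfD) (rule less_le_trans)
    then show "eventually (\<lambda>n. a < \<mu> (s n)) sequentially"
      by eventually_elim (use True V(3) in \<open>simp add: ennreal_less_iff\<close>)
  qed
  show ?thesis
  proof (rule topological_space_class.openI)
    fix g assume "g \<in> {g. a < \<mu> g}"
    then show "\<exists>T. open T \<and> g \<in> T \<and> T \<subseteq> {g. a < \<mu> g}"
      using ev[of g] unfolding eventually_nhds by blast
  qed
qed

lemma open_\<mu>_less: "open {g. \<mu> g < b}"
proof (cases "0 < b")
  case True
  have "open (uminus -` {g. 1 / b < \<mu> g})" by (intro open_vimage open_\<mu>_greater continuous_intros)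
  moreover have "uminus -` {g. 1 / b < \<mu> g} = {g. \<mu> g < b}"
    using True \<mu>_pos by (auto simp: \<mu>_minus divide_less_cancel divide_strict_left_mono field_simps)
  ultimately show ?thesis by simp
next
  case False
  then have "{g. \<mu> g < b} = {}" using \<mu>_pos by (auto simp: not_less intro: less_imp_le order_trans)
  then show ?thesis by simp
qed

lemma continuous_on_\<mu>: "continuous_on UNIV \<mu>"
  unfolding continuous_on_def
proof (intro ballI order_tendstoI)
  fix g a assume "a < \<mu> g"
  then show "eventually (\<lambda>x. a < \<mu> x) (at g within UNIV)"
    unfolding eventually_at_topological using open_\<mu>_greater[of a] by blast
next
  fix g a assume "\<mu> g < a"
  then show "eventually (\<lambda>x. \<mu> x < a) (at g within UNIV)"
    unfolding eventually_at_topological using open_\<mu>_less[of a] by blast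
qed

lemma measurable_\<mu> [measurable]: "\<mu> \<in> borel_measurable borel"
  by (rule borel_measurable_continuous_onI[OF continuous_on_\<mu>])

text \<open>The powers of a value of \<open>\<mu>\<close> on \<open>H\<close> are values of \<open>\<mu>\<close> on \<open>H\<close>, so they are bounded.\<close>

lemma \<mu>_compact_subgroup:
  assumes H: "H \<in> closed_subgroups" "compact H" and h: "h \<in> H"
  shows "\<mu> h = 1"
proof -
  have "compact (\<mu> ` H)" using H(2) continuous_on_subset[OF continuous_on_\<mu>]
    by (intro compact_continuous_image) auto
  then obtain B where B: "\<And>x. x \<in> H \<Longrightarrow> \<mu> x \<le> B"
    using compact_imp_bounded bounded_iff by (metis abs_le_D1 imageI real_norm_def)
  have le: "\<mu> x \<le> 1" if x: "x \<in> H" for x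
  proof (rule ccontr)
    assume "\<not> \<mu> x \<le> 1"
    then obtain n where n: "B < \<mu> x ^ n" using real_arch_pow[of "\<mu> x" B] by auto
    have "\<exists>y\<in>H. \<mu> y = \<mu> x ^ m" for m
    proof (induction m)
      case 0
      show ?case using closed_subgroupD(2)[OF H(1)] by (intro bexI[of _ 0]) auto
    next
      case (Suc m)
      then obtain y where "y \<in> H" "\<mu> y = \<mu> x ^ m" by blast
      then show ?case using closed_subgroupD(3)[OF H(1) x] by (intro bexI[of _ "x + y"]) (auto simp: \<mu>_add)
    qed
    then show False using B n by (metis not_le)
  qed
  have "\<mu> (- h) \<le> 1" by (rule le[OF closed_subgroupD(4)[OF H(1) h]])
  then have "1 \<le> \<mu> h" using \<mu>_pos[of h] by (simp add: \<mu>_minus)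
  then show ?thesis using le[OF h] by simp
qed

lemma pair_haar: "pair_sigma_finite haar haar"
  by (intro pair_sigma_finite.intro) unfold_locales

text \<open>Inversion turns \<open>haar\<close> into \<open>\<mu> haar\<close>. For a test function \<open>\<psi>\<close>, the double integral of
  \<open>F (- x) \<mu> (- x) \<psi> (y + x)\<close> is the product of the left side and \<open>\<integral>\<psi>\<close> by right translation of \<open>\<psi>\<close>, and
  the product of the right side and \<open>\<integral>\<psi>\<close> by the left translation that replaces \<open>x\<close> by \<open>- y + x\<close>.\<close>

lemma nn_integral_inverse:
  assumes [measurable]: "F \<in> borel_measurable borel"
  shows "(\<integral>\<^sup>+x. F (- x) \<partial>haar) = (\<integral>\<^sup>+x. F x * ennreal (\<mu> x) \<partial>haar)"
proof -
  interpret P: pair_sigma_finite haar haar by (rule pair_haar)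
  obtain V l where V: "open V" "emeasure haar V = ennreal l" "0 < l" by (rule unit_mass_set)
  have V_meas [measurable]: "V \<in> sets borel" using V(1) by simp
  define \<psi> :: "'g \<Rightarrow> ennreal" where "\<psi> = indicator V"
  have [measurable]: "\<psi> \<in> borel_measurable borel" unfolding \<psi>_def by measurable
  have int: "(\<integral>\<^sup>+x. \<psi> x \<partial>haar) = ennreal l" using V(2) by (simp add: \<psi>_def sets_haar)
  have one: "ennreal (\<mu> (- x)) * (ennreal (\<mu> x) * ennreal l) = ennreal l" for x
    using \<mu>_pos[of x] V(3) by (simp add: \<mu>_minus ennreal_mult[symmetric])
  have "(\<integral>\<^sup>+x. F (- x) \<partial>haar) * ennreal l = (\<integral>\<^sup>+x. F (- x) * ennreal l \<partial>haar)"
    by (rule nn_integral_multc[symmetric]) measurable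
  also have "\<dots> = (\<integral>\<^sup>+x. \<integral>\<^sup>+y. F (- x) * ennreal (\<mu> (- x)) * \<psi> (y + x) \<partial>haar \<partial>haar)"
  proof (rule nn_integral_cong)
    fix x
    have "(\<integral>\<^sup>+y. F (- x) * ennreal (\<mu> (- x)) * \<psi> (y + x) \<partial>haar)
        = F (- x) * ennreal (\<mu> (- x)) * (\<integral>\<^sup>+y. \<psi> (y + x) \<partial>haar)"
      by (rule nn_integral_cmult) measurable
    also have "\<dots> = F (- x) * (ennreal (\<mu> (- x)) * (ennreal (\<mu> x) * ennreal l))"
      by (subst nn_integral_right_translate) (simp_all add: int mult.assoc)
    finally show "F (- x) * ennreal l = (\<integral>\<^sup>+y. F (- x) * ennreal (\<mu> (- x)) * \<psi> (y + x) \<partial>haar)"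
      unfolding one by simp
  qed
  also have "\<dots> = (\<integral>\<^sup>+y. \<integral>\<^sup>+x. F (- x) * ennreal (\<mu> (- x)) * \<psi> (y + x) \<partial>haar \<partial>haar)"
    by (rule P.Fubini'[symmetric]) measurable
  also have "\<dots> = (\<integral>\<^sup>+y. \<integral>\<^sup>+x. F (- x + y) * ennreal (\<mu> (- x + y)) * \<psi> x \<partial>haar \<partial>haar)"
  proof (rule nn_integral_cong)
    fix y
    have "(\<integral>\<^sup>+x. F (- (- y + x)) * ennreal (\<mu> (- (- y + x))) * \<psi> (y + (- y + x)) \<partial>haar)
        = (\<integral>\<^sup>+x. F (- x) * ennreal (\<mu> (- x)) * \<psi> (y + x) \<partial>haar)"
      by (rule nn_integral_left_translate[of "\<lambda>x. F (- x) * ennreal (\<mu> (- x)) * \<psi> (y + x)"]) measurable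
    then show "(\<integral>\<^sup>+x. F (- x) * ennreal (\<mu> (- x)) * \<psi> (y + x) \<partial>haar)
        = (\<integral>\<^sup>+x. F (- x + y) * ennreal (\<mu> (- x + y)) * \<psi> x \<partial>haar)"
      by (simp add: minus_add)
  qed
  also have "\<dots> = (\<integral>\<^sup>+x. \<integral>\<^sup>+y. F (- x + y) * ennreal (\<mu> (- x + y)) * \<psi> x \<partial>haar \<partial>haar)"
    by (rule P.Fubini') measurable
  also have "\<dots> = (\<integral>\<^sup>+x. (\<integral>\<^sup>+y. F y * ennreal (\<mu> y) \<partial>haar) * \<psi> x \<partial>haar)"
  proof (rule nn_integral_cong)
    fix x
    have "(\<integral>\<^sup>+y. F (- x + y) * ennreal (\<mu> (- x + y)) * \<psi> x \<partial>haar)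
        = (\<integral>\<^sup>+y. F (- x + y) * ennreal (\<mu> (- x + y)) \<partial>haar) * \<psi> x"
      by (rule nn_integral_multc) measurable
    also have "(\<integral>\<^sup>+y. F (- x + y) * ennreal (\<mu> (- x + y)) \<partial>haar) = (\<integral>\<^sup>+y. F y * ennreal (\<mu> y) \<partial>haar)"
      by (rule nn_integral_left_translate[of "\<lambda>y. F y * ennreal (\<mu> y)"]) measurable
    finally show "(\<integral>\<^sup>+y. F (- x + y) * ennreal (\<mu> (- x + y)) * \<psi> x \<partial>haar)
        = (\<integral>\<^sup>+y. F y * ennreal (\<mu> y) \<partial>haar) * \<psi> x" .
  qed
  also have "\<dots> = (\<integral>\<^sup>+y. F y * ennreal (\<mu> y) \<partial>haar) * (\<integral>\<^sup>+x. \<psi> x \<partial>haar)"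
    by (rule nn_integral_cmult) measurable
  finally have "(\<integral>\<^sup>+x. F (- x) \<partial>haar) * ennreal l = (\<integral>\<^sup>+y. F y * ennreal (\<mu> y) \<partial>haar) * ennreal l"
    unfolding int .
  then show ?thesis using V(3) by (simp add: mult.commute[of _ "ennreal l"] ennreal_mult_cancel_left)
qed

lemma nn_integral_modular_right_invariant:
  assumes [measurable]: "F \<in> borel_measurable borel"
  shows "(\<integral>\<^sup>+x. F (x + k) * ennreal (\<mu> x) \<partial>haar) = (\<integral>\<^sup>+x. F x * ennreal (\<mu> x) \<partial>haar)"
proof -
  have eq: "ennreal (\<mu> (x + k)) * ennreal (\<mu> (- k)) = ennreal (\<mu> x)" for x
    using \<mu>_pos[of k] \<mu>_pos[of x] by (simp add: \<mu>_add \<mu>_minus ennreal_mult[symmetric])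
  have "(\<integral>\<^sup>+x. F (x + k) * ennreal (\<mu> x) \<partial>haar)
      = (\<integral>\<^sup>+x. F (x + k) * ennreal (\<mu> (x + k)) * ennreal (\<mu> (- k)) \<partial>haar)"
    by (simp add: mult.assoc eq)
  also have "\<dots> = (\<integral>\<^sup>+x. F (x + k) * ennreal (\<mu> (x + k)) \<partial>haar) * ennreal (\<mu> (- k))"
    by (rule nn_integral_multc) measurable
  also have "(\<integral>\<^sup>+x. F (x + k) * ennreal (\<mu> (x + k)) \<partial>haar) = ennreal (\<mu> k) * (\<integral>\<^sup>+x. F x * ennreal (\<mu> x) \<partial>haar)"
    by (rule nn_integral_right_translate[of "\<lambda>x. F x * ennreal (\<mu> x)"]) measurable
  also have "\<dots> * ennreal (\<mu> (- k)) = (\<integral>\<^sup>+x. F x * ennreal (\<mu> x) \<partial>haar) * (ennreal (\<mu> k) * ennreal (\<mu> (- k)))"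
    by (simp add: mult_ac)
  also have "ennreal (\<mu> k) * ennreal (\<mu> (- k)) = 1"
    using \<mu>_pos[of k] by (simp add: \<mu>_minus ennreal_mult[symmetric])
  finally show ?thesis by simp
qed

section \<open>Integrals over the coset spaces as integrals over the group\<close>

lemma modular_on_rcoset:
  assumes H: "H \<in> closed_subgroups" "\<forall>h\<in>H. \<mu> h = 1"
  shows "modular_on_coset \<mu> (rcoset H g) = \<mu> g"
  unfolding modular_on_coset_def
proof (rule the_equality)
  show "\<forall>x\<in>rcoset H g. \<mu> x = \<mu> g"
    using H(2) by (auto simp: rcoset_def \<mu>_add)
  then show "c = \<mu> g" if "\<forall>x\<in>rcoset H g. \<mu> x = c" for c
    using that self_mem_rcoset[OF H(1)] by auto
qed

lemma measurable_quotient_Cos: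
  assumes H: "H \<in> closed_subgroups"
  shows "(\<lambda>C. C) \<in> borel_of (quotient_topology H) \<rightarrow>\<^sub>M (Cos :: 'g set measure)"
  unfolding coset_topology_def
proof (rule measurable_into_fell_subspace)
  fix C assume "C \<in> space (borel_of (quotient_topology H))"
  then show "C \<in> {rcoset H g | H g. H \<in> closed_subgroups}" "closed C"
    using H closed_rcoset[OF closed_subgroupD(1)[OF H]] by (auto simp: topspace_quotient)
next
  fix U :: "'g set" assume "open U"
  then show "{C \<in> space (borel_of (quotient_topology H)). C \<inter> U \<noteq> {}} \<in> sets (borel_of (quotient_topology H))"
    using openin_sets_borel_of[OF openin_quotient_hit[OF H]] by (simp add: topspace_quotient[OF H])
qed

text \<open>As \<open>\<mu>\<close> is constant on cosets, its value on \<open>C\<close> exceeds \<open>a\<close> iff \<open>C\<close> meets the open set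
  \<open>{\<mu> > a}\<close>.\<close>

lemma measurable_modular_on_coset:
  assumes H: "H \<in> closed_subgroups" "\<forall>h\<in>H. \<mu> h = 1"
  shows "modular_on_coset \<mu> \<in> borel_measurable (borel_of (quotient_topology H))"
proof (rule borel_measurableI_greater)
  fix a
  have "a < modular_on_coset \<mu> C \<longleftrightarrow> C \<inter> {g. a < \<mu> g} \<noteq> {}" if C: "C \<in> range (rcoset H)" for C
  proof -
    obtain g where g: "C = rcoset H g" using C by blast
    have const: "\<mu> x = \<mu> g" if "x \<in> C" for x
      using that H(2) unfolding g by (auto simp: rcoset_def \<mu>_add)
    have mem: "g \<in> C" unfolding g by (rule self_mem_rcoset[OF H(1)])
    have "a < \<mu> g \<longleftrightarrow> (\<exists>x\<in>C. a < \<mu> x)"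
    proof
      assume "a < \<mu> g"
      then show "\<exists>x\<in>C. a < \<mu> x" using mem by blast
    next
      assume "\<exists>x\<in>C. a < \<mu> x"
      then obtain x where "x \<in> C" "a < \<mu> x" by blast
      then show "a < \<mu> g" using const[of x] by simp
    qed
    moreover have "modular_on_coset \<mu> C = \<mu> g" unfolding g by (rule modular_on_rcoset[OF H])
    moreover have "(\<exists>x\<in>C. a < \<mu> x) \<longleftrightarrow> C \<inter> {g. a < \<mu> g} \<noteq> {}" by blast
    ultimately show ?thesis by simp
  qed
  then have "{C \<in> space (borel_of (quotient_topology H)). a < modular_on_coset \<mu> C}
      = {C \<in> range (rcoset H). C \<inter> {g. a < \<mu> g} \<noteq> {}}"
    by (auto simp: topspace_quotient[OF H(1)])
  then show "{C \<in> space (borel_of (quotient_topology H)). a < modular_on_coset \<mu> C} \<in> sets (borel_of (quotient_topology H))"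
    using openin_sets_borel_of[OF openin_quotient_hit[OF H(1) open_\<mu>_greater]] by simp
qed

lemma coset_integral_modular:
  assumes H: "tame H" "\<forall>h\<in>H. \<mu> h = 1" and w: "unit_density fd H w"
    and f: "f \<in> borel_measurable Cos"
  shows "(\<integral>\<^sup>+C. ennreal (f C * modular_on_coset \<mu> C) \<partial>coset_measure fd haar H)
    = (\<integral>\<^sup>+g. w g * (ennreal (f (rcoset H g)) * ennreal (\<mu> g)) \<partial>haar)"
proof -
  have cH: "H \<in> closed_subgroups" using H by (simp add: tame_def)
  have [measurable]: "f \<in> borel_measurable (borel_of (quotient_topology H))"
    using measurable_compose[OF measurable_quotient_Cos[OF cH] f] by simp
  note [measurable] = measurable_modular_on_coset[OF cH H(2)]
  have "(\<integral>\<^sup>+C. ennreal (f C * modular_on_coset \<mu> C) \<partial>coset_measure fd haar H)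
    = (\<integral>\<^sup>+g. w g * ennreal (f (rcoset H g) * modular_on_coset \<mu> (rcoset H g)) \<partial>haar)"
    by (rule nn_integral_coset_measure[OF H(1) w]) measurable
  then show ?thesis
    using less_imp_le[OF \<mu>_pos] by (simp add: modular_on_rcoset[OF cH H(2)] ennreal_mult'')
qed

lemma coset_integral_inverse:
  assumes H: "tame H" and w: "unit_density fd H w" and f: "f \<in> borel_measurable Cos"
  shows "(\<integral>\<^sup>+C. ennreal (f (coset_inverse C)) \<partial>coset_measure fd haar H)
    = (\<integral>\<^sup>+g. w g * ennreal (f (coset_inverse (rcoset H g))) \<partial>haar)"
proof -
  have cH: "H \<in> closed_subgroups" using H by (simp add: tame_def)
  have [measurable]: "(\<lambda>C. f (coset_inverse C)) \<in> borel_measurable (borel_of (quotient_topology H))"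
    by (rule measurable_compose[OF measurable_quotient_Cos[OF cH] measurable_compose[OF measurable_coset_inverse f]])
  show ?thesis by (rule nn_integral_coset_measure[OF H w]) measurable
qed

end

section \<open>Consequences of conjugation invariance\<close>

locale subgroup_measure = haar_modular haar \<mu>
  for haar :: "'g::{topological_group_add, t2_space, second_countable_topology} measure" and \<mu> +
  fixes \<Lambda> :: "'g set measure"
  assumes sets_\<Lambda>: "sets \<Lambda> = sets Sub"
    and sigma_finite_\<Lambda>: "sigma_finite_measure \<Lambda>"
    and discrete_or_compact: "AE H in \<Lambda>. discrete H \<or> compact H"
begin

lemma space_\<Lambda>: "space \<Lambda> = closed_subgroups"
  using sets_eq_imp_space_eq[OF sets_\<Lambda>] by (simp add: topspace_chabauty)

lemma AE_tame: "AE H in \<Lambda>. tame H"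
  using discrete_or_compact AE_space by eventually_elim (simp add: tame_def space_\<Lambda>)

lemma sets_pair: "sets (\<Lambda> \<Otimes>\<^sub>M haar) = sets (Sub \<Otimes>\<^sub>M borel)"
  by (intro sets_pair_measure_cong sets_\<Lambda> sets_haar)

lemma pair_\<Lambda>_haar: "pair_sigma_finite \<Lambda> haar"
  by (intro pair_sigma_finite.intro sigma_finite_\<Lambda>) unfold_locales

lemma measurable_section_Sub:
  assumes "\<Phi> \<in> borel_measurable (Sub \<Otimes>\<^sub>M borel)" "H \<in> closed_subgroups"
  shows "(\<lambda>g. \<Phi> (H, g :: 'g)) \<in> borel_measurable borel"
  by (rule measurable_compose[OF measurable_section[OF assms(2)] assms(1)])

lemma measurable_nn_integral_haar:
  assumes "\<Phi> \<in> borel_measurable (Sub \<Otimes>\<^sub>M borel)"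
  shows "(\<lambda>H. \<integral>\<^sup>+g. \<Phi> (H, g) \<partial>haar) \<in> borel_measurable \<Lambda>"
  using assms by (intro borel_measurable_nn_integral_fst) (simp add: measurable_cong_sets[OF sets_pair refl])

lemma measurable_conjugate_at: "conjugate k \<in> \<Lambda> \<rightarrow>\<^sub>M \<Lambda>"
proof -
  have "(\<lambda>H. (H, k)) \<in> Sub \<rightarrow>\<^sub>M Sub \<Otimes>\<^sub>M borel" by (intro measurable_Pair) auto
  from measurable_compose[OF this measurable_conjugate]
  show ?thesis by (simp add: measurable_cong_sets[OF sets_\<Lambda> sets_\<Lambda>])
qed

lemma conjugate_image_eq: "A \<subseteq> closed_subgroups \<Longrightarrow> conjugate k ` A = conjugate (- k) -` A \<inter> closed_subgroups"
proof (intro set_eqI iffI)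
  fix H assume "A \<subseteq> closed_subgroups" "H \<in> conjugate k ` A"
  then show "H \<in> conjugate (- k) -` A \<inter> closed_subgroups"
    using conjugate_closed_subgroup by (auto simp: conjugate_conjugate)
next
  fix H assume "H \<in> conjugate (- k) -` A \<inter> closed_subgroups"
  then have "conjugate (- k) H \<in> A" "H = conjugate k (conjugate (- k) H)"
    by (auto simp: conjugate_conjugate)
  then show "H \<in> conjugate k ` A" by blast
qed

lemma nn_integral_conjugate:
  assumes inv: "conjugation_invariant \<Lambda>" and [measurable]: "F \<in> borel_measurable \<Lambda>"
  shows "(\<integral>\<^sup>+H. F (conjugate k H) \<partial>\<Lambda>) = (\<integral>\<^sup>+H. F H \<partial>\<Lambda>)"
proof -
  have "distr \<Lambda> \<Lambda> (conjugate k) = \<Lambda>"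
  proof (rule measure_eqI)
    fix A assume "A \<in> sets (distr \<Lambda> \<Lambda> (conjugate k))"
    then have A: "A \<in> sets \<Lambda>" by simp
    then have "A \<subseteq> closed_subgroups" using sets.sets_into_space space_\<Lambda> by blast
    then have "conjugate (- k) ` A = conjugate k -` A \<inter> space \<Lambda>"
      using conjugate_image_eq[of A "- k"] by (simp add: space_\<Lambda>)
    moreover have "emeasure \<Lambda> (conjugate (- k) ` A) = emeasure \<Lambda> A"
      using inv A unfolding conjugation_invariant_def by blast
    ultimately show "emeasure (distr \<Lambda> \<Lambda> (conjugate k)) A = emeasure \<Lambda> A"
      using A by (simp add: emeasure_distr[OF measurable_conjugate_at])
  qed simp
  then show ?thesis using nn_integral_distr[OF measurable_conjugate_at, of F k] by simp
qed

text \<open>Invert \<open>g\<close>, exchange the integrals, and conjugate \<open>H\<close> by \<open>g\<close> for fixed \<open>g\<close>.\<close>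

lemma nn_integral_invert_conjugate:
  assumes inv: "conjugation_invariant \<Lambda>" and \<Phi>: "\<Phi> \<in> borel_measurable (Sub \<Otimes>\<^sub>M borel)"
  shows "(\<integral>\<^sup>+H. \<integral>\<^sup>+g. \<Phi> (H, g) * ennreal (\<mu> g) \<partial>haar \<partial>\<Lambda>)
    = (\<integral>\<^sup>+H. \<integral>\<^sup>+g. \<Phi> (conjugate (- g) H, - g) \<partial>haar \<partial>\<Lambda>)"
proof -
  interpret P: pair_sigma_finite \<Lambda> haar by (rule pair_\<Lambda>_haar)
  have meas\<Phi>: "(\<lambda>p. \<Phi> p * ennreal (\<mu> (snd p))) \<in> borel_measurable (Sub \<Otimes>\<^sub>M borel)"
    using \<Phi> by measurable
  have pair: "(\<lambda>p. (conjugate (snd p) (fst p), snd p)) \<in> Sub \<Otimes>\<^sub>M borel \<rightarrow>\<^sub>M Sub \<Otimes>\<^sub>M (borel :: 'g measure)"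
    by (intro measurable_Pair measurable_conjugate measurable_snd)
  have conj\<Phi>: "(\<lambda>p. \<Phi> (conjugate (snd p) (fst p), snd p)) \<in> borel_measurable (Sub \<Otimes>\<^sub>M borel)"
    by (rule measurable_compose[OF pair \<Phi>])
  have conj: "(\<lambda>p. \<Phi> (conjugate (snd p) (fst p), snd p) * ennreal (\<mu> (snd p))) \<in> borel_measurable (Sub \<Otimes>\<^sub>M borel)"
    using conj\<Phi> by measurable
  have "(\<integral>\<^sup>+H. \<integral>\<^sup>+g. \<Phi> (conjugate (- g) H, - g) \<partial>haar \<partial>\<Lambda>)
      = (\<integral>\<^sup>+H. \<integral>\<^sup>+g. \<Phi> (conjugate g H, g) * ennreal (\<mu> g) \<partial>haar \<partial>\<Lambda>)"
  proof (rule nn_integral_cong)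
    fix H assume "H \<in> space \<Lambda>"
    then have "(\<lambda>g. \<Phi> (conjugate g H, g)) \<in> borel_measurable borel"
      using measurable_section_Sub[OF conj\<Phi>, of H] by (simp add: space_\<Lambda>)
    from nn_integral_inverse[OF this]
    show "(\<integral>\<^sup>+g. \<Phi> (conjugate (- g) H, - g) \<partial>haar) = (\<integral>\<^sup>+g. \<Phi> (conjugate g H, g) * ennreal (\<mu> g) \<partial>haar)" .
  qed
  also have "\<dots> = (\<integral>\<^sup>+g. \<integral>\<^sup>+H. \<Phi> (conjugate g H, g) * ennreal (\<mu> g) \<partial>\<Lambda> \<partial>haar)"
    using conj by (intro P.Fubini'[symmetric]) (simp add: measurable_cong_sets[OF sets_pair refl] case_prod_beta')
  also have "\<dots> = (\<integral>\<^sup>+g. \<integral>\<^sup>+H. \<Phi> (H, g) * ennreal (\<mu> g) \<partial>\<Lambda> \<partial>haar)"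
  proof (rule nn_integral_cong)
    fix g :: 'g
    have "(\<lambda>H. (H, g)) \<in> Sub \<rightarrow>\<^sub>M Sub \<Otimes>\<^sub>M borel" by (intro measurable_Pair) auto
    from measurable_compose[OF this meas\<Phi>]
    have "(\<lambda>H. \<Phi> (H, g) * ennreal (\<mu> g)) \<in> borel_measurable \<Lambda>"
      by (simp add: measurable_cong_sets[OF sets_\<Lambda> refl])
    from nn_integral_conjugate[OF inv this]
    show "(\<integral>\<^sup>+H. \<Phi> (conjugate g H, g) * ennreal (\<mu> g) \<partial>\<Lambda>) = (\<integral>\<^sup>+H. \<Phi> (H, g) * ennreal (\<mu> g) \<partial>\<Lambda>)" .
  qed
  also have "\<dots> = (\<integral>\<^sup>+H. \<integral>\<^sup>+g. \<Phi> (H, g) * ennreal (\<mu> g) \<partial>haar \<partial>\<Lambda>)"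
    using meas\<Phi> by (intro P.Fubini') (simp add: measurable_cong_sets[OF sets_pair refl] case_prod_beta')
  finally show ?thesis by simp
qed

text \<open>With the canonical weights the left side is the integral of \<open>\<Phi>(H, g) \<mu>(g)\<close> over all pairs, where
  \<open>\<Phi>\<close> is the weight of \<open>g\<close> in \<open>Hg\<close> times \<open>f(Hg)\<close>. With the inverted weights the right side is the
  integral of \<open>\<Phi>(g\<^sup>-\<^sup>1Hg, g\<^sup>-\<^sup>1)\<close>, since \<open>(Hg)\<^sup>-\<^sup>1 = (g\<^sup>-\<^sup>1Hg)g\<^sup>-\<^sup>1\<close>.\<close>

lemma coset_identity_if_invariant:
  assumes inv: "conjugation_invariant \<Lambda>" and one: "AE H in \<Lambda>. \<forall>h\<in>H. \<mu> h = 1"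
    and f: "f \<in> borel_measurable Cos"
  shows "(\<integral>\<^sup>+H. (\<integral>\<^sup>+C. ennreal (f C * modular_on_coset \<mu> C) \<partial>coset_measure fd haar H) \<partial>\<Lambda>) =
    (\<integral>\<^sup>+H. (\<integral>\<^sup>+C. ennreal (f (coset_inverse C)) \<partial>coset_measure fd haar H) \<partial>\<Lambda>)"
proof -
  define \<Phi> where "\<Phi> p = weight fd (rcoset (fst p) (snd p)) (snd p) * ennreal (f (rcoset (fst p) (snd p)))"
    for p :: "'g set \<times> 'g"
  have [measurable]: "(\<lambda>p. f (rcoset (fst p) (snd p))) \<in> borel_measurable (Sub \<Otimes>\<^sub>M borel)"
    by (rule measurable_compose[OF measurable_rcoset f])
  have \<Phi>: "\<Phi> \<in> borel_measurable (Sub \<Otimes>\<^sub>M borel)"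
    unfolding \<Phi>_def by measurable
  have "(\<integral>\<^sup>+H. (\<integral>\<^sup>+C. ennreal (f C * modular_on_coset \<mu> C) \<partial>coset_measure fd haar H) \<partial>\<Lambda>)
      = (\<integral>\<^sup>+H. \<integral>\<^sup>+g. \<Phi> (H, g) * ennreal (\<mu> g) \<partial>haar \<partial>\<Lambda>)"
    using AE_tame one
    by (intro nn_integral_cong_AE, eventually_elim)
      (simp add: \<Phi>_def coset_integral_modular[OF _ _ unit_density_weight f] mult.assoc)
  also have "\<dots> = (\<integral>\<^sup>+H. \<integral>\<^sup>+g. \<Phi> (conjugate (- g) H, - g) \<partial>haar \<partial>\<Lambda>)"
    by (rule nn_integral_invert_conjugate[OF inv \<Phi>])
  also have "\<dots> = (\<integral>\<^sup>+H. (\<integral>\<^sup>+C. ennreal (f (coset_inverse C)) \<partial>coset_measure fd haar H) \<partial>\<Lambda>)"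
    using AE_tame
  proof (intro nn_integral_cong_AE, eventually_elim)
    fix H :: "'g set" assume H: "tame H"
    then have cH: "H \<in> closed_subgroups" by (simp add: tame_def)
    show "(\<integral>\<^sup>+g. \<Phi> (conjugate (- g) H, - g) \<partial>haar) = (\<integral>\<^sup>+C. ennreal (f (coset_inverse C)) \<partial>coset_measure fd haar H)"
      unfolding coset_integral_inverse[OF H unit_density_inverse[OF H] f]
      by (simp add: \<Phi>_def coset_inverse_eq_rcoset[OF cH])
  qed
  finally show ?thesis .
qed

lemma measurable_share_rcoset:
  assumes "open U"
  shows "(\<lambda>p. share U (rcoset (fst p) (snd p)) (snd p)) \<in> borel_measurable (Sub \<Otimes>\<^sub>M borel)"
proof -
  have "(\<lambda>p. (rcoset (fst p) (snd p), snd p :: 'g)) \<in> Sub \<Otimes>\<^sub>M borel \<rightarrow>\<^sub>M borel_of fell_topology \<Otimes>\<^sub>M borel"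
    by (intro measurable_Pair measurable_snd) (rule measurable_compose[OF measurable_rcoset measurable_Cos_fell])
  from measurable_compose[OF this measurable_share[OF assms]] show ?thesis by simp
qed

lemma sets_rcoset_hit:
  assumes "open U"
  shows "{p \<in> space (Sub \<Otimes>\<^sub>M borel). rcoset (fst p) (snd p) \<inter> U \<noteq> {}} \<in> sets (Sub \<Otimes>\<^sub>M (borel :: 'g measure))"
proof -
  have "{p \<in> space (Sub \<Otimes>\<^sub>M borel). rcoset (fst p) (snd p) \<inter> U \<noteq> {}}
      = (\<lambda>p. rcoset (fst p) (snd p)) -` {C \<in> space Cos. C \<inter> U \<noteq> {}} \<inter> space (Sub \<Otimes>\<^sub>M (borel :: 'g measure))"
    by (auto simp: space_pair_measure topspace_coset topspace_chabauty)
  then show ?thesis using measurable_sets[OF measurable_rcoset Cos_sets_hit[OF assms]] by simp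
qed

text \<open>Consider the cosets that meet both \<open>U\<close> and \<open>V\<close>, and share their mass either among their points in
  \<open>U\<close> or among those in \<open>V\<close>. By mass transport the two totals are equal, both before and after
  the inversion \<open>(H, g) \<mapsto> (g\<^sup>-\<^sup>1Hg, g\<^sup>-\<^sup>1)\<close>. By conjugation invariance the totals after inversion are
  those weighted by \<open>\<mu>\<close>, which are at most \<open>a\<close> times the first one and at least \<open>b\<close> times the
  second. As \<open>a < b\<close> and the total is finite, it is \<open>0\<close>. Compact subgroups are excluded to make
  cosets meet \<open>U\<close> and \<open>V\<close> in finitely many points; their modular function is \<open>1\<close> anyway.\<close>

lemma AE_coset_not_meeting_both:
  assumes inv: "conjugation_invariant \<Lambda>" and A: "A \<in> sets \<Lambda>" "emeasure \<Lambda> A \<noteq> \<infinity>"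
    and U: "open U" "compact (closure U)" and V: "open V" "compact (closure V)"
    and ab: "0 \<le> a" "a < b" and aU: "\<And>x. x \<in> U \<Longrightarrow> \<mu> x \<le> a" and bV: "\<And>x. x \<in> V \<Longrightarrow> b \<le> \<mu> x"
  shows "AE H in \<Lambda>. H \<in> A \<longrightarrow> \<not> compact H \<longrightarrow> (\<forall>g\<in>U. rcoset H g \<inter> V = {})"
proof -
  define E where "E = {p \<in> space (Sub \<Otimes>\<^sub>M (borel :: 'g measure)). fst p \<in> A \<and> \<not> compact (fst p) \<and>
    rcoset (fst p) (snd p) \<inter> U \<noteq> {} \<and> rcoset (fst p) (snd p) \<inter> V \<noteq> {}}"
  define \<Phi> where "\<Phi> W p = indicator E p * share W (rcoset (fst p) (snd p)) (snd p)" for W p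
  have E [measurable]: "E \<in> sets (Sub \<Otimes>\<^sub>M borel)"
  proof -
    have "A \<in> sets Sub" using A(1) sets_\<Lambda> by simp
    then have 1: "{p \<in> space (Sub \<Otimes>\<^sub>M (borel :: 'g measure)). fst p \<in> A} \<in> sets (Sub \<Otimes>\<^sub>M borel)"
      by measurable
    have "Measurable.pred Sub (\<lambda>H :: 'g set. pushed False H)"
      by (rule measurable_compose[OF measurable_Sub_fell measurable_pushed])
    then have "Measurable.pred (Sub \<Otimes>\<^sub>M (borel :: 'g measure)) (\<lambda>p. \<not> compact (fst p :: 'g set))"
      unfolding pushed_def by simp measurable
    then have 2: "{p \<in> space (Sub \<Otimes>\<^sub>M (borel :: 'g measure)). \<not> compact (fst p :: 'g set)} \<in> sets (Sub \<Otimes>\<^sub>M borel)"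
      by (simp add: pred_def)
    show ?thesis
      unfolding E_def by (intro sets.sets_Collect_conj 1 2 sets_rcoset_hit U V)
  qed
  have \<Phi>_meas: "\<Phi> W \<in> borel_measurable (Sub \<Otimes>\<^sub>M borel)" if "open W" for W
    unfolding \<Phi>_def using measurable_share_rcoset[OF that] by measurable
  have E_coset: "(H, g) \<in> E \<longleftrightarrow> H \<in> A \<and> \<not> compact H \<and> rcoset H g \<inter> U \<noteq> {} \<and> rcoset H g \<inter> V \<noteq> {}"
    if "H \<in> closed_subgroups" for H g
    using that by (auto simp: E_def space_pair_measure topspace_chabauty)
  have share1: "(\<integral>\<^sup>+h. share W (rcoset H g) (h + g) \<partial>count_space H) = 1"
    if "tame H" "\<not> compact H" "rcoset H g \<inter> W \<noteq> {}" "W = U \<or> W = V" for H g W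
  proof -
    have "finite (rcoset H g \<inter> W)"
      using that U(2) V(2) by (intro discrete_coset_finite) (auto simp: tame_def)
    then have "(\<integral>\<^sup>+x. share W (rcoset H g) x \<partial>count_space (rcoset H g)) = 1"
      using that(3) by (intro share_sum)
    then show ?thesis using nn_integral_count_rcoset[where f = "share W (rcoset H g)"] by simp
  qed
  \<comment> \<open>Sharing the mass of these cosets among their points in \<open>U\<close> or in \<open>V\<close> gives the same integral.\<close>
  have same: "(\<integral>\<^sup>+g. \<Phi> U (H, g) \<partial>haar) = (\<integral>\<^sup>+g. \<Phi> V (H, g) \<partial>haar)" if H: "tame H" for H
  proof (cases "compact H")
    case True
    then show ?thesis by (simp add: \<Phi>_def E_def)
  next
    case False
    have cH: "H \<in> closed_subgroups" and disc: "discrete H" using H False by (auto simp: tame_def)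
    have "(\<integral>\<^sup>+g. share U (rcoset H g) g * indicator E (H, g) \<partial>haar)
        = (\<integral>\<^sup>+g. share V (rcoset H g) g * indicator E (H, g) \<partial>haar)"
    proof (rule mass_transport[OF cH discrete_subgroup_countable[OF cH disc]])
      show "(\<lambda>g. share U (rcoset H g) g) \<in> borel_measurable borel"
        "(\<lambda>g. share V (rcoset H g) g) \<in> borel_measurable borel"
        using measurable_section_Sub[OF measurable_share_rcoset cH] U V by simp_all
      show "(\<lambda>g. indicator E (H, g) :: ennreal) \<in> borel_measurable borel"
        by (rule measurable_section_Sub[OF _ cH]) measurable
      show "(indicator E (H, h + g) :: ennreal) = indicator E (H, g)" if "h \<in> H" for h g
        using E_coset[OF cH] rcoset_add[OF cH that] by (simp add: indicator_def)
      fix g assume "(indicator E (H, g) :: ennreal) \<noteq> 0"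
      then have "rcoset H g \<inter> U \<noteq> {}" "rcoset H g \<inter> V \<noteq> {}"
        using E_coset[OF cH] by (auto simp: indicator_def split: if_splits)
      moreover have "(\<integral>\<^sup>+h. share W (rcoset H (h + g)) (h + g) \<partial>count_space H)
          = (\<integral>\<^sup>+h. share W (rcoset H g) (h + g) \<partial>count_space H)" for W
        by (intro nn_integral_cong) (simp add: rcoset_add[OF cH])
      ultimately show "(\<integral>\<^sup>+h. share U (rcoset H (h + g)) (h + g) \<partial>count_space H) = 1"
        "(\<integral>\<^sup>+h. share V (rcoset H (h + g)) (h + g) \<partial>count_space H) = 1"
        using share1[OF H False] by simp_all
    qed
    then show ?thesis by (simp add: \<Phi>_def mult.commute)
  qed
  have same_inv: "(\<integral>\<^sup>+g. \<Phi> U (conjugate (- g) H, - g) \<partial>haar) = (\<integral>\<^sup>+g. \<Phi> V (conjugate (- g) H, - g) \<partial>haar)"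
    if H: "tame H" for H
  proof (cases "compact H")
    case True
    then show ?thesis by (simp add: \<Phi>_def E_def compact_conjugate_iff)
  next
    case False
    have cH: "H \<in> closed_subgroups" and disc: "discrete H" using H False by (auto simp: tame_def)
    define C where "C g = coset_inverse (rcoset H g)" for g
    have C: "rcoset (conjugate (- g) H) (- g) = C g" for g
      unfolding C_def coset_inverse_eq_rcoset[OF cH] ..
    have C_add: "C (h + g) = C g" "conjugate (- (h + g)) H = conjugate (- g) H" if "h \<in> H" for h g
      using rcoset_add[OF cH that, of g] right_stabilizer_rcoset[OF cH] unfolding C_def by metis+
    have pair: "(\<lambda>g. (conjugate (- g) H, - g)) \<in> borel \<rightarrow>\<^sub>M Sub \<Otimes>\<^sub>M borel"
    proof -
      have neg: "uminus \<in> borel \<rightarrow>\<^sub>M (borel :: 'g measure)"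
        using measurable_uminus_group[OF measurable_ident_sets[OF refl]] by simp
      have "(\<lambda>g. (H, - g :: 'g)) \<in> borel \<rightarrow>\<^sub>M Sub \<Otimes>\<^sub>M borel"
        using cH by (intro measurable_Pair neg) (simp add: topspace_chabauty)
      from measurable_compose[OF this measurable_conjugate]
      show ?thesis by (intro measurable_Pair) (simp_all add: neg)
    qed
    have "(\<integral>\<^sup>+g. share U (C g) (- g) * indicator E (conjugate (- g) H, - g) \<partial>haar)
        = (\<integral>\<^sup>+g. share V (C g) (- g) * indicator E (conjugate (- g) H, - g) \<partial>haar)"
    proof (rule mass_transport[OF cH discrete_subgroup_countable[OF cH disc]])
      show "(\<lambda>g. share U (C g) (- g)) \<in> borel_measurable borel"
        "(\<lambda>g. share V (C g) (- g)) \<in> borel_measurable borel"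
        using measurable_compose[OF pair measurable_share_rcoset[OF U(1)]]
          measurable_compose[OF pair measurable_share_rcoset[OF V(1)]] by (simp_all add: C)
      show "(\<lambda>g. indicator E (conjugate (- g) H, - g) :: ennreal) \<in> borel_measurable borel"
        by (rule measurable_compose[OF pair]) measurable
      have E_C: "(conjugate (- g) H, - g) \<in> E \<longleftrightarrow>
          conjugate (- g) H \<in> A \<and> \<not> compact H \<and> C g \<inter> U \<noteq> {} \<and> C g \<inter> V \<noteq> {}" for g
        using E_coset[OF conjugate_closed_subgroup[OF cH]] by (simp add: C compact_conjugate_iff)
      show "(indicator E (conjugate (- (h + g)) H, - (h + g)) :: ennreal) = indicator E (conjugate (- g) H, - g)"
        if "h \<in> H" for h g
        using E_C[of "h + g"] E_C[of g] unfolding C_add[OF that] indicator_def by simp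
      fix g assume "(indicator E (conjugate (- g) H, - g) :: ennreal) \<noteq> 0"
      then have hit: "C g \<inter> U \<noteq> {}" "C g \<inter> V \<noteq> {}"
        using E_C[of g] by (auto simp: indicator_def split: if_splits)
      have sum: "(\<integral>\<^sup>+h. share W (C (h + g)) (- (h + g)) \<partial>count_space H) = 1"
        if W: "C g \<inter> W \<noteq> {}" "W = U \<or> W = V" for W
      proof -
        have "finite (C g \<inter> W)"
          using W U(2) V(2) unfolding C[symmetric]
          by (intro discrete_coset_finite conjugate_closed_subgroup[OF cH] discrete_conjugate[OF disc]) auto
        then have "1 = (\<integral>\<^sup>+x. share W (C g) x \<partial>count_space (C g))"
          using W(1) by (intro share_sum[symmetric])
        also have "\<dots> = (\<integral>\<^sup>+x. share W (C g) (- x) \<partial>count_space (rcoset H g))"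
          by (rule nn_integral_bij_count_space[symmetric]) (auto simp: bij_betw_def C_def coset_inverse_def)
        also have "\<dots> = (\<integral>\<^sup>+h. share W (C g) (- (h + g)) \<partial>count_space H)"
          by (rule nn_integral_count_rcoset[symmetric])
        also have "\<dots> = (\<integral>\<^sup>+h. share W (C (h + g)) (- (h + g)) \<partial>count_space H)"
          by (intro nn_integral_cong) (simp add: C_add)
        finally show ?thesis by simp
      qed
      show "(\<integral>\<^sup>+h. share U (C (h + g)) (- (h + g)) \<partial>count_space H) = 1"
        "(\<integral>\<^sup>+h. share V (C (h + g)) (- (h + g)) \<partial>count_space H) = 1"
        using sum hit by simp_all
    qed
    then show ?thesis by (simp add: \<Phi>_def C mult.commute)
  qed
  \<comment> \<open>\<open>Y\<close> is the \<open>\<nu>\<^sub>H\<close>-mass of these cosets, integrated over \<open>H\<close>; the aim is \<open>bY \<le> aY < \<infinity>\<close>.\<close>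
  define Y where "Y = (\<integral>\<^sup>+H. \<integral>\<^sup>+g. \<Phi> U (H, g) \<partial>haar \<partial>\<Lambda>)"
  have inner_meas: "(\<lambda>H. \<integral>\<^sup>+g. \<Phi> W (H, g) \<partial>haar) \<in> borel_measurable \<Lambda>" if "open W" for W
    by (rule measurable_nn_integral_haar[OF \<Phi>_meas[OF that]])
  have "ennreal b * Y = ennreal b * (\<integral>\<^sup>+H. \<integral>\<^sup>+g. \<Phi> V (H, g) \<partial>haar \<partial>\<Lambda>)"
    unfolding Y_def using AE_tame same by (intro arg_cong2[of _ _ _ _ "(*)"] nn_integral_cong_AE) auto
  also have "\<dots> = (\<integral>\<^sup>+H. ennreal b * (\<integral>\<^sup>+g. \<Phi> V (H, g) \<partial>haar) \<partial>\<Lambda>)"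
    by (rule nn_integral_cmult[OF inner_meas[OF V(1)], symmetric])
  also have "\<dots> \<le> (\<integral>\<^sup>+H. \<integral>\<^sup>+g. \<Phi> V (H, g) * ennreal (\<mu> g) \<partial>haar \<partial>\<Lambda>)"
  proof (rule nn_integral_mono)
    fix H assume "H \<in> space \<Lambda>"
    then have "ennreal b * (\<integral>\<^sup>+g. \<Phi> V (H, g) \<partial>haar) = (\<integral>\<^sup>+g. ennreal b * \<Phi> V (H, g) \<partial>haar)"
      using measurable_section_Sub[OF \<Phi>_meas[OF V(1)], of H]
      by (intro nn_integral_cmult[symmetric]) (simp add: space_\<Lambda> borel_measurable_haar_iff)
    also have "\<dots> \<le> (\<integral>\<^sup>+g. \<Phi> V (H, g) * ennreal (\<mu> g) \<partial>haar)"
    proof (rule nn_integral_mono)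
      fix g
      have "\<Phi> V (H, g) = 0" if "g \<notin> V" using that by (simp add: \<Phi>_def share_def)
      then show "ennreal b * \<Phi> V (H, g) \<le> \<Phi> V (H, g) * ennreal (\<mu> g)"
        using bV[of g] by (cases "g \<in> V") (auto simp: mult.commute intro!: mult_left_mono mult_right_mono ennreal_leI)
    qed
    finally show "ennreal b * (\<integral>\<^sup>+g. \<Phi> V (H, g) \<partial>haar) \<le> (\<integral>\<^sup>+g. \<Phi> V (H, g) * ennreal (\<mu> g) \<partial>haar)" .
  qed
  also have "\<dots> = (\<integral>\<^sup>+H. \<integral>\<^sup>+g. \<Phi> V (conjugate (- g) H, - g) \<partial>haar \<partial>\<Lambda>)"
    by (rule nn_integral_invert_conjugate[OF inv \<Phi>_meas[OF V(1)]])
  also have "\<dots> = (\<integral>\<^sup>+H. \<integral>\<^sup>+g. \<Phi> U (conjugate (- g) H, - g) \<partial>haar \<partial>\<Lambda>)"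
    using AE_tame same_inv by (intro nn_integral_cong_AE) auto
  also have "\<dots> = (\<integral>\<^sup>+H. \<integral>\<^sup>+g. \<Phi> U (H, g) * ennreal (\<mu> g) \<partial>haar \<partial>\<Lambda>)"
    by (rule nn_integral_invert_conjugate[OF inv \<Phi>_meas[OF U(1)], symmetric])
  also have "\<dots> \<le> (\<integral>\<^sup>+H. ennreal a * (\<integral>\<^sup>+g. \<Phi> U (H, g) \<partial>haar) \<partial>\<Lambda>)"
  proof (rule nn_integral_mono)
    fix H assume H: "H \<in> space \<Lambda>"
    have "(\<integral>\<^sup>+g. \<Phi> U (H, g) * ennreal (\<mu> g) \<partial>haar) \<le> (\<integral>\<^sup>+g. ennreal a * \<Phi> U (H, g) \<partial>haar)"
    proof (rule nn_integral_mono)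
      fix g
      have "\<Phi> U (H, g) = 0" if "g \<notin> U" using that by (simp add: \<Phi>_def share_def)
      then show "\<Phi> U (H, g) * ennreal (\<mu> g) \<le> ennreal a * \<Phi> U (H, g)"
        using aU[of g] by (cases "g \<in> U") (auto simp: mult.commute intro!: mult_left_mono mult_right_mono ennreal_leI)
    qed
    also have "\<dots> = ennreal a * (\<integral>\<^sup>+g. \<Phi> U (H, g) \<partial>haar)"
      using measurable_section_Sub[OF \<Phi>_meas[OF U(1)], of H] H
      by (intro nn_integral_cmult) (simp add: space_\<Lambda> borel_measurable_haar_iff)
    finally show "(\<integral>\<^sup>+g. \<Phi> U (H, g) * ennreal (\<mu> g) \<partial>haar) \<le> ennreal a * (\<integral>\<^sup>+g. \<Phi> U (H, g) \<partial>haar)" .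
  qed
  also have "\<dots> = ennreal a * Y"
    unfolding Y_def by (rule nn_integral_cmult[OF inner_meas[OF U(1)]])
  finally have le: "ennreal b * Y \<le> ennreal a * Y" .
  \<comment> \<open>A point of \<open>U\<close> receives a share of at most \<open>1\<close>.\<close>
  have "Y \<le> (\<integral>\<^sup>+H. emeasure haar U * indicator A H \<partial>\<Lambda>)"
    unfolding Y_def
  proof (rule nn_integral_mono)
    fix H assume H: "H \<in> space \<Lambda>"
    have "(\<integral>\<^sup>+g. \<Phi> U (H, g) \<partial>haar) \<le> (\<integral>\<^sup>+g. indicator A H * indicator U g \<partial>haar)"
    proof (rule nn_integral_mono)
      fix g
      show "\<Phi> U (H, g) \<le> indicator A H * indicator U g"
      proof (cases "(H, g) \<in> E \<and> g \<in> U")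
        case True
        then have "H \<in> A" by (auto simp: E_def)
        have "g \<in> rcoset H g" using H by (intro self_mem_rcoset) (simp add: space_\<Lambda>)
        from share_le_indicator[OF this, of U]
        show ?thesis using True \<open>H \<in> A\<close> by (simp add: \<Phi>_def)
      next
        case False
        then have "\<Phi> U (H, g) = 0" by (auto simp: \<Phi>_def share_def)
        then show ?thesis by simp
      qed
    qed
    also have "\<dots> = emeasure haar U * indicator A H"
      using U(1) by (subst nn_integral_cmult) (auto simp: sets_haar borel_measurable_haar_iff mult.commute)
    finally show "(\<integral>\<^sup>+g. \<Phi> U (H, g) \<partial>haar) \<le> emeasure haar U * indicator A H" .
  qed
  also have "\<dots> = emeasure haar U * emeasure \<Lambda> A"
    using A(1) by (rule nn_integral_cmult_indicator)
  also have "\<dots> < \<infinity>"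
    using haar_relatively_compact_finite[OF U(2)] A(2) by (simp add: ennreal_mult_eq_top_iff less_top[symmetric])
  finally have "Y < \<infinity>" .
  then obtain y where y: "Y = ennreal y" "0 \<le> y" by (cases Y) auto
  have "b * y \<le> a * y" using le ab y by (simp add: ennreal_mult[symmetric])
  then have "y = 0" using ab y(2) by (auto simp: mult_le_cancel_right)
  then have "(\<integral>\<^sup>+H. \<integral>\<^sup>+g. \<Phi> U (H, g) \<partial>haar \<partial>\<Lambda>) = 0" using y(1) unfolding Y_def by simp
  then have "AE H in \<Lambda>. (\<integral>\<^sup>+g. \<Phi> U (H, g) \<partial>haar) = 0"
    by (simp add: nn_integral_0_iff_AE[OF inner_meas[OF U(1)]])
  then show ?thesis using AE_tame
  proof eventually_elim
    fix H assume zero: "(\<integral>\<^sup>+g. \<Phi> U (H, g) \<partial>haar) = 0" and H: "tame H"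
    show "H \<in> A \<longrightarrow> \<not> compact H \<longrightarrow> (\<forall>g\<in>U. rcoset H g \<inter> V = {})"
    proof (intro impI, rule ccontr)
      assume HA: "H \<in> A" and nc: "\<not> compact H" and ex: "\<not> (\<forall>g\<in>U. rcoset H g \<inter> V = {})"
      have cH: "H \<in> closed_subgroups" and disc: "discrete H" using H nc by (auto simp: tame_def)
      define W where "W = U \<inter> {g. rcoset H g \<inter> V \<noteq> {}}"
      \<comment> \<open>The set on which the integrand is positive is open, so it cannot be null and nonempty.\<close>
      have "open W" "W \<noteq> {}" using ex open_rcoset_hit[OF V(1), of H] U(1) by (auto simp: W_def)
      then have "0 < emeasure haar W" by (rule haar_open_pos)
      have AE0: "AE g in haar. \<Phi> U (H, g) = 0"
        using zero measurable_section_Sub[OF \<Phi>_meas[OF U(1)] cH]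
        by (subst (asm) nn_integral_0_iff_AE) (simp_all add: borel_measurable_haar_iff)
      have pos: "\<Phi> U (H, g) \<noteq> 0" if g: "g \<in> W" for g
      proof -
        have "g \<in> rcoset H g" by (rule self_mem_rcoset[OF cH])
        then have "(H, g) \<in> E" using g HA nc E_coset[OF cH] by (auto simp: W_def)
        moreover have "num_points U (rcoset H g) < \<infinity>"
          unfolding num_points_finite_iff by (rule discrete_coset_finite[OF cH disc U(2)])
        ultimately show ?thesis using g by (simp add: \<Phi>_def share_def W_def)
      qed
      from AE0 have "AE g in haar. g \<notin> W" by eventually_elim (use pos in blast)
      moreover have "W \<in> sets haar" using \<open>open W\<close> by (simp add: sets_haar)
      ultimately have "emeasure haar W = 0"
        by (subst (asm) AE_iff_measurable[of W]) auto
      then show False using \<open>0 < emeasure haar W\<close> by simp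
    qed
  qed
qed

text \<open>If \<open>\<mu>(h) > 1\<close> for some \<open>h \<in> H\<close>, then \<open>H\<close>, as a coset of itself, meets a basic neighbourhood of the
  identity and a basic neighbourhood of \<open>h\<close> that are separated by the values of \<open>\<mu>\<close>. This happens
  for almost no \<open>H\<close>.\<close>

lemma AE_modular_eq_1:
  assumes inv: "conjugation_invariant \<Lambda>"
  shows "AE H in \<Lambda>. \<forall>h\<in>H. \<mu> h = 1"
proof -
  obtain A :: "nat \<Rightarrow> 'g set set" where A: "range A \<subseteq> sets \<Lambda>" "(\<Union>i. A i) = space \<Lambda>" "\<And>i. emeasure \<Lambda> (A i) \<noteq> \<infinity>"
    using sigma_finite_measure.sigma_finite[OF sigma_finite_\<Lambda>] by metis
  define sep where "sep i j \<longleftrightarrow> (\<exists>a b. 0 \<le> a \<and> a < b \<and> (\<forall>x\<in>basic i. \<mu> x \<le> a) \<and> (\<forall>x\<in>basic j. b \<le> \<mu> x))" for i j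
  have avoid: "AE H in \<Lambda>. sep i j \<longrightarrow> H \<in> A n \<longrightarrow> \<not> compact H \<longrightarrow> (\<forall>g\<in>basic i. rcoset H g \<inter> basic j = {})" for i j n
  proof (cases "sep i j")
    case True
    then obtain a b where ab: "0 \<le> a" "a < b" "\<And>x. x \<in> basic i \<Longrightarrow> \<mu> x \<le> a" "\<And>x. x \<in> basic j \<Longrightarrow> b \<le> \<mu> x"
      unfolding sep_def by blast
    have "A n \<in> sets \<Lambda>" using A(1) by blast
    then have "AE H in \<Lambda>. H \<in> A n \<longrightarrow> \<not> compact H \<longrightarrow> (\<forall>g\<in>basic i. rcoset H g \<inter> basic j = {})"
      by (rule AE_coset_not_meeting_both[OF inv _ A(3) basic(1,2) basic(1,2) ab(1,2)]) (use ab in auto)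
    then show ?thesis using True by simp
  qed simp
  have "AE H in \<Lambda>. \<forall>i j n. sep i j \<longrightarrow> H \<in> A n \<longrightarrow> \<not> compact H \<longrightarrow> (\<forall>g\<in>basic i. rcoset H g \<inter> basic j = {})"
    by (intro AE_all_countable[THEN iffD2] allI avoid)
  then show ?thesis using AE_tame AE_space
  proof eventually_elim
    fix H assume avoid: "\<forall>i j n. sep i j \<longrightarrow> H \<in> A n \<longrightarrow> \<not> compact H \<longrightarrow> (\<forall>g\<in>basic i. rcoset H g \<inter> basic j = {})"
      and H: "tame H" and "H \<in> space \<Lambda>"
    have cH: "H \<in> closed_subgroups" using H by (simp add: tame_def)
    obtain n where n: "H \<in> A n" using \<open>H \<in> space \<Lambda>\<close> A(2) by blast
    show "\<forall>h\<in>H. \<mu> h = 1"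
    proof (cases "compact H")
      case True
      then show ?thesis using \<mu>_compact_subgroup[OF cH] by blast
    next
      case False
      have le: "\<mu> h \<le> 1" if h: "h \<in> H" for h
      proof (rule ccontr)
        assume "\<not> \<mu> h \<le> 1"
        then obtain a b where ab: "1 < a" "a < b" "b < \<mu> h" using dense by (metis not_le)
        obtain i where i: "0 \<in> basic i" "basic i \<subseteq> {g. \<mu> g < a}"
          using basic(3)[OF open_\<mu>_less, of 0 a] ab(1) by auto
        obtain j where j: "h \<in> basic j" "basic j \<subseteq> {g. b < \<mu> g}"
          using basic(3)[OF open_\<mu>_greater, of h b] ab(3) by auto
        have "sep i j" unfolding sep_def
          using ab i(2) j(2) by (intro exI[of _ a] exI[of _ b]) (auto intro: less_imp_le)
        then have "rcoset H 0 \<inter> basic j = {}" using avoid n False i(1) by blast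
        then show False using h j(1) by auto
      qed
      show ?thesis
      proof
        fix h assume h: "h \<in> H"
        have "\<mu> (- h) \<le> 1" by (rule le[OF closed_subgroupD(4)[OF cH h]])
        then have "1 \<le> \<mu> h" using \<mu>_pos[of h] by (simp add: \<mu>_minus)
        then show "\<mu> h = 1" using le[OF h] by simp
      qed
    qed
  qed
qed

section \<open>The coset identity implies conjugation invariance\<close>

text \<open>The \<open>\<nu>\<^sub>H\<close>-mass of the cosets that meet \<open>V\<close>.\<close>

definition hit_mass :: "bool \<Rightarrow> 'g set \<Rightarrow> 'g set \<Rightarrow> ennreal" where
  "hit_mass fd V H = (\<integral>\<^sup>+g. weight fd (rcoset H g) g * indicator {g. rcoset H g \<inter> V \<noteq> {}} g \<partial>haar)"

lemma measurable_hit_mass: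
  assumes V: "open V" shows "hit_mass fd V \<in> borel_measurable \<Lambda>"
proof -
  have [measurable]: "{p \<in> space (Sub \<Otimes>\<^sub>M borel). rcoset (fst p) (snd p) \<inter> V \<noteq> {}} \<in> sets (Sub \<Otimes>\<^sub>M (borel :: 'g measure))"
    by (rule sets_rcoset_hit[OF V])
  have "(\<lambda>p. weight fd (rcoset (fst p) (snd p)) (snd p) *
      indicator {p \<in> space (Sub \<Otimes>\<^sub>M borel). rcoset (fst p) (snd p) \<inter> V \<noteq> {}} p)
      \<in> borel_measurable (Sub \<Otimes>\<^sub>M (borel :: 'g measure))" (is "?F \<in> _")
    by measurable
  from measurable_nn_integral_haar[OF this]
  have "(\<lambda>H. \<integral>\<^sup>+g. ?F (H, g) \<partial>haar) \<in> borel_measurable \<Lambda>" .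
  moreover have "(\<integral>\<^sup>+g. ?F (H, g) \<partial>haar) = hit_mass fd V H" if "H \<in> space \<Lambda>" for H
    using that unfolding hit_mass_def
    by (intro nn_integral_cong) (auto simp: space_\<Lambda> space_pair_measure topspace_chabauty indicator_def)
  ultimately show ?thesis by (simp cong: measurable_cong)
qed

text \<open>The cosets that meet \<open>V\<close> are those of the points of the open set \<open>HV\<close>. If \<open>H\<close> is compact, \<open>HV\<close> is
  relatively compact. If \<open>H\<close> is discrete, their mass can be shared among their points in \<open>V\<close>, where
  every point receives a positive share of at most \<open>1\<close>.\<close>

lemma hit_mass_bounds:
  assumes H: "tame H" and V: "open V" "compact (closure V)" "V \<noteq> {}"
  shows "0 < hit_mass fd V H" "hit_mass fd V H < \<infinity>"
proof -
  have cH: "H \<in> closed_subgroups" using H by (simp add: tame_def)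
  have "open {g. rcoset H g \<inter> V \<noteq> {}}" by (rule open_rcoset_hit[OF V(1)])
  then have O_meas [measurable]: "{g. rcoset H g \<inter> V \<noteq> {}} \<in> sets borel" by simp
  have VO: "V \<subseteq> {g. rcoset H g \<inter> V \<noteq> {}}" using self_mem_rcoset[OF cH] by blast
  have "0 < hit_mass fd V H \<and> hit_mass fd V H < \<infinity>"
  proof (cases "pushed fd H")
    case True
    then have "hit_mass fd V H = emeasure haar {g. rcoset H g \<inter> V \<noteq> {}}"
      unfolding hit_mass_def by (simp add: weight_def sets_haar)
    moreover have "{g. rcoset H g \<inter> V \<noteq> {}} \<subseteq> (\<lambda>(h, v). - h + v) ` (H \<times> closure V)"
    proof
      fix g assume "g \<in> {g. rcoset H g \<inter> V \<noteq> {}}"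
      then obtain h where "h \<in> H" "h + g \<in> V" by (auto simp: rcoset_def)
      then have "(h, h + g) \<in> H \<times> closure V" using closure_subset[of V] by blast
      then show "g \<in> (\<lambda>(h, v). - h + v) ` (H \<times> closure V)"
        by (rule image_eqI[rotated]) simp
    qed
    moreover have "compact ((\<lambda>(h, v). - h + v) ` (H \<times> closure V))"
      using True V(2) unfolding case_prod_beta
      by (intro compact_continuous_image compact_Times continuous_intros) (auto simp: pushed_def)
    moreover have "(\<lambda>(h, v). - h + v) ` (H \<times> closure V) \<in> sets haar"
      using compact_imp_closed[OF calculation(3)] by (simp add: sets_haar)
    ultimately have "hit_mass fd V H < \<infinity>"
      using haar_compact_finite emeasure_mono le_less_trans by metis
    moreover have "0 < emeasure haar {g. rcoset H g \<inter> V \<noteq> {}}"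
      using V(3) VO \<open>open {g. rcoset H g \<inter> V \<noteq> {}}\<close> by (intro haar_open_pos) auto
    ultimately show ?thesis using \<open>hit_mass fd V H = emeasure haar {g. rcoset H g \<inter> V \<noteq> {}}\<close> by simp
  next
    case False
    have disc: "discrete H" by (rule discrete_if_not_pushed[OF H False])
    have share_meas: "(\<lambda>g. share V (rcoset H g) g) \<in> borel_measurable borel"
      using measurable_section_Sub[OF measurable_share_rcoset[OF V(1)] cH] by simp
    have "hit_mass fd V H = (\<integral>\<^sup>+g. share V (rcoset H g) g * indicator {g. rcoset H g \<inter> V \<noteq> {}} g \<partial>haar)"
      unfolding hit_mass_def
    proof (rule mass_transport[OF cH discrete_subgroup_countable[OF cH disc]])
      show "(\<lambda>g. weight fd (rcoset H g) g) \<in> borel_measurable borel"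
        "(\<integral>\<^sup>+h. weight fd (rcoset H (h + g)) (h + g) \<partial>count_space H) = 1" for g
        using unit_density_weight[OF H, of fd] False by (simp_all add: unit_density_def)
      show "(\<lambda>g. share V (rcoset H g) g) \<in> borel_measurable borel" by (rule share_meas)
      show "(indicator {g. rcoset H g \<inter> V \<noteq> {}} (h + g) :: ennreal) = indicator {g. rcoset H g \<inter> V \<noteq> {}} g"
        if "h \<in> H" for h g by (simp add: rcoset_add[OF cH that] indicator_def)
      fix g assume "(indicator {g. rcoset H g \<inter> V \<noteq> {}} g :: ennreal) \<noteq> 0"
      then have "rcoset H g \<inter> V \<noteq> {}" by (auto simp: indicator_def split: if_splits)
      then have "(\<integral>\<^sup>+x. share V (rcoset H g) x \<partial>count_space (rcoset H g)) = 1"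
        by (rule share_sum[OF _ discrete_coset_finite[OF cH disc V(2)]])
      moreover have "(\<integral>\<^sup>+h. share V (rcoset H (h + g)) (h + g) \<partial>count_space H)
          = (\<integral>\<^sup>+h. share V (rcoset H g) (h + g) \<partial>count_space H)"
        by (intro nn_integral_cong) (simp add: rcoset_add[OF cH])
      ultimately show "(\<integral>\<^sup>+h. share V (rcoset H (h + g)) (h + g) \<partial>count_space H) = 1"
        using nn_integral_count_rcoset[where f = "share V (rcoset H g)"] by simp
    qed measurable
    also have "\<dots> = (\<integral>\<^sup>+g. share V (rcoset H g) g \<partial>haar)"
      using VO by (intro nn_integral_cong) (auto simp: indicator_def share_def)
    finally have eq: "hit_mass fd V H = (\<integral>\<^sup>+g. share V (rcoset H g) g \<partial>haar)" .
    have share_bounds: "share V (rcoset H g) g \<le> indicator V g" "g \<in> V \<Longrightarrow> share V (rcoset H g) g \<noteq> 0" for g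
    proof -
      have fin: "finite (rcoset H g \<inter> V)" by (rule discrete_coset_finite[OF cH disc V(2)])
      show "share V (rcoset H g) g \<le> indicator V g"
        by (rule share_le_indicator[OF self_mem_rcoset[OF cH]])
      show "g \<in> V \<Longrightarrow> share V (rcoset H g) g \<noteq> 0"
        using fin by (simp add: share_def num_points_eq)
    qed
    have "hit_mass fd V H \<le> (\<integral>\<^sup>+g. indicator V g \<partial>haar)"
      unfolding eq by (rule nn_integral_mono) (rule share_bounds)
    also have "\<dots> < \<infinity>" using haar_relatively_compact_finite[OF V(2)] V(1) by (simp add: sets_haar)
    finally have "hit_mass fd V H < \<infinity>" .
    moreover have "hit_mass fd V H \<noteq> 0"
    proof
      assume "hit_mass fd V H = 0"
      then have "AE g in haar. share V (rcoset H g) g = 0"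
        using share_meas unfolding eq by (subst (asm) nn_integral_0_iff_AE) (simp_all add: borel_measurable_haar_iff)
      then have "AE g in haar. g \<notin> V" by eventually_elim (use share_bounds(2) in blast)
      moreover have "V \<in> sets haar" using V(1) by (simp add: sets_haar)
      ultimately have "emeasure haar V = 0" by (subst (asm) AE_iff_measurable[of V]) auto
      then show False using haar_open_pos[OF V(1,3)] by simp
    qed
    ultimately show ?thesis by (simp add: zero_less_iff_neq_zero)
  qed
  then show "0 < hit_mass fd V H" "hit_mass fd V H < \<infinity>" by simp_all
qed

text \<open>Right translation by \<open>k\<close> preserves \<open>\<mu> haar\<close>, and it turns the density \<open>w\<close> into another one with
  sum \<open>1\<close> on every coset.\<close>

lemma coset_integral_modular_translate:
  assumes H: "tame H" "\<forall>h\<in>H. \<mu> h = 1" and f: "f \<in> borel_measurable Cos"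
  shows "(\<integral>\<^sup>+C. ennreal (f ((\<lambda>x. x + k) ` C) * modular_on_coset \<mu> C) \<partial>coset_measure fd haar H)
    = (\<integral>\<^sup>+C. ennreal (f C * modular_on_coset \<mu> C) \<partial>coset_measure fd haar H)"
proof -
  have cH: "H \<in> closed_subgroups" using H by (simp add: tame_def)
  define w where "w g = weight fd (rcoset H g) g" for g
  have w: "unit_density fd H w" unfolding w_def by (rule unit_density_weight[OF H(1)])
  then have [measurable]: "w \<in> borel_measurable borel" by (simp add: unit_density_def)
  have w': "unit_density fd H (\<lambda>g. w (g + - k))" by (rule unit_density_right_translate[OF w])
  have fk: "(\<lambda>C. f ((\<lambda>x. x + k) ` C)) \<in> borel_measurable Cos"
    by (rule measurable_compose[OF measurable_coset_translate f])
  have fH [measurable]: "(\<lambda>g. f (rcoset H g)) \<in> borel_measurable borel"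
    using measurable_compose[OF measurable_section[OF cH] measurable_compose[OF measurable_rcoset f]] by simp
  have [measurable]: "(\<lambda>g. w (g + - k)) \<in> borel_measurable borel" by measurable
  have F: "(\<lambda>g. w (g + - k) * ennreal (f (rcoset H g))) \<in> borel_measurable borel" by measurable
  have "(\<integral>\<^sup>+C. ennreal (f ((\<lambda>x. x + k) ` C) * modular_on_coset \<mu> C) \<partial>coset_measure fd haar H)
      = (\<integral>\<^sup>+g. (w (g + k + - k) * ennreal (f (rcoset H (g + k)))) * ennreal (\<mu> g) \<partial>haar)"
    unfolding coset_integral_modular[OF H w fk] by (simp add: rcoset_rcoset add.assoc mult.assoc)
  also have "\<dots> = (\<integral>\<^sup>+g. (w (g + - k) * ennreal (f (rcoset H g))) * ennreal (\<mu> g) \<partial>haar)"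
    by (rule nn_integral_modular_right_invariant[OF F])
  also have "\<dots> = (\<integral>\<^sup>+C. ennreal (f C * modular_on_coset \<mu> C) \<partial>coset_measure fd haar H)"
    unfolding coset_integral_modular[OF H w' f] by (simp add: mult.assoc)
  finally show ?thesis .
qed

text \<open>Left translation by \<open>k\<^sup>-\<^sup>1\<close> maps \<open>Hg\<close> to a coset of \<open>H' = k\<^sup>-\<^sup>1Hk\<close>, and \<open>\<nu>\<^sub>H\<close> to \<open>\<nu>\<^bsub>H'\<^esub>\<close> as \<open>haar\<close> is left
  invariant. On inverses it is right translation by \<open>k\<close>.\<close>

lemma coset_integral_inverse_translate:
  assumes H: "tame H" and f: "f \<in> borel_measurable Cos"
  shows "(\<integral>\<^sup>+C. ennreal (f ((\<lambda>x. x + k) ` coset_inverse C)) \<partial>coset_measure fd haar H)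
    = (\<integral>\<^sup>+C. ennreal (f (coset_inverse C)) \<partial>coset_measure fd haar (conjugate (- k) H))"
proof -
  define H' where "H' = conjugate (- k) H"
  have H': "tame H'" unfolding H'_def by (rule tame_conjugate[OF H])
  have cH: "H \<in> closed_subgroups" and cH': "H' \<in> closed_subgroups" using H H' by (auto simp: tame_def)
  define w where "w g = weight fd (rcoset H' g) g" for g
  have w: "unit_density fd H' w" unfolding w_def by (rule unit_density_weight[OF H'])
  then have [measurable]: "w \<in> borel_measurable borel" by (simp add: unit_density_def)
  have w': "unit_density fd H (\<lambda>g. w (- k + g))"
    by (rule unit_density_conjugate[OF cH w[unfolded H'_def]])
  have fk: "(\<lambda>C. f ((\<lambda>x. x + k) ` C)) \<in> borel_measurable Cos"
    by (rule measurable_compose[OF measurable_coset_translate f])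
  have [measurable]: "(\<lambda>g. f (coset_inverse (rcoset H' g))) \<in> borel_measurable borel"
    using measurable_compose[OF measurable_section[OF cH'] measurable_compose[OF measurable_rcoset
      measurable_compose[OF measurable_coset_inverse f]]] by simp
  have F: "(\<lambda>g. w g * ennreal (f (coset_inverse (rcoset H' g)))) \<in> borel_measurable borel" by measurable
  have coset: "(\<lambda>x. x + k) ` coset_inverse (rcoset H g) = coset_inverse (rcoset H' (- k + g))" for g
    unfolding coset_inverse_eq_rcoset[OF cH] coset_inverse_eq_rcoset[OF cH'] rcoset_rcoset
    by (simp add: H'_def conjugate_conjugate minus_add add.assoc)
  have "(\<integral>\<^sup>+C. ennreal (f ((\<lambda>x. x + k) ` coset_inverse C)) \<partial>coset_measure fd haar H)
      = (\<integral>\<^sup>+g. w (- k + g) * ennreal (f (coset_inverse (rcoset H' (- k + g)))) \<partial>haar)"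
    unfolding coset_integral_inverse[OF H w' fk] coset ..
  also have "\<dots> = (\<integral>\<^sup>+g. w g * ennreal (f (coset_inverse (rcoset H' g))) \<partial>haar)"
    by (rule nn_integral_left_translate[OF F])
  also have "\<dots> = (\<integral>\<^sup>+C. ennreal (f (coset_inverse C)) \<partial>coset_measure fd haar H')"
    by (rule coset_integral_inverse[OF H' w f, symmetric])
  finally show ?thesis unfolding H'_def .
qed

text \<open>Apply the identity to a function \<open>f\<close> and to its right translate \<open>C \<mapsto> f(Ck)\<close>. The left sides are
  equal. On the right sides, the translation replaces \<open>H\<close> by \<open>k\<^sup>-\<^sup>1Hk\<close>. A set \<open>A\<close> of subgroups is
  recovered by a function \<open>f\<close> that depends on \<open>C = g\<^sup>-\<^sup>1H\<close> mostly through \<open>C\<^sup>-\<^sup>1C = H\<close>.\<close>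

lemma invariant_if_coset_identity:
  assumes one: "AE H in \<Lambda>. \<forall>h\<in>H. \<mu> h = 1"
    and identity: "\<And>f :: 'g set \<Rightarrow> real. f \<in> borel_measurable Cos \<Longrightarrow> (\<And>C. 0 \<le> f C) \<Longrightarrow>
      (\<integral>\<^sup>+H. (\<integral>\<^sup>+C. ennreal (f C * modular_on_coset \<mu> C) \<partial>coset_measure fd haar H) \<partial>\<Lambda>) =
      (\<integral>\<^sup>+H. (\<integral>\<^sup>+C. ennreal (f (coset_inverse C)) \<partial>coset_measure fd haar H) \<partial>\<Lambda>)"
  shows "conjugation_invariant \<Lambda>"
  unfolding conjugation_invariant_def
proof (intro allI ballI)
  fix k :: 'g and A assume A: "A \<in> sets \<Lambda>"
  obtain V :: "'g set" where V: "open V" "compact (closure V)" "0 \<in> V" and sym: "\<And>x. - x \<in> V \<longleftrightarrow> x \<in> V"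
    using symmetric_nbhd by metis
  have V_ne: "V \<noteq> {}" using V(3) by blast
  define B where "B = hit_mass fd V"
  have B_meas [measurable]: "B \<in> borel_measurable Sub"
    using measurable_hit_mass[OF V(1)] unfolding B_def by (simp add: measurable_cong_sets[OF sets_\<Lambda> refl])
  have A_meas [measurable]: "A \<in> sets Sub" using A sets_\<Lambda> by simp
  have hit_meas [measurable]: "{C \<in> space Cos. C \<inter> V \<noteq> {}} \<in> sets Cos" by (rule Cos_sets_hit[OF V(1)])
  define f :: "'g set \<Rightarrow> real" where "f C = indicator {C \<in> space Cos. C \<inter> V \<noteq> {}} C *
    (indicator A (right_stabilizer C) * enn2real (1 / B (right_stabilizer C)))" for C
  have f: "f \<in> borel_measurable Cos" unfolding f_def by measurable
  have f_nonneg: "0 \<le> f C" for C by (simp add: f_def)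
  define fk where "fk C = f ((\<lambda>x. x + k) ` C)" for C
  have fk: "fk \<in> borel_measurable Cos"
    unfolding fk_def by (rule measurable_compose[OF measurable_coset_translate f])
  \<comment> \<open>Restricting to the cosets that meet \<open>V\<close> makes the inner integral finite, and dividing by
    their mass makes it \<open>1\<close> for \<open>H \<in> A\<close>.\<close>
  have R: "(\<integral>\<^sup>+C. ennreal (f (coset_inverse C)) \<partial>coset_measure fd haar H) = indicator A H" if H: "tame H" for H
  proof -
    have cH: "H \<in> closed_subgroups" using H by (simp add: tame_def)
    have BH: "0 < B H" "B H < \<infinity>" unfolding B_def using hit_mass_bounds[OF H V(1,2) V_ne] by auto
    have stab: "right_stabilizer (coset_inverse (rcoset H g)) = H" for g
      unfolding coset_inverse_eq_rcoset[OF cH] right_stabilizer_rcoset[OF conjugate_closed_subgroup[OF cH]]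
      by (simp add: conjugate_conjugate)
    have "coset_inverse (rcoset H g) \<in> space Cos" for g
      unfolding coset_inverse_eq_rcoset[OF cH] space_borel_of topspace_coset
      using conjugate_closed_subgroup[OF cH] by blast
    moreover have "coset_inverse (rcoset H g) \<inter> V \<noteq> {} \<longleftrightarrow> rcoset H g \<inter> V \<noteq> {}" for g
      using sym by (force simp: coset_inverse_def)
    moreover have "ennreal (enn2real (1 / B H)) = 1 / B H"
      using BH by (intro ennreal_enn2real) (simp add: ennreal_divide_eq_top_iff less_top[symmetric])
    ultimately have "ennreal (f (coset_inverse (rcoset H g)))
        = indicator {g. rcoset H g \<inter> V \<noteq> {}} g * (indicator A H * (1 / B H))" for g
      unfolding f_def stab by (simp add: indicator_def)
    then have "(\<integral>\<^sup>+C. ennreal (f (coset_inverse C)) \<partial>coset_measure fd haar H)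
        = (\<integral>\<^sup>+g. (weight fd (rcoset H g) g * indicator {g. rcoset H g \<inter> V \<noteq> {}} g) * (indicator A H * (1 / B H)) \<partial>haar)"
      unfolding coset_integral_inverse[OF H unit_density_weight[OF H] f] by (simp add: mult.assoc)
    also have "\<dots> = B H * (indicator A H * (1 / B H))"
      unfolding B_def hit_mass_def
    proof (rule nn_integral_multc)
      have [measurable]: "{g. rcoset H g \<inter> V \<noteq> {}} \<in> sets borel"
        "(\<lambda>g. weight fd (rcoset H g) g) \<in> borel_measurable borel"
        using open_rcoset_hit[OF V(1), of H] unit_density_weight[OF H, of fd] by (simp_all add: unit_density_def)
      show "(\<lambda>g. weight fd (rcoset H g) g * indicator {g. rcoset H g \<inter> V \<noteq> {}} g) \<in> borel_measurable haar"
        by measurable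
    qed
    also have "\<dots> = indicator A H * (B H / B H)"
      by (simp add: divide_ennreal_def mult_ac)
    also have "B H / B H = 1" using BH by (intro ennreal_divide_self) auto
    finally show ?thesis by simp
  qed
  have "conjugate k ` A = conjugate (- k) -` A \<inter> space \<Lambda>"
    using conjugate_image_eq[of A k] sets.sets_into_space[OF A] by (simp add: space_\<Lambda>)
  then have A': "conjugate k ` A \<in> sets \<Lambda>"
    "\<And>H. H \<in> space \<Lambda> \<Longrightarrow> H \<in> conjugate k ` A \<longleftrightarrow> conjugate (- k) H \<in> A"
    using measurable_sets[OF measurable_conjugate_at A, of "- k"] by auto
  have "emeasure \<Lambda> A = (\<integral>\<^sup>+H. indicator A H \<partial>\<Lambda>)" using A by simp
  also have "\<dots> = (\<integral>\<^sup>+H. (\<integral>\<^sup>+C. ennreal (f (coset_inverse C)) \<partial>coset_measure fd haar H) \<partial>\<Lambda>)"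
    using AE_tame by (intro nn_integral_cong_AE, eventually_elim) (simp add: R)
  also have "\<dots> = (\<integral>\<^sup>+H. (\<integral>\<^sup>+C. ennreal (f C * modular_on_coset \<mu> C) \<partial>coset_measure fd haar H) \<partial>\<Lambda>)"
    by (rule identity[OF f f_nonneg, symmetric])
  also have "\<dots> = (\<integral>\<^sup>+H. (\<integral>\<^sup>+C. ennreal (fk C * modular_on_coset \<mu> C) \<partial>coset_measure fd haar H) \<partial>\<Lambda>)"
    using AE_tame one unfolding fk_def
    by (intro nn_integral_cong_AE, eventually_elim) (simp add: coset_integral_modular_translate[OF _ _ f])
  also have "\<dots> = (\<integral>\<^sup>+H. (\<integral>\<^sup>+C. ennreal (fk (coset_inverse C)) \<partial>coset_measure fd haar H) \<partial>\<Lambda>)"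
    by (rule identity[OF fk]) (simp add: fk_def f_nonneg)
  also have "\<dots> = (\<integral>\<^sup>+H. indicator (conjugate k ` A) H \<partial>\<Lambda>)"
    using AE_tame AE_space unfolding fk_def
    by (intro nn_integral_cong_AE, eventually_elim)
      (simp add: coset_integral_inverse_translate[OF _ f] R[OF tame_conjugate] A'(2) indicator_def)
  also have "\<dots> = emeasure \<Lambda> (conjugate k ` A)" using A'(1) by simp
  finally show "emeasure \<Lambda> (conjugate k ` A) = emeasure \<Lambda> A" by simp
qed

end

theorem theorem5p2:
  fixes haar :: "'g::{topological_group_add, t2_space, second_countable_topology} measure"
    and \<mu> :: "'g \<Rightarrow> real"
    and \<Lambda> :: "'g set measure"
    and fin_discrete :: bool
  assumes "locally_compact_space (euclidean :: 'g topology)"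
    and "left_haar_measure haar"
    and "modular_function haar \<mu>"
    and "sets \<Lambda> = sets (borel_of chabauty_topology)"
    and "sigma_finite_measure \<Lambda>"
    and "AE H in \<Lambda>. discrete H \<or> compact H"
  shows "conjugation_invariant \<Lambda> \<longleftrightarrow>
    (AE H in \<Lambda>. \<forall>h\<in>H. \<mu> h = 1) \<and>
    (\<forall>f :: 'g set \<Rightarrow> real.
       f \<in> borel_measurable (borel_of coset_topology) \<longrightarrow>
       (\<forall>C\<in>topspace coset_topology. 0 \<le> f C) \<longrightarrow>
       (\<integral>\<^sup>+H. (\<integral>\<^sup>+C. ennreal (f C * modular_on_coset \<mu> C) \<partial>coset_measure fin_discrete haar H) \<partial>\<Lambda>) =
       (\<integral>\<^sup>+H. (\<integral>\<^sup>+C. ennreal (f (coset_inverse C)) \<partial>coset_measure fin_discrete haar H) \<partial>\<Lambda>))"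
proof -
  interpret subgroup_measure haar \<mu> \<Lambda>
    by (intro subgroup_measure.intro haar_modular.intro haar_group.intro haar_modular_axioms.intro
        subgroup_measure_axioms.intro assms)
  show ?thesis
  proof (intro iffI conjI allI impI)
    assume inv: "conjugation_invariant \<Lambda>"
    then show one: "AE H in \<Lambda>. \<forall>h\<in>H. \<mu> h = 1" by (rule AE_modular_eq_1)
    fix f :: "'g set \<Rightarrow> real" assume "f \<in> borel_measurable (borel_of coset_topology)"
    with inv one show "(\<integral>\<^sup>+H. (\<integral>\<^sup>+C. ennreal (f C * modular_on_coset \<mu> C) \<partial>coset_measure fin_discrete haar H) \<partial>\<Lambda>) =
       (\<integral>\<^sup>+H. (\<integral>\<^sup>+C. ennreal (f (coset_inverse C)) \<partial>coset_measure fin_discrete haar H) \<partial>\<Lambda>)"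
      by (rule coset_identity_if_invariant)
  next
    assume "(AE H in \<Lambda>. \<forall>h\<in>H. \<mu> h = 1) \<and>
      (\<forall>f :: 'g set \<Rightarrow> real.
       f \<in> borel_measurable (borel_of coset_topology) \<longrightarrow>
       (\<forall>C\<in>topspace coset_topology. 0 \<le> f C) \<longrightarrow>
       (\<integral>\<^sup>+H. (\<integral>\<^sup>+C. ennreal (f C * modular_on_coset \<mu> C) \<partial>coset_measure fin_discrete haar H) \<partial>\<Lambda>) =
       (\<integral>\<^sup>+H. (\<integral>\<^sup>+C. ennreal (f (coset_inverse C)) \<partial>coset_measure fin_discrete haar H) \<partial>\<Lambda>))"
    then show "conjugation_invariant \<Lambda>"
      by (intro invariant_if_coset_identity[where fd = fin_discrete]) auto
  qed
qed

end
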